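(* Assume that $d\ll n$ as $n\to\infty$. (i) If $\ln n\ll d$, then $$ \sqrt{\frac{d}{\ln(n/d)}}\;H_{\mathrm{typ}}\xrightarrow{P}\sqrt2 $$ (in particular $H_{\mathrm{typ}}$ approaches zero). (ii) If $(\ln n)/d\to\rho>0$, then $$ H_{\mathrm{typ}}\xrightarrow{P}\sqrt{1-e^{-2\rho}}. $$ (iii) If $\ln n\gg d$, then $$ -\frac{d-1}{\ln n}\,\ln\!\big(1-H_{\mathrm{typ}}^2\big)\xrightarrow{P}2 $$ (in particular $H_{\mathrm{typ}}$ approaches one). Here $\xrightarrow{P}$ denotes convergence in probability.
   Context: Asymptotic setting: $\mathbb{N}\ni n\to\infty$ and $d=d(n)\in\{2,\ldots,n-1\}$ is a function of $n$ which is either constant or tends to infinity. All limits are as $n\to\infty$. The notation $f\ll g$ (equivalently $g\gg f$) means $f(n)/g(n)\to0$. Let $X_1,\ldots,X_n$ be i.i.d. random vectors uniformly distributed on the unit sphere $\mathbb{S}^{d-1}\subset\mathbb{R}^d$, and let $P_{n,d}=[X_1,\ldots,X_n]$ be their convex hull. A facet ($(d-1)$-dimensional face) of $P_{n,d}$ has height $h\in[-1,1]$ if its supporting hyperplane is $\{x\in\mathbb{R}^d:\langle x,u\rangle=h\}$ for some $u\in\mathbb{S}^{d-1}$ and $P_{n,d}\subset\{x:\langle x,u\rangle\le h\}$ (heights can be negative). The typical height $H_{\mathrm{typ}}$ (depending on $n,d$) is the random variable with distribution $$\mathbb{P}(H_{\mathrm{typ}}\in\cdot)=\mathbb{P}\big([X_1,\ldots,X_d]\text{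 has height in }\cdot \;\big|\; [X_1,\ldots,X_d]\text{ is a facet of }P_{n,d}\big).$$ *)

theory Defs
  imports "HOL-Probability.Probability" "HOL-Library.Function_Algebras"
begin

text \<open>
  The dimension \<open>d\<close> varies with \<open>n\<close>, so it cannot be a type. Euclidean space of dimension \<open>d\<close> is
  taken to be the set of all \<open>x :: nat \<Rightarrow> real\<close> that vanish on all indices \<open>i \<ge> d\<close>, with the
  pointwise vector space structure and, as \<open>\<sigma>\<close>-algebra, the Borel sets of the product
  topology, which induces the usual topology on this subspace. The instance below makes
  \<^const>\<open>hull\<close>, \<^const>\<open>convex\<close>, \<^const>\<open>affine\<close>, \<^const>\<open>affine_dependent\<close>
  and \<^const>\<open>face_of\<close> from the library available for such vectors.
\<close>

instantiation "fun" :: (type, real_vector) real_vector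
begin

definition scaleR_fun :: "real \<Rightarrow> ('a \<Rightarrow> 'b) \<Rightarrow> 'a \<Rightarrow> 'b"
  where "scaleR_fun r f = (\<lambda>x. r *\<^sub>R f x)"

instance
  by standard (auto simp: scaleR_fun_def fun_eq_iff scaleR_right_distrib scaleR_left_distrib)

end

definition Rspace :: "nat \<Rightarrow> (nat \<Rightarrow> real) set"
  where "Rspace d = {x. \<forall>i\<ge>d. x i = 0}"

definition ip :: "nat \<Rightarrow> (nat \<Rightarrow> real) \<Rightarrow> (nat \<Rightarrow> real) \<Rightarrow> real"
  where "ip d x y = (\<Sum>i<d. x i * y i)"

definition usphere :: "nat \<Rightarrow> (nat \<Rightarrow> real) set"
  where "usphere d = {x \<in> Rspace d. ip d x x = 1}"

text \<open>
  The normalized surface measure on the unit sphere: the measure of a set \<open>A\<close> is the volume of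
  the cone \<open>{r x | x \<in> A, 0 < r \<le> 1}\<close> divided by the volume of the unit ball, i.e. it is the
  image of the uniform distribution on the unit ball under radial projection \<open>x \<mapsto> x / |x|\<close>.
  The library's product measure lives on functions that are \<^const>\<open>undefined\<close>
  outside of \<open>{..<d}\<close>; \<open>radial_proj\<close> also moves these into \<^const>\<open>Rspace\<close>.
\<close>

definition unit_ball_PiM :: "nat \<Rightarrow> (nat \<Rightarrow> real) set"
  where "unit_ball_PiM d = {x \<in> space (Pi\<^sub>M {..<d} (\<lambda>_. lborel)). ip d x x \<le> 1}"

definition radial_proj :: "nat \<Rightarrow> (nat \<Rightarrow> real) \<Rightarrow> nat \<Rightarrow> real"
  where "radial_proj d x = (\<lambda>i. if i < d then x i / sqrt (ip d x x) else 0)"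

definition unif_sphere :: "nat \<Rightarrow> (nat \<Rightarrow> real) measure"
  where "unif_sphere d =
    distr (uniform_measure (Pi\<^sub>M {..<d} (\<lambda>_. lborel)) (unit_ball_PiM d)) borel (radial_proj d)"

definition iid_unif_sphere ::
    "'a measure \<Rightarrow> (nat \<Rightarrow> 'a \<Rightarrow> nat \<Rightarrow> real) \<Rightarrow> nat \<Rightarrow> nat \<Rightarrow> bool"
  where "iid_unif_sphere M X n d \<longleftrightarrow>
    prob_space M \<and>
    prob_space.indep_vars M (\<lambda>_. borel) X {..<n} \<and>
    (\<forall>i<n. distr M borel (X i) = unif_sphere d)"

text \<open>
  \<^const>\<open>aff_dim\<close> and \<^const>\<open>facet_of\<close> are restricted to Euclidean space types.
  A facet is here a face of dimension exactly \<open>d - 1\<close> (not relative to the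
  dimension of the polytope).
\<close>

definition has_aff_dim :: "'a::real_vector set \<Rightarrow> nat \<Rightarrow> bool"
  where "has_aff_dim S k \<longleftrightarrow>
    (\<exists>B. finite B \<and> affine hull B = affine hull S \<and> \<not> affine_dependent B \<and> card B = k + 1)"

definition is_facet :: "nat \<Rightarrow> (nat \<Rightarrow> real) set \<Rightarrow> (nat \<Rightarrow> real) set \<Rightarrow> bool"
  where "is_facet d F P \<longleftrightarrow> F face_of P \<and> has_aff_dim F (d - 1)"

text \<open>
  The facet \<open>F\<close> determines \<open>h\<close> whenever the polytope \<open>P\<close> has full dimension \<open>d\<close>.
\<close>

definition facet_height ::
    "nat \<Rightarrow> (nat \<Rightarrow> real) set \<Rightarrow> (nat \<Rightarrow> real) set \<Rightarrow> real \<Rightarrow> bool"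
  where "facet_height d F P h \<longleftrightarrow>
    is_facet d F P \<and> h \<in> {-1..1} \<and>
    (\<exists>u \<in> usphere d.
       P \<subseteq> {x \<in> Rspace d. ip d x u \<le> h} \<and>
       F = P \<inter> {x \<in> Rspace d. ip d x u = h})"

definition hull_first :: "(nat \<Rightarrow> 'a \<Rightarrow> nat \<Rightarrow> real) \<Rightarrow> nat \<Rightarrow> 'a \<Rightarrow> (nat \<Rightarrow> real) set"
  where "hull_first X k \<omega> = convex hull ((\<lambda>i. X i \<omega>) ` {..<k})"

text \<open>
  \<open>H\<close> is a random variable on \<open>N\<close> (not necessarily the space \<open>M\<close> carrying the sample) whose
  law is that of the typical height of the convex hull of \<open>X 0, \<dots>, X (n - 1)\<close>.
\<close>

definition typical_height ::
    "'a measure \<Rightarrow> (nat \<Rightarrow> 'a \<Rightarrow> nat \<Rightarrow> real) \<Rightarrow> nat \<Rightarrow> nat \<Rightarrow> 'b measure \<Rightarrow> ('b \<Rightarrow> real) \<Rightarrow> bool"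
  where "typical_height M X n d N H \<longleftrightarrow>
    prob_space N \<and> H \<in> borel_measurable N \<and>
    (\<forall>B \<in> sets borel.
       \<P>(\<omega> in N. H \<omega> \<in> B) =
       \<P>(\<omega> in M. (\<exists>h\<in>B. facet_height d (hull_first X d \<omega>) (hull_first X n \<omega>) h)
          \<bar> is_facet d (hull_first X d \<omega>) (hull_first X n \<omega>)))"

definition conv_in_prob :: "(nat \<Rightarrow> 'b measure) \<Rightarrow> (nat \<Rightarrow> 'b \<Rightarrow> real) \<Rightarrow> real \<Rightarrow> bool"
  where "conv_in_prob N Y c \<longleftrightarrow>
    (\<forall>\<epsilon>>0. (\<lambda>n. \<P>(\<omega> in N n. \<bar>Y n \<omega> - c\<bar> > \<epsilon>)) \<longlonglongrightarrow> 0)"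

end

theory Submission
  imports Defs "HOL-Real_Asymp.Real_Asymp"
begin

text \<open>
  Let \<open>E\<close> be the event that \<open>X 0, \<dots>, X (d - 1)\<close> span a facet. Almost surely the points are in
  general position and \<open>X 0\<close> lies in some facet with exactly \<open>d\<close> vertices, so by exchangeability
  \<open>1 / P(E)\<close> is at most \<open>(n - 1) choose (d - 1) \<le> (e n / d)\<^sup>d\<close>. Hence it suffices to find
  thresholds \<open>s < t\<close> such that \<open>P(E, height < s)\<close> and \<open>P(E, height > t)\<close> are of smaller order;
  the exact density of the height is not needed.

  If the height is below \<open>s\<close>, the other \<open>n - d\<close> points avoid one of the two caps of height \<open>s\<close>
  determined by the first \<open>d\<close> points, which has probability at most \<open>2 (1 - q)\<^bsup>n - d\<^esup>\<close>, where
  \<open>q\<close> is the measure of the cap, about \<open>(1 - s\<^sup>2)\<^bsup>d / 2\<^esup>\<close>. If the height exceeds \<open>t\<close>, the first \<open>d\<close>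
  points lie in a common cap of height \<open>t\<close>. For \<open>ln n \<gg> d\<close> it is enough that they are then close
  to \<open>X 0\<close>. Otherwise an average over perturbed directions replaces the unknown direction by a fixed
  one at the price of a factor exponential in \<open>d\<close>; for \<open>ln n \<ll> d\<close> the direction has to be that of
  \<open>\<Sum>i<d. X i\<close>, and a Chernoff bound for the squares of the projections applies.
\<close>

text \<open>The thresholds come from balancing exponents. A cap of height t has measure about (1 -
  t^2)^(d/2), so \<open>d\<close> independent points fall into one fixed cap with probability about
  (1 - t^2)^(d^2/2). This beats the factor (e n / d)^d once (1 - t^2)^(d/2) is clearly below d/n; if
  it is clearly above, q n is far larger than d ln(n/d) and exp (- q n / 2) wins. The break-even 1 -
  t^2 = (d/n)^(2/d), up to lower-order corrections, yields all three limits. When \<open>d\<close>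
  may stay bounded, one unit in an exponent matters and \<open>d - 1\<close> has to replace
  \<open>d\<close>, which calls for sharper forms of the bounds.

  The obstacle in the high tail is that the direction of the cap depends on the points themselves.
  Moving it by e changes inner products by up to e. For fixed heights this is harmless, but when the
  height tends to 0, an e of the same order costs e^(- d), which may exceed the gain; only a
  direction for which the error is proportional to the height avoids this.

  Events that ask for a direction are handled through measurable events containing them or contained
  in them.\<close>

declare plus_fun_apply [simp del] zero_fun_apply [simp del] minus_apply [simp del]
  uminus_apply [simp del]

text \<open>Vector operations on functions stay folded by default so that the bilinearity rules for
  \<open>ip\<close> match; coordinates are exposed only where this bundle is given.\<close>

lemmas fun_apply = plus_fun_apply zero_fun_apply minus_apply uminus_apply scaleR_fun_def

section \<open>Volumes in coordinate space\<close>

abbreviation leb :: "nat \<Rightarrow> (nat \<Rightarrow> real) measure"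
  where "leb d \<equiv> Pi\<^sub>M {..<d} (\<lambda>_. lborel)"

definition nrm :: "nat \<Rightarrow> (nat \<Rightarrow> real) \<Rightarrow> real"
  where "nrm d x = sqrt (ip d x x)"

lemma ip_commute: "ip d x y = ip d y x"
  by (simp add: ip_def mult.commute)

lemma ip_linear [simp]:
  "ip d (x + y) z = ip d x z + ip d y z" "ip d z (x + y) = ip d z x + ip d z y"
  "ip d (x - y) z = ip d x z - ip d y z" "ip d z (x - y) = ip d z x - ip d z y"
  "ip d (a *\<^sub>R x) z = a * ip d x z" "ip d z (a *\<^sub>R x) = a * ip d z x"
  "ip d (- x) z = - ip d x z" "ip d z (- x) = - ip d z x"
  "ip d 0 z = 0" "ip d z 0 = 0"
  by (simp_all add: ip_def algebra_simps sum.distrib sum_subtractf sum_distrib_left sum_negf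
        fun_apply)

lemma ip_restrict [simp]:
  "ip d (restrict x {..<d}) y = ip d x y" "ip d y (restrict x {..<d}) = ip d y x"
  by (simp_all add: ip_def)

lemma ip_sum_left: "ip d (sum f A) z = (\<Sum>i\<in>A. ip d (f i) z)"
  by (induction A rule: infinite_finite_induct) auto

lemma ip_self_nonneg [simp]: "0 \<le> ip d x x"
  by (auto simp: ip_def intro: sum_nonneg)

lemma ip_self_eq_0_iff: "ip d x x = 0 \<longleftrightarrow> (\<forall>i<d. x i = 0)"
  by (auto simp: ip_def sum_nonneg_eq_0_iff)

lemma nrm_eq_L2_set: "nrm d x = L2_set x {..<d}"
  by (simp add: nrm_def ip_def L2_set_def power2_eq_square)

lemma nrm_nonneg [simp]: "0 \<le> nrm d x"
  by (simp add: nrm_def)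

lemma nrm_power2 [simp]: "(nrm d x)\<^sup>2 = ip d x x"
  by (simp add: nrm_def)

lemma abs_ip_le_nrm: "\<bar>ip d x y\<bar> \<le> nrm d x * nrm d y"
proof -
  have "\<bar>ip d x y\<bar> \<le> (\<Sum>i<d. \<bar>x i\<bar> * \<bar>y i\<bar>)"
    unfolding ip_def using sum_abs[of "\<lambda>i. x i * y i" "{..<d}"] by (simp only: abs_mult)
  also have "\<dots> \<le> L2_set x {..<d} * L2_set y {..<d}"
    by (rule L2_set_mult_ineq)
  finally show ?thesis
    by (simp only: nrm_def ip_def L2_set_def power2_eq_square)
qed

lemma ip_le_nrm: "ip d x y \<le> nrm d x * nrm d y"
  using abs_ip_le_nrm[of d x y] by linarith

lemma nrm_scaleR [simp]: "nrm d (a *\<^sub>R x) = \<bar>a\<bar> * nrm d x"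
proof -
  have "ip d (a *\<^sub>R x) (a *\<^sub>R x) = a\<^sup>2 * ip d x x"
    by (simp add: power2_eq_square)
  then show ?thesis
    by (simp only: nrm_def real_sqrt_mult real_sqrt_abs)
qed

lemma nrm_restrict [simp]: "nrm d (restrict x {..<d}) = nrm d x"
  by (simp add: nrm_def)

lemma nrm_triangle: "nrm d (x + y) \<le> nrm d x + nrm d y"
  using L2_set_triangle_ineq[of x y "{..<d}"]
  by (simp add: nrm_def ip_def L2_set_def power2_eq_square fun_apply)

lemma nrm_usphere: "u \<in> usphere d \<Longrightarrow> nrm d u = 1"
  by (simp add: usphere_def nrm_def)

lemma measurable_component_leb [measurable]: "i < d \<Longrightarrow> (\<lambda>x. x i) \<in> borel_measurable (leb d)"
  by (metis lborelD lessThan_iff measurable_component_singleton measurable_lborel1 sets_lborel measurable_cong_sets)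

lemma measurable_coordinate_borel: "(\<lambda>x::nat \<Rightarrow> real. x i) \<in> borel_measurable borel"
  by (intro borel_measurable_continuous_onI continuous_on_product_coordinates)

lemma measurable_ip:
  assumes "\<And>i. i < d \<Longrightarrow> (\<lambda>\<omega>. f \<omega> i) \<in> borel_measurable M"
    and "\<And>i. i < d \<Longrightarrow> (\<lambda>\<omega>. g \<omega> i) \<in> borel_measurable M"
  shows "(\<lambda>\<omega>. ip d (f \<omega>) (g \<omega>)) \<in> borel_measurable M"
  unfolding ip_def using assms by (intro borel_measurable_sum borel_measurable_times) auto

lemma borel_measurable_sqrt_comp [measurable (raw)]:
  "f \<in> borel_measurable M \<Longrightarrow> (\<lambda>x. sqrt (f x :: real)) \<in> borel_measurable M"
  by simp

lemma measurable_ip_borel [measurable]: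
  "(\<lambda>x. ip d x v) \<in> borel_measurable borel" "(\<lambda>x. ip d v x) \<in> borel_measurable borel"
  "(\<lambda>x. ip d x x) \<in> borel_measurable borel" "(\<lambda>x. nrm d x) \<in> borel_measurable borel"
  unfolding nrm_def
  by (intro borel_measurable_sqrt_comp measurable_ip measurable_coordinate_borel borel_measurable_const)+

lemma measurable_ip_leb [measurable]:
  "(\<lambda>x. ip d x v) \<in> borel_measurable (leb d)" "(\<lambda>x. ip d v x) \<in> borel_measurable (leb d)"
  "(\<lambda>x. ip d x x) \<in> borel_measurable (leb d)" "(\<lambda>x. nrm d x) \<in> borel_measurable (leb d)"
  unfolding nrm_def
  by (intro borel_measurable_sqrt_comp measurable_ip measurable_component_leb borel_measurable_const; simp)+

text \<open>Both sides agree on boxes, by the one-dimensional affine formula in each coordinate, and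
  \<open>PiM_eqI\<close> extends this to all measurable sets. \<open>restrict\<close> brings the
  image back into \<open>space (leb d)\<close>, whose elements are \<open>undefined\<close> beyond
  \<open>{..<d}\<close>.\<close>

lemma emeasure_leb_affine:
  assumes r: "r \<noteq> 0" and A: "A \<in> sets (leb d)"
  shows "emeasure (leb d) A =
    ennreal (\<bar>r\<bar> ^ d) * emeasure (leb d) {x \<in> space (leb d). restrict (c + r *\<^sub>R x) {..<d} \<in> A}"
proof -
  interpret product_sigma_finite "\<lambda>_::nat. lborel :: real measure" by standard
  let ?T = "\<lambda>x. restrict (c + r *\<^sub>R x) {..<d}"
  have T: "?T \<in> leb d \<rightarrow>\<^sub>M leb d"
    by (intro measurable_restrict) (auto simp: fun_apply)
  let ?P = "scale_measure (ennreal (\<bar>r\<bar> ^ d)) (distr (leb d) (leb d) ?T)"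
  have "?P = leb d"
  proof (rule PiM_eqI)
    fix B :: "nat \<Rightarrow> real set" assume B: "\<And>i. i \<in> {..<d} \<Longrightarrow> B i \<in> sets lborel"
    have *: "?T -` Pi\<^sub>E {..<d} B \<inter> space (leb d) = Pi\<^sub>E {..<d} (\<lambda>i. (\<lambda>t. c i + r * t) -` B i)"
      by (auto simp: space_PiM fun_apply PiE_iff)
    have pre: "(\<lambda>t. c i + r * t) -` B i \<in> sets borel" if "i < d" for i
      using B[of i] that by (auto intro!: measurable_sets_borel[of _ borel])
    have one: "emeasure lborel (B i) = ennreal \<bar>r\<bar> * emeasure lborel ((\<lambda>t. c i + r * t) -` B i)"
      if "i < d" for i
      using B[of i] that pre[of i] by (subst lborel_real_affine[OF r, of "c i"])
        (simp add: emeasure_density emeasure_distr nn_integral_cmult nn_integral_cmult_indicator)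
    have "emeasure ?P (Pi\<^sub>E {..<d} B)
        = ennreal (\<bar>r\<bar> ^ d) * emeasure (leb d) (Pi\<^sub>E {..<d} (\<lambda>i. (\<lambda>t. c i + r * t) -` B i))"
      using B T by (simp add: emeasure_distr sets_PiM_I_finite *)
    also have "\<dots> = (\<Prod>i<d. ennreal \<bar>r\<bar> * emeasure lborel ((\<lambda>t. c i + r * t) -` B i))"
      using pre by (subst emeasure_PiM) (auto simp: prod.distrib ennreal_power)
    finally show "emeasure ?P (Pi\<^sub>E {..<d} B) = (\<Prod>i<d. emeasure lborel (B i))"
      using one by simp
  qed auto
  then have "emeasure (leb d) A = emeasure ?P A"
    by simp
  also have "\<dots> = ennreal (\<bar>r\<bar> ^ d) * emeasure (leb d) (?T -` A \<inter> space (leb d))"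
    using A T by (simp add: emeasure_distr)
  also have "?T -` A \<inter> space (leb d) = {x \<in> space (leb d). ?T x \<in> A}"
    by auto
  finally show ?thesis .
qed

lemma measure_leb_affine:
  assumes "r \<noteq> 0" "A \<in> sets (leb d)"
  shows "measure (leb d) A =
    \<bar>r\<bar> ^ d * measure (leb d) {x \<in> space (leb d). restrict (c + r *\<^sub>R x) {..<d} \<in> A}"
  using emeasure_leb_affine[OF assms, of c] by (simp add: measure_def enn2real_mult)

definition bll :: "nat \<Rightarrow> (nat \<Rightarrow> real) \<Rightarrow> real \<Rightarrow> (nat \<Rightarrow> real) set"
  where "bll d c r = {x \<in> space (leb d). nrm d (x - c) \<le> r}"

lemma mem_bll_0: "x \<in> bll d 0 r \<longleftrightarrow> x \<in> space (leb d) \<and> nrm d x \<le> r"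
  unfolding bll_def by simp

lemma bll_sets [measurable]: "bll d c r \<in> sets (leb d)"
proof -
  have "(\<lambda>x. nrm d (x - c)) \<in> borel_measurable (leb d)"
    unfolding nrm_def by (intro borel_measurable_sqrt_comp measurable_ip) (auto simp: fun_apply)
  then show ?thesis unfolding bll_def by measurable
qed

abbreviation bvol :: "nat \<Rightarrow> real"
  where "bvol d \<equiv> unit_ball_vol (real d)"

lemma bvol_pos [simp]: "0 < bvol d" "bvol d \<noteq> 0"
  using unit_ball_vol_pos[of "real d"] by (simp, linarith)

lemma emeasure_bll:
  assumes "0 < r"
  shows "emeasure (leb d) (bll d c r) = ennreal (bvol d * r ^ d)"
proof -
  have "emeasure (leb d) (bll d c r)
      = emeasure (leb d) {x \<in> space (leb d). restrict (c + 1 *\<^sub>R x) {..<d} \<in> bll d c r}"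
    using emeasure_leb_affine[of 1 "bll d c r" d c] by simp
  also have "{x \<in> space (leb d). restrict (c + 1 *\<^sub>R x) {..<d} \<in> bll d c r}
      = {f. sqrt (\<Sum>i<d. (f i)\<^sup>2) \<le> r} \<inter> space (leb d)"
  proof -
    have "nrm d (restrict (c + 1 *\<^sub>R x) {..<d} - c) = sqrt (\<Sum>i<d. (x i)\<^sup>2)" for x
      by (simp add: nrm_eq_L2_set fun_apply L2_set_def)
    then show ?thesis
      by (auto simp: bll_def space_PiM)
  qed
  also have "emeasure (leb d) \<dots> = ennreal (bvol d * r ^ d)"
    using emeasure_cball_aux[of "{..<d}" r] assms by simp
  finally show ?thesis .
qed

lemma bll_fmeasurable: "bll d c r \<in> fmeasurable (leb d)"
proof -
  \<comment> \<open>The enlarged radius is positive, as \<open>emeasure_bll\<close> requires;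
    \<open>r\<close> itself may be zero or negative.\<close>
  have "bll d c r \<subseteq> bll d c (\<bar>r\<bar> + 1)"
    by (auto simp: bll_def)
  then have "emeasure (leb d) (bll d c r) \<le> emeasure (leb d) (bll d c (\<bar>r\<bar> + 1))"
    by (intro emeasure_mono) auto
  also have "\<dots> < \<infinity>"
    by (subst emeasure_bll) auto
  finally show ?thesis
    by (auto intro: fmeasurableI)
qed

lemma measure_bll: "0 < r \<Longrightarrow> measure (leb d) (bll d c r) = bvol d * r ^ d"
  by (simp add: measure_def emeasure_bll)

lemma measure_le_bll:
  assumes "A \<subseteq> bll d c r" "0 < r" "A \<in> sets (leb d)"
  shows "measure (leb d) A \<le> bvol d * r ^ d"
  using measure_mono_fmeasurable[OF assms(1,3) bll_fmeasurable] measure_bll[OF assms(2)] by simp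

lemma fmeasurable_subset_bll: "A \<subseteq> bll d c r \<Longrightarrow> A \<in> sets (leb d) \<Longrightarrow> A \<in> fmeasurable (leb d)"
  using bll_fmeasurable fmeasurableI2 by blast

section \<open>The uniform distribution on the sphere\<close>

lemma unit_ball_PiM_eq: "unit_ball_PiM d = bll d 0 1"
  by (auto simp: unit_ball_PiM_def bll_def nrm_def)

lemma radial_proj_measurable [measurable]: "radial_proj d \<in> leb d \<rightarrow>\<^sub>M borel"
proof (rule measurable_coordinatewise_then_product)
  fix i show "(\<lambda>x. radial_proj d x i) \<in> borel_measurable (leb d)"
    by (cases "i < d") (auto simp: radial_proj_def)
qed

lemma sets_unif_sphere [simp, measurable_cong]: "sets (unif_sphere d) = sets borel"
  by (simp add: unif_sphere_def)

lemma space_unif_sphere [simp]: "space (unif_sphere d) = UNIV"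
  by (simp add: unif_sphere_def)

lemma emeasure_bll_unit: "emeasure (leb d) (bll d 0 1) = ennreal (bvol d)"
  using emeasure_bll[of 1 d 0] by simp

lemma prob_space_unif_sphere: "prob_space (unif_sphere d)"
  unfolding unif_sphere_def unit_ball_PiM_eq
  by (intro prob_space.prob_space_distr prob_space_uniform_measure)
     (auto simp: emeasure_bll_unit)

lemma measure_unif_sphere:
  assumes [measurable]: "A \<in> sets borel"
  shows "measure (unif_sphere d) A = measure (leb d) {x \<in> bll d 0 1. radial_proj d x \<in> A} / bvol d"
proof -
  have "radial_proj d \<in> uniform_measure (leb d) (bll d 0 1) \<rightarrow>\<^sub>M borel"
    by (subst measurable_cong_sets[OF sets_uniform_measure refl]) (rule radial_proj_measurable)
  then have "measure (unif_sphere d) A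
      = measure (uniform_measure (leb d) (bll d 0 1)) (radial_proj d -` A \<inter> space (leb d))"
    unfolding unif_sphere_def unit_ball_PiM_eq by (simp only: measure_distr[OF _ assms] space_uniform_measure)
  also have "\<dots> = measure (leb d) (bll d 0 1 \<inter> (radial_proj d -` A \<inter> space (leb d))) / bvol d"
    using measurable_sets[OF radial_proj_measurable assms]
    by (subst measure_uniform_measure) (simp_all add: emeasure_bll_unit measure_bll)
  also have "bll d 0 1 \<inter> (radial_proj d -` A \<inter> space (leb d)) = {x \<in> bll d 0 1. radial_proj d x \<in> A}"
    by (auto simp: bll_def)
  finally show ?thesis .
qed

lemma radial_proj_scale:
  assumes "0 < r"
  shows "radial_proj d (r *\<^sub>R x) = radial_proj d x"
proof -
  have "sqrt (ip d (r *\<^sub>R x) (r *\<^sub>R x)) = r * sqrt (ip d x x)"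
    using nrm_scaleR[of d r x] assms unfolding nrm_def by (simp only: abs_of_pos)
  then show ?thesis
    using assms by (intro ext) (simp only: radial_proj_def fun_apply, simp)
qed

lemma radial_proj_restrict: "radial_proj d (restrict x {..<d}) = radial_proj d x"
  by (intro ext) (simp add: radial_proj_def)

text \<open>Dilation by \<open>r\<close> maps the cone inside the unit ball onto the cone inside the
  ball of radius \<open>r\<close>, because \<open>radial_proj\<close> ignores positive
  factors.\<close>

lemma measure_cone_bll:
  assumes [measurable]: "A \<in> sets borel" and r: "0 < r"
  shows "measure (leb d) {x \<in> bll d 0 r. radial_proj d x \<in> A} = r ^ d * bvol d * measure (unif_sphere d) A"
proof -
  let ?C = "\<lambda>r. {x \<in> bll d 0 r. radial_proj d x \<in> A}"
  have [measurable]: "?C r \<in> sets (leb d)" for r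
    by measurable
  have "measure (leb d) (?C r) = r ^ d * measure (leb d) {x \<in> space (leb d). restrict (0 + r *\<^sub>R x) {..<d} \<in> ?C r}"
    using measure_leb_affine[of r "?C r" d 0] r by simp
  also have "{x \<in> space (leb d). restrict (0 + r *\<^sub>R x) {..<d} \<in> ?C r} = ?C 1"
    using r by (auto simp: bll_def radial_proj_restrict radial_proj_scale space_PiM)
  finally show ?thesis
    by (simp add: measure_unif_sphere)
qed

text \<open>All estimates of spherical measures below compare the part of a cone in a suitable shell
  with a ball.\<close>

lemma measure_cone_shell:
  assumes [measurable]: "A \<in> sets borel" and r: "0 \<le> r" "r < R" and d: "0 < d"
  shows "measure (leb d) {x \<in> space (leb d). r < nrm d x \<and> nrm d x \<le> R \<and> radial_proj d x \<in> A}
    = (R ^ d - r ^ d) * bvol d * measure (unif_sphere d) A"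
proof -
  let ?C = "\<lambda>r. {x \<in> bll d 0 r. radial_proj d x \<in> A}"
  have fm: "?C s \<in> fmeasurable (leb d)" for s
    by (rule fmeasurable_subset_bll[of _ d 0 s]) auto
  have r0: "measure (leb d) (?C r) = r ^ d * bvol d * measure (unif_sphere d) A"
  proof (cases "r = 0")
    case True
    have "measure (leb d) (?C 0) \<le> 0"
    proof (rule tendsto_lowerbound)
      show "(\<lambda>k. bvol d * inverse (real (Suc k)) ^ d) \<longlonglongrightarrow> 0"
        using tendsto_mult[OF tendsto_const tendsto_power[OF LIMSEQ_inverse_real_of_nat, of d], of "bvol d"] d
        by (simp add: power_0_left)
      show "\<forall>\<^sub>F k in sequentially. measure (leb d) (?C 0) \<le> bvol d * inverse (real (Suc k)) ^ d"
        by (intro always_eventually allI measure_le_bll[of _ d 0])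
           (auto simp: bll_def intro: order_trans)
    qed simp
    then show ?thesis using True d measure_nonneg[of "leb d" "?C 0"] by (simp add: power_0_left)
  qed (use r in \<open>simp add: measure_cone_bll\<close>)
  have "{x \<in> space (leb d). r < nrm d x \<and> nrm d x \<le> R \<and> radial_proj d x \<in> A} = ?C R - ?C r"
    using r by (auto simp: mem_bll_0)
  moreover have "measure (leb d) (?C R - ?C r) = measure (leb d) (?C R) - measure (leb d) (?C r)"
  proof (rule measure_Diff[of "leb d" "?C R" "?C r"])
    show "emeasure (leb d) (?C R) \<noteq> \<infinity>"
      using fmeasurableD2[OF fm[of R]] by simp
    show "?C r \<subseteq> ?C R"
      using r by (auto simp: mem_bll_0)
  qed (rule fmeasurableD[OF fm])+
  ultimately show ?thesis
    using r by (simp add: r0 measure_cone_bll algebra_simps)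
qed

lemma nrm_cong: "(\<And>i. i < d \<Longrightarrow> x i = y i) \<Longrightarrow> nrm d x = nrm d y"
  by (simp add: nrm_eq_L2_set L2_set_def)

lemma ip_cong: "(\<And>i. i < d \<Longrightarrow> x i = x' i) \<Longrightarrow> (\<And>i. i < d \<Longrightarrow> y i = y' i) \<Longrightarrow> ip d x y = ip d x' y'"
  by (simp add: ip_def)

lemma ip_radial_proj: "ip d (radial_proj d x) v = ip d x v / nrm d x"
  by (simp add: radial_proj_def ip_def nrm_def sum_divide_distrib)

lemma nrm_radial_proj: "nrm d x \<noteq> 0 \<Longrightarrow> nrm d (radial_proj d x) = 1"
proof -
  assume a: "nrm d x \<noteq> 0"
  have "ip d (radial_proj d x) (radial_proj d x) = ip d x (radial_proj d x) / nrm d x"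
    by (rule ip_radial_proj)
  also have "\<dots> = ip d x x / nrm d x / nrm d x"
    by (subst ip_commute) (simp add: ip_radial_proj)
  also have "\<dots> = 1"
    using a by (simp add: nrm_power2[symmetric] power2_eq_square del: nrm_power2)
  finally show ?thesis by (simp add: nrm_def)
qed

lemma nrm_diff_radial_proj:
  assumes "nrm d x \<noteq> 0"
  shows "nrm d (x - radial_proj d x) = \<bar>nrm d x - 1\<bar>"
proof -
  have "nrm d (x - radial_proj d x) = nrm d ((nrm d x - 1) *\<^sub>R radial_proj d x)"
  proof (rule nrm_cong)
    fix i assume "i < d"
    then show "(x - radial_proj d x) i = ((nrm d x - 1) *\<^sub>R radial_proj d x) i"
      using assms by (simp add: fun_apply radial_proj_def nrm_def field_simps)
  qed
  then show ?thesis
    using assms by (simp add: nrm_radial_proj)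
qed

section \<open>Bounds for spherical caps and small neighbourhoods\<close>

lemma nrm_power2_diff: "(nrm d (x - a *\<^sub>R v))\<^sup>2 = (nrm d x)\<^sup>2 - 2 * a * ip d x v + a\<^sup>2 * (nrm d v)\<^sup>2"
  unfolding nrm_power2 by (simp add: algebra_simps power2_eq_square ip_commute[of d v x])

lemma cap_measure_shell:
  assumes v: "nrm d v \<le> 1" and h: "0 < h" "h < 1" and r: "0 \<le> r" "r < 1" "2 * h\<^sup>2 - 1 \<le> r"
    and d: "0 < d"
  shows "measure (unif_sphere d) {x. h \<le> ip d x v} * (1 - r ^ d) \<le> sqrt (1 - h\<^sup>2) ^ d"
proof -
  let ?S = "{x \<in> space (leb d). r < nrm d x \<and> nrm d x \<le> 1 \<and> radial_proj d x \<in> {x. h \<le> ip d x v}}"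
  have h2: "0 < 1 - h\<^sup>2"
    using h by (simp add: abs_square_less_1)
  have "?S \<subseteq> bll d (h *\<^sub>R v) (sqrt (1 - h\<^sup>2))"
  proof
    fix x assume "x \<in> ?S"
    then have x: "x \<in> space (leb d)" "r < nrm d x" "nrm d x \<le> 1" "h \<le> ip d x v / nrm d x"
      by (auto simp: ip_radial_proj)
    have a: "h * nrm d x \<le> ip d x v"
      using x r by (simp add: pos_le_divide_eq)
    have v2: "(nrm d v)\<^sup>2 \<le> 1"
      using v by (simp add: power_le_one del: nrm_power2)
    have "(nrm d (x - h *\<^sub>R v))\<^sup>2 = (nrm d x)\<^sup>2 - 2 * h * ip d x v + h\<^sup>2 * (nrm d v)\<^sup>2"
      by (rule nrm_power2_diff)
    also have "\<dots> \<le> (nrm d x)\<^sup>2 - 2 * h * (h * nrm d x) + h\<^sup>2 * 1"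
      using a v2 h by (intro add_mono diff_mono mult_left_mono) auto
    also have "\<dots> = 1 - h\<^sup>2 + (nrm d x - 1) * (nrm d x + 1 - 2 * h\<^sup>2)"
      by (simp add: algebra_simps power2_eq_square del: nrm_power2)
    also have "\<dots> \<le> 1 - h\<^sup>2"
      using x r by (simp add: mult_nonpos_nonneg)
    finally show "x \<in> bll d (h *\<^sub>R v) (sqrt (1 - h\<^sup>2))"
      using x(1) real_le_rsqrt[of "nrm d (x - h *\<^sub>R v)"] by (simp add: bll_def)
  qed
  then have "measure (leb d) ?S \<le> bvol d * sqrt (1 - h\<^sup>2) ^ d"
    using h2 by (intro measure_le_bll) auto
  moreover have "measure (leb d) ?S = (1 ^ d - r ^ d) * bvol d * measure (unif_sphere d) {x. h \<le> ip d x v}"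
    using r d by (intro measure_cone_shell) auto
  ultimately have "bvol d * (measure (unif_sphere d) {x. h \<le> ip d x v} * (1 - r ^ d)) \<le> bvol d * sqrt (1 - h\<^sup>2) ^ d"
    by (simp add: mult_ac)
  then show ?thesis
    by simp
qed

text \<open>With r = max 0 (2 h^2 - 1) the shell keeps a share 1 - r^d >= 1 - r >= 1 - h^2 of the
  cone; dividing by it costs two of the \<open>d\<close> factors sqrt (1 - h^2).\<close>

lemma cap_measure_le:
  assumes v: "nrm d v \<le> 1" and h: "0 < h" "h < 1" and d: "2 \<le> d"
  shows "measure (unif_sphere d) {x. h \<le> ip d x v} \<le> sqrt (1 - h\<^sup>2) ^ (d - 2)"
proof -
  define r where "r = max 0 (2 * h\<^sup>2 - 1)"
  let ?s = "sqrt (1 - h\<^sup>2)"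
  have h2: "0 < 1 - h\<^sup>2" "h\<^sup>2 > 0"
    using h by (simp_all add: abs_square_less_1)
  have r: "0 \<le> r" "r < 1" "2 * h\<^sup>2 - 1 \<le> r" "1 - h\<^sup>2 \<le> 1 - r"
    using h2 unfolding r_def by auto
  have "r ^ d \<le> r ^ 1"
    using r d by (intro power_decreasing) auto
  then have "1 - h\<^sup>2 \<le> 1 - r ^ d"
    using r by simp
  then have "measure (unif_sphere d) {x. h \<le> ip d x v} * (1 - h\<^sup>2)
      \<le> measure (unif_sphere d) {x. h \<le> ip d x v} * (1 - r ^ d)"
    by (intro mult_left_mono) auto
  also have "\<dots> \<le> ?s ^ d"
    using v h r d by (intro cap_measure_shell) auto
  also have "?s ^ d = ?s ^ (d - 2) * (1 - h\<^sup>2)"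
    using d h2 by (metis le_add_diff_inverse2 less_eq_real_def power_add real_sqrt_pow2)
  finally show ?thesis
    using h2 by simp
qed

text \<open>Gaussian form of the cap bound, by 1 - g^2 <= exp (- g^2), extended to all heights in
  [0, 1] for use in the moment bound.\<close>

lemma cap_measure_exp:
  assumes v: "nrm d v \<le> 1" and h: "0 \<le> h" "h \<le> 1" and d: "2 \<le> d"
  shows "measure (unif_sphere d) {x. h \<le> ip d x v} \<le> exp (- (real d - 2) / 2 * h\<^sup>2)"
proof -
  interpret prob_space "unif_sphere d" by (rule prob_space_unif_sphere)
  have less: "prob {x. g \<le> ip d x v} \<le> exp (- (real d - 2) / 2 * g\<^sup>2)" if g: "0 \<le> g" "g < 1" for g
  proof (cases "g = 0")
    case False
    have g2: "0 < 1 - g\<^sup>2"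
      using g by (simp add: abs_square_less_1)
    have "prob {x. g \<le> ip d x v} \<le> sqrt (1 - g\<^sup>2) ^ (d - 2)"
      using g False v d by (intro cap_measure_le) auto
    also have "\<dots> \<le> sqrt (exp (- g\<^sup>2)) ^ (d - 2)"
      using exp_ge_add_one_self[of "- g\<^sup>2"] g2 by (intro power_mono) auto
    also have "sqrt (exp (- g\<^sup>2)) = exp (- g\<^sup>2 / 2)"
      by (rule real_sqrt_unique) (simp_all add: power2_eq_square flip: exp_add)
    also have "exp (- g\<^sup>2 / 2) ^ (d - 2) = exp (- (real d - 2) / 2 * g\<^sup>2)"
      using d by (simp add: of_nat_diff field_simps flip: exp_of_nat_mult)
    finally show ?thesis .
  qed simp
  show ?thesis
  proof (cases "h < 1")
    case False
    then have "h = 1" using h by simp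
    \<comment> \<open>The cap bound requires a height below 1, so height 1 is reached by letting
      \<open>g\<close> increase to 1.\<close>
    have "((\<lambda>g. exp (- (real d - 2) / 2 * g\<^sup>2)) \<longlongrightarrow> exp (- (real d - 2) / 2 * 1\<^sup>2)) (at_left 1)"
      by (intro tendsto_intros)
    moreover have "\<forall>\<^sub>F g in at_left (1::real). prob {x. 1 \<le> ip d x v} \<le> exp (- (real d - 2) / 2 * g\<^sup>2)"
      using eventually_at_left_real[OF zero_less_one]
    proof eventually_elim
      case (elim g)
      have "prob {x. 1 \<le> ip d x v} \<le> prob {x. g \<le> ip d x v}"
        using elim by (intro finite_measure_mono) auto
      also have "\<dots> \<le> exp (- (real d - 2) / 2 * g\<^sup>2)"
        using elim by (intro less) auto
      finally show ?case .
    qed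
    ultimately show ?thesis
      unfolding \<open>h = 1\<close> by (intro tendsto_lowerbound[of _ _ "at_left (1::real)"]) auto
  qed (use less h in auto)
qed

text \<open>The shell of thickness \<open>r\<close> over the points within \<open>r\<close> of
  \<open>v\<close> lies in the ball of radius \<open>2 * r\<close> about \<open>v\<close>, and it
  makes up a share 1 - (1 - r)^d >= r of its cone. Dividing by \<open>r\<close> leaves the exponent
  \<open>d - 1\<close>, the dimension of the sphere.\<close>

lemma near_measure_le:
  assumes r: "0 < r" "r \<le> 1" and d: "0 < d"
  shows "measure (unif_sphere d) {x. nrm d (x - v) \<le> r} \<le> 2 ^ d * r ^ (d - 1)"
proof -
  have [measurable]: "(\<lambda>x. nrm d (x - v)) \<in> borel_measurable borel"
    unfolding nrm_def
    by (intro borel_measurable_sqrt_comp measurable_ip) (auto simp: fun_apply intro!: borel_measurable_diff measurable_coordinate_borel)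
  let ?S = "{x \<in> space (leb d). 1 - r < nrm d x \<and> nrm d x \<le> 1 \<and> radial_proj d x \<in> {x. nrm d (x - v) \<le> r}}"
  have "?S \<subseteq> bll d v (2 * r)"
  proof
    fix x assume "x \<in> ?S"
    then have x: "x \<in> space (leb d)" "1 - r < nrm d x" "nrm d x \<le> 1" "nrm d (radial_proj d x - v) \<le> r"
      by auto
    have "nrm d (x - v) \<le> nrm d (x - radial_proj d x) + nrm d (radial_proj d x - v)"
      using nrm_triangle[of d "x - radial_proj d x" "radial_proj d x - v"] by simp
    also have "\<dots> \<le> r + r"
      using x r by (intro add_mono) (auto simp: nrm_diff_radial_proj)
    finally show "x \<in> bll d v (2 * r)"
      using x by (simp add: bll_def)
  qed
  then have "measure (leb d) ?S \<le> bvol d * (2 * r) ^ d"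
    using r by (intro measure_le_bll) auto
  moreover have "measure (leb d) ?S = (1 ^ d - (1 - r) ^ d) * bvol d * measure (unif_sphere d) {x. nrm d (x - v) \<le> r}"
    using r d by (intro measure_cone_shell) auto
  ultimately have "bvol d * (measure (unif_sphere d) {x. nrm d (x - v) \<le> r} * (1 - (1 - r) ^ d)) \<le> bvol d * (2 * r) ^ d"
    by (simp add: mult_ac)
  then have *: "measure (unif_sphere d) {x. nrm d (x - v) \<le> r} * (1 - (1 - r) ^ d) \<le> (2 * r) ^ d"
    by simp
  have "(1 - r) ^ d \<le> (1 - r) ^ 1"
    using r d by (intro power_decreasing) auto
  then have "measure (unif_sphere d) {x. nrm d (x - v) \<le> r} * r
      \<le> measure (unif_sphere d) {x. nrm d (x - v) \<le> r} * (1 - (1 - r) ^ d)"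
    by (intro mult_left_mono) auto
  also note *
  also have "(2 * r) ^ d = 2 ^ d * r ^ (d - 1) * r"
    using d by (simp add: power_mult_distrib flip: power_Suc2)
  finally show ?thesis
    using r by simp
qed

lemma sqr_max_measurable [measurable]:
  "(\<lambda>x. (max 0 (ip d x v))\<^sup>2) \<in> borel_measurable borel"
  by measurable

lemma abs_ip_sphere_le_1:
  assumes "nrm d x = 1" "nrm d v \<le> 1"
  shows "\<bar>ip d x v\<bar> \<le> 1"
  using abs_ip_le_nrm[of d x v] assms by simp

lemma continuous_on_ip:
  assumes "\<And>i. i < d \<Longrightarrow> continuous_on S (\<lambda>x. f x i)" "\<And>i. i < d \<Longrightarrow> continuous_on S (\<lambda>x. g x i)"
  shows "continuous_on S (\<lambda>x. ip d (f x) (g x))"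
  unfolding ip_def using assms by (intro continuous_on_sum continuous_on_mult) auto

lemma usphere_eq: "usphere d = {x. (\<forall>i. d \<le> i \<longrightarrow> x i = 0) \<and> ip d x x = 1}"
  by (auto simp: usphere_def Rspace_def)

lemma closed_usphere: "closed (usphere d)"
  unfolding usphere_eq
  by (intro closed_Collect_conj closed_Collect_all closed_Collect_imp closed_Collect_eq
      continuous_on_ip continuous_intros continuous_on_product_coordinates) auto

lemma usphere_sets [measurable]: "usphere d \<in> sets borel"
  using closed_usphere by simp

lemma radial_proj_in_usphere: "nrm d x \<noteq> 0 \<Longrightarrow> radial_proj d x \<in> usphere d"
  using nrm_radial_proj[of d x] by (auto simp: usphere_eq nrm_def radial_proj_def)

text \<open>\<open>radial_proj\<close> sends every point of nonzero norm into
  \<open>usphere d\<close>, so the shells with inner radius 0 over \<open>usphere d\<close> and over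
  \<open>UNIV\<close> coincide.\<close>

lemma AE_usphere:
  assumes "0 < d"
  shows "AE x in unif_sphere d. x \<in> usphere d"
proof -
  interpret prob_space "unif_sphere d" by (rule prob_space_unif_sphere)
  let ?S = "\<lambda>A. {x \<in> space (leb d). 0 < nrm d x \<and> nrm d x \<le> 1 \<and> radial_proj d x \<in> A}"
  have shell: "measure (leb d) (?S A) = bvol d * prob A" if "A \<in> sets borel" for A
    using measure_cone_shell[OF that, of 0 1 d] assms by simp
  have "?S (usphere d) = ?S UNIV"
    using radial_proj_in_usphere by auto
  then have "prob (usphere d) = prob UNIV"
    using shell[OF usphere_sets[of d]] shell[of UNIV] by simp
  then have "prob (usphere d) = 1"
    using prob_space by simp
  then show ?thesis
    by (intro AE_prob_1) auto
qed

text \<open>Splitting by the integer part \<open>j\<close> of \<open>k * Z x\<close> bounds the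
  integrand by exp (j + 1), while the cap bound at height sqrt (j / k) gives probability at most exp
  (- b j / k). A geometric series with ratio \<open>q\<close> remains. Its sum depends only on the
  quotient of \<open>b\<close> and \<open>k\<close>, so it is uniform in \<open>d\<close> when
  \<open>k\<close> is a fixed fraction of \<open>b\<close>.\<close>

lemma exp_cap_moment:
  assumes v: "nrm d v \<le> 1" and d: "2 < d" and k: "0 < k" "k < (real d - 2) / 2"
  shows "(\<integral>\<^sup>+x. ennreal (exp (k * (max 0 (ip d x v))\<^sup>2)) \<partial>unif_sphere d)
    \<le> ennreal (exp 1 / (1 - exp (1 - (real d - 2) / 2 / k)))"
proof -
  interpret prob_space "unif_sphere d" by (rule prob_space_unif_sphere)
  define b where "b = (real d - 2) / 2"
  define K where "K = nat \<lfloor>k\<rfloor>"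
  define Z where "Z x = (max 0 (ip d x v))\<^sup>2" for x
  define A where "A j = {x. real j \<le> k * Z x}" for j
  have [measurable]: "Z \<in> borel_measurable borel"
    unfolding Z_def by measurable
  have A [measurable]: "A j \<in> sets borel" for j
    unfolding A_def by measurable
  define q where "q = exp (1 - b / k)"
  have q: "0 < q" "q < 1"
    using k by (auto simp: b_def q_def field_simps)
  have AE_le: "AE x in unif_sphere d.
      ennreal (exp (k * Z x)) \<le> (\<Sum>j\<le>K. ennreal (exp (real j + 1)) * indicator (A j) x)"
  proof (rule AE_mp[OF AE_usphere], use d in simp, intro AE_I2 impI)
    fix x assume x: "x \<in> usphere d"
    define j where "j = nat \<lfloor>k * Z x\<rfloor>"
    have Z: "0 \<le> Z x" "Z x \<le> 1"
      using abs_ip_sphere_le_1[of d x v] x v by (auto simp: nrm_usphere Z_def power_le_one)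
    have kZ: "0 \<le> k * Z x" "k * Z x \<le> k"
      using k Z by (simp_all add: mult_left_le)
    have j: "real j \<le> k * Z x" "k * Z x \<le> real j + 1"
      unfolding j_def using kZ by linarith+
    have "j \<le> K"
      unfolding j_def K_def using kZ by (intro nat_mono floor_mono) simp
    have "ennreal (exp (k * Z x)) \<le> ennreal (exp (real j + 1)) * indicator (A j) x"
      using j by (auto simp: A_def)
    also have "\<dots> \<le> (\<Sum>j\<le>K. ennreal (exp (real j + 1)) * indicator (A j) x)"
      using \<open>j \<le> K\<close> by (intro member_le_sum) auto
    finally show "ennreal (exp (k * Z x)) \<le> \<dots>" .
  qed
  have prob_A: "prob (A j) \<le> exp (- b * (real j / k))" if "j \<le> K" for j
  proof (cases "j = 0")
    case False
    \<comment> \<open>Levels above \<open>K\<close> do not occur because \<open>Z x\<close> is at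
      most 1 on the sphere, so \<open>c\<close> stays within the range of the cap bound.\<close>
    define c where "c = sqrt (real j / k)"
    have "real j \<le> k"
      using that k unfolding K_def by linarith
    then have c: "0 < c" "c \<le> 1" "c\<^sup>2 = real j / k"
      using False k by (auto simp: c_def)
    have "A j \<subseteq> {x. c \<le> ip d x v}"
    proof
      fix x assume "x \<in> A j"
      then have "c\<^sup>2 \<le> (max 0 (ip d x v))\<^sup>2"
        using k by (simp add: A_def Z_def c(3) field_simps)
      then have "c \<le> max 0 (ip d x v)"
        by (rule power2_le_imp_le) simp
      then show "x \<in> {x. c \<le> ip d x v}"
        using c by auto
    qed
    then have "prob (A j) \<le> prob {x. c \<le> ip d x v}"
      by (intro finite_measure_mono) auto
    also have "\<dots> \<le> exp (- b * (real j / k))"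
    proof -
      have "- (real d - 2) / 2 * c\<^sup>2 = - b * (real j / k)"
        unfolding c(3) b_def by (simp only: minus_divide_left[symmetric] mult_minus_left)
      then show ?thesis
        using cap_measure_exp[of d v c] v c d by simp
    qed
    finally show ?thesis .
  qed simp
  have "(\<integral>\<^sup>+x. ennreal (exp (k * Z x)) \<partial>unif_sphere d)
      \<le> (\<integral>\<^sup>+x. (\<Sum>j\<le>K. ennreal (exp (real j + 1)) * indicator (A j) x) \<partial>unif_sphere d)"
    by (intro nn_integral_mono_AE AE_le)
  also have "\<dots> = (\<Sum>j\<le>K. ennreal (exp (real j + 1)) * emeasure (unif_sphere d) (A j))"
    by (subst nn_integral_sum) (auto simp: nn_integral_cmult_indicator)
  also have "\<dots> \<le> (\<Sum>j\<le>K. ennreal (exp 1 * q ^ j))"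
  proof (intro sum_mono)
    fix j assume "j \<in> {..K}"
    then have "exp (real j + 1) * prob (A j) \<le> exp (real j + 1) * exp (- b * (real j / k))"
      by (intro mult_left_mono prob_A) auto
    also have "\<dots> = exp 1 * q ^ j"
      by (simp add: q_def field_simps flip: exp_add exp_of_nat_mult)
    finally show "ennreal (exp (real j + 1)) * emeasure (unif_sphere d) (A j) \<le> ennreal (exp 1 * q ^ j)"
      by (simp add: emeasure_eq_measure ennreal_leI flip: ennreal_mult)
  qed
  also have "\<dots> = ennreal (exp 1 * (\<Sum>j\<le>K. q ^ j))"
    using q by (simp add: sum_ennreal sum_distrib_left)
  also have "\<dots> \<le> ennreal (exp 1 * (1 / (1 - q)))"
  proof (intro ennreal_leI mult_left_mono)
    have "(\<Sum>j\<le>K. q ^ j) = (1 - q ^ Suc K) / (1 - q)"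
      using q by (simp add: lessThan_Suc_atMost[symmetric] sum_gp_strict del: sum.lessThan_Suc)
    also have "\<dots> \<le> 1 / (1 - q)"
      using q by (intro divide_right_mono) auto
    finally show "(\<Sum>j\<le>K. q ^ j) \<le> 1 / (1 - q)" .
  qed simp
  finally show ?thesis
    by (simp add: Z_def q_def b_def)
qed

text \<open>The slab \<open>W\<close> of the ball of radius \<open>s\<close> about h v, given by h
  <= <x, v> <= h + 2 s / sqrt d, has at least a quarter of the volume of that ball and lies in the
  cone over the cap. On it |x|^2 <= 1 - 2 h^2 + 2 h <x, v> <= R^2, so \<open>W\<close> is part of
  the shell r < |x| <= R. Cutting the half ball at relative height 2 / sqrt d costs only a constant
  and keeps \<open>R ^ d\<close> below exp (2 h s sqrt d).\<close>

lemma cap_measure_lower: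
  assumes v: "nrm d v = 1" and h: "0 < h" "h < 1" and r: "0 \<le> r" "r < h" and d: "2 \<le> d"
  defines "s \<equiv> sqrt (1 - h\<^sup>2)"
  defines "R \<equiv> sqrt (1 + 4 * h * s / sqrt (real d))"
  shows "s ^ d / 4 \<le> measure (unif_sphere d) {x. h \<le> ip d x v} * (R ^ d - r ^ d)"
proof -
  let ?t = "2 / sqrt (real d)"
  have h2: "0 < 1 - h\<^sup>2" "0 < s" "s\<^sup>2 = 1 - h\<^sup>2"
    using h by (simp_all add: abs_square_less_1 s_def power_le_one)
  have R: "R\<^sup>2 = 1 + 4 * h * s / sqrt (real d)" "1 \<le> R"
    unfolding R_def using h h2 by auto
  let ?B = "bll d 0 1"
  let ?P = "{y \<in> ?B. 0 \<le> ip d y v}" and ?N = "{y \<in> ?B. ip d y v \<le> 0}"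
  let ?T = "{y \<in> ?B. ?t < ip d y v}"
  let ?V = "{y \<in> ?B. 0 \<le> ip d y v \<and> ip d y v \<le> ?t}"
  have fm: "{y \<in> ?B. Q y} \<in> fmeasurable (leb d)" if "{y \<in> ?B. Q y} \<in> sets (leb d)" for Q
    using that by (intro fmeasurable_subset_bll[of _ d 0 1]) auto
  have sets: "?P \<in> sets (leb d)" "?N \<in> sets (leb d)" "?T \<in> sets (leb d)" "?V \<in> sets (leb d)"
    by measurable
  \<comment> \<open>Reflection at the origin shows that the half ball has at least half of the
    volume.\<close>
  have "measure (leb d) ?N = measure (leb d) {x \<in> space (leb d). restrict (0 + (- 1) *\<^sub>R x) {..<d} \<in> ?N}"
    using measure_leb_affine[of "- 1" ?N d 0] sets by simp
  also have "{x \<in> space (leb d). restrict (0 + (- 1) *\<^sub>R x) {..<d} \<in> ?N} = ?P"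
    by (auto simp: mem_bll_0 space_PiM nrm_def)
  finally have NP: "measure (leb d) ?N = measure (leb d) ?P" .
  have "bvol d = measure (leb d) (?P \<union> ?N)"
    using measure_bll[of 1 d 0] by (simp add: Un_def) (metis (no_types, lifting) Collect_cong linorder_linear Collect_mem_eq)
  also have "\<dots> \<le> measure (leb d) ?P + measure (leb d) ?N"
    by (intro measure_Un_le sets)
  finally have P: "bvol d / 2 \<le> measure (leb d) ?P"
    using NP by simp
  \<comment> \<open>The piece beyond \<open>?t\<close> lies in a ball of radius sqrt (1 - 4/d), as
    for caps; the constant 2 in \<open>?t\<close> makes its share at most exp (- 2) <= 1/4.\<close>
  have T: "measure (leb d) ?T \<le> bvol d / 4"
  proof (cases "?t < 1")
    case True
    have t: "0 < ?t" "0 < 1 - ?t\<^sup>2"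
      using True d by (simp, subst less_iff_diff_less_0, simp add: abs_square_less_1)
    have "?T \<subseteq> bll d (?t *\<^sub>R v) (sqrt (1 - ?t\<^sup>2))"
    proof
      fix y assume y: "y \<in> ?T"
      have "(nrm d (y - ?t *\<^sub>R v))\<^sup>2 = (nrm d y)\<^sup>2 - 2 * ?t * ip d y v + ?t\<^sup>2 * (nrm d v)\<^sup>2"
        by (rule nrm_power2_diff)
      also have "\<dots> \<le> 1 - 2 * ?t * ?t + ?t\<^sup>2 * 1"
        using y v t by (intro add_mono diff_mono mult_left_mono) (auto simp: mem_bll_0 power_le_one simp del: nrm_power2)
      also have "\<dots> = 1 - ?t\<^sup>2"
        by (simp add: power2_eq_square)
      finally show "y \<in> bll d (?t *\<^sub>R v) (sqrt (1 - ?t\<^sup>2))"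
        using y real_le_rsqrt[of "nrm d (y - ?t *\<^sub>R v)"] by (simp add: bll_def)
    qed
    then have "measure (leb d) ?T \<le> bvol d * sqrt (1 - ?t\<^sup>2) ^ d"
      using t sets by (intro measure_le_bll) auto
    also have "sqrt (1 - ?t\<^sup>2) ^ d \<le> sqrt (exp (- ?t\<^sup>2)) ^ d"
      using exp_ge_add_one_self[of "- ?t\<^sup>2"] t by (intro power_mono) auto
    also have "sqrt (exp (- ?t\<^sup>2)) = exp (- ?t\<^sup>2 / 2)"
      by (rule real_sqrt_unique) (simp_all add: power2_eq_square flip: exp_add)
    also have "exp (- ?t\<^sup>2 / 2) ^ d = exp (- 2)"
      using d by (simp add: power_divide flip: exp_of_nat_mult)
    also have "exp (- 2 :: real) \<le> 1 / 4"
    proof -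
      have "2 \<le> exp (1::real)"
        using exp_ge_add_one_self[of 1] by simp
      then have "2 * 2 \<le> exp (1::real) * exp 1"
        by (intro mult_mono) auto
      then show ?thesis
        by (simp add: exp_minus field_simps flip: exp_add)
    qed
    finally show ?thesis
      by simp
  next
    case False
    have "ip d y v \<le> 1" if "y \<in> ?B" for y
      using ip_le_nrm[of d y v] that v by (simp add: mem_bll_0)
    then have "?T = {}"
      using False by fastforce
    then show ?thesis
      by (simp only: measure_empty) simp
  qed
  have "measure (leb d) ?P \<le> measure (leb d) (?V \<union> ?T)"
    using sets by (intro measure_mono_fmeasurable fmeasurable.Un fm) auto
  also have "\<dots> \<le> measure (leb d) ?V + measure (leb d) ?T"
    by (intro measure_Un_le sets)
  finally have V: "bvol d / 4 \<le> measure (leb d) ?V"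
    using P T by simp
  \<comment> \<open>\<open>W\<close> is the image of the slab \<open>?V\<close> under y -> h v + s
    y.\<close>
  define W where "W = {x \<in> space (leb d). h \<le> ip d x v \<and> ip d x v \<le> h + s * ?t \<and> nrm d (x - h *\<^sub>R v) \<le> s}"
  have Ws: "W \<in> sets (leb d)"
  proof -
    have "W = bll d (h *\<^sub>R v) s \<inter> {x \<in> space (leb d). h \<le> ip d x v \<and> ip d x v \<le> h + s * ?t}"
      by (auto simp: W_def bll_def)
    also have "\<dots> \<in> sets (leb d)"
      by measurable
    finally show ?thesis .
  qed
  have "measure (leb d) W = s ^ d * measure (leb d) {y \<in> space (leb d). restrict (h *\<^sub>R v + s *\<^sub>R y) {..<d} \<in> W}"
    using measure_leb_affine[of s W d "h *\<^sub>R v"] Ws h2 by simp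
  also have "{y \<in> space (leb d). restrict (h *\<^sub>R v + s *\<^sub>R y) {..<d} \<in> W} = ?V"
  proof -
    have 1: "nrm d (restrict (h *\<^sub>R v + s *\<^sub>R y) {..<d} - h *\<^sub>R v) = s * nrm d y" for y
    proof -
      have "nrm d (restrict (h *\<^sub>R v + s *\<^sub>R y) {..<d} - h *\<^sub>R v) = nrm d (s *\<^sub>R y)"
        by (rule nrm_cong) (simp add: fun_apply)
      then show ?thesis
        using h2 by simp
    qed
    have 2: "ip d v v = 1"
      using v nrm_power2[of d v] by simp
    have 3: "ip d (restrict (h *\<^sub>R v + s *\<^sub>R y) {..<d}) v = h + s * ip d y v" for y
      by (simp add: 2)
    have 4: "h \<le> h + s * a \<longleftrightarrow> 0 \<le> a" "h + s * a \<le> h + s * ?t \<longleftrightarrow> a \<le> ?t" "s * a \<le> s \<longleftrightarrow> a \<le> 1" for a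
      using h2(2) by (simp_all only: le_add_same_cancel1 add_le_cancel_left mult_le_cancel_left_pos
        zero_le_mult_iff mult_le_cancel_left2) auto
    have 5: "restrict f {..<d} \<in> space (leb d)" for f
      by (auto simp: space_PiM)
    show ?thesis
      unfolding W_def mem_Collect_eq 1 3 4 mem_bll_0 using 5 by auto
  qed
  finally have W: "s ^ d * (bvol d / 4) \<le> measure (leb d) W"
    using V h2 by simp
  let ?S = "{x \<in> space (leb d). r < nrm d x \<and> nrm d x \<le> R \<and> radial_proj d x \<in> {x. h \<le> ip d x v}}"
  have "W \<subseteq> ?S"
  proof
    fix x assume x: "x \<in> W"
    define a where "a = ip d x v"
    have a: "h \<le> a" "a \<le> h + s * ?t" "(nrm d (x - h *\<^sub>R v))\<^sup>2 \<le> s\<^sup>2"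
      using x by (auto simp: W_def a_def intro: power_mono simp del: nrm_power2)
    have n: "(nrm d x)\<^sup>2 \<le> 1 - 2 * h\<^sup>2 + 2 * h * a"
      using a(3) h2 v unfolding nrm_power2_diff by (simp add: a_def del: nrm_power2)
    have an: "a \<le> nrm d x"
      using ip_le_nrm[of d x v] v by (simp add: a_def)
    have "1 - 2 * h\<^sup>2 + 2 * h * a \<le> 1 - 2 * h\<^sup>2 + 2 * h * (h + s * ?t)"
      using a h by (intro add_left_mono mult_left_mono) auto
    also have "\<dots> = R\<^sup>2"
      unfolding R by (simp add: algebra_simps power2_eq_square)
    finally have "(nrm d x)\<^sup>2 \<le> R\<^sup>2"
      using n by linarith
    then have xR: "nrm d x \<le> R"
      by (rule power2_le_imp_le) (use R in simp)
    have "(h * nrm d x)\<^sup>2 \<le> h\<^sup>2 * (1 - 2 * h\<^sup>2 + 2 * h * a)"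
      using n by (simp add: power_mult_distrib mult_left_mono del: nrm_power2)
    also have "\<dots> \<le> a\<^sup>2"
    proof -
      \<comment> \<open>This identity places \<open>W\<close> inside the cone: both terms on the
        right are nonnegative because a >= h.\<close>
      have "a\<^sup>2 - h\<^sup>2 * (1 - 2 * h\<^sup>2 + 2 * h * a) = (a - h)\<^sup>2 + 2 * h * (a - h) * (1 - h\<^sup>2)"
        by (simp add: algebra_simps power2_eq_square)
      moreover have "0 \<le> 2 * h * (a - h) * (1 - h\<^sup>2)"
        using h a h2 by simp
      ultimately show ?thesis
        by (smt (verit) zero_le_power2)
    qed
    finally have "h * nrm d x \<le> a"
      by (rule power2_le_imp_le) (use a h in simp)
    then show "x \<in> ?S"
      using x xR an a r h by (auto simp: W_def ip_radial_proj a_def pos_le_divide_eq)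
  qed
  then have "measure (leb d) W \<le> measure (leb d) ?S"
  proof (rule measure_mono_fmeasurable[OF _ Ws])
    show "?S \<in> fmeasurable (leb d)"
      by (rule fmeasurable_subset_bll[of _ d 0 R]) (auto simp: mem_bll_0)
  qed
  also have "\<dots> = (R ^ d - r ^ d) * bvol d * measure (unif_sphere d) {x. h \<le> ip d x v}"
    using r h R d by (intro measure_cone_shell) auto
  finally have "s ^ d * (bvol d / 4) \<le> (R ^ d - r ^ d) * bvol d * measure (unif_sphere d) {x. h \<le> ip d x v}"
    by (rule order_trans[OF W])
  moreover have "s ^ d * (bvol d / 4) = bvol d * (s ^ d / 4)"
    "(R ^ d - r ^ d) * bvol d * measure (unif_sphere d) {x. h \<le> ip d x v}
      = bvol d * (measure (unif_sphere d) {x. h \<le> ip d x v} * (R ^ d - r ^ d))"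
    by (simp_all only: mult_ac times_divide_eq_left times_divide_eq_right)
  ultimately show ?thesis
    by (simp only: mult_le_cancel_left_pos[OF bvol_pos(1)])
qed

text \<open>If |b| >= 1, the hyperplane meets the sphere at most in the point
  \<open>b *\<^sub>R w\<close>. If |b| < 1, the cone over the intersection has infinitely many
  pairwise disjoint translates of equal volume inside one ball, so its volume is 0.\<close>

lemma hyperplane_null_sets:
  assumes w: "nrm d w = 1" and d: "2 \<le> d"
  shows "{x. ip d x w = b} \<in> null_sets (unif_sphere d)"
proof -
  interpret prob_space "unif_sphere d" by (rule prob_space_unif_sphere)
  have "prob {x. ip d x w = b} = 0"
  proof (cases "\<bar>b\<bar> < 1")
    case False
    have "\<forall>\<^sub>F r in at_right (0::real). prob {x. ip d x w = b} \<le> 2 ^ d * r ^ (d - 1)"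
      using eventually_at_right_real[OF zero_less_one]
    proof eventually_elim
      case (elim r)
      have "prob {x. ip d x w = b} \<le> prob {x. nrm d (x - b *\<^sub>R w) \<le> r}"
      proof (rule finite_measure_mono_AE)
        show "AE x in unif_sphere d. x \<in> {x. ip d x w = b} \<longrightarrow> x \<in> {x. nrm d (x - b *\<^sub>R w) \<le> r}"
        proof (rule AE_mp[OF AE_usphere], use d in simp, intro AE_I2 impI)
          fix x assume x: "x \<in> usphere d" "x \<in> {x. ip d x w = b}"
          have "(nrm d (x - b *\<^sub>R w))\<^sup>2 = 1 - b\<^sup>2"
            using x w unfolding nrm_power2_diff by (simp add: nrm_usphere power2_eq_square del: nrm_power2)
          also have "\<dots> \<le> 0"
            using False by (simp add: abs_square_less_1 flip: not_less)
          finally have "nrm d (x - b *\<^sub>R w) = 0"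
            by (simp del: nrm_power2)
          then show "x \<in> {x. nrm d (x - b *\<^sub>R w) \<le> r}"
            using elim by simp
        qed
        have "(\<lambda>x. nrm d (x - b *\<^sub>R w)) \<in> borel_measurable borel"
          unfolding nrm_def
          by (intro borel_measurable_sqrt_comp measurable_ip)
            (auto simp: fun_apply intro!: borel_measurable_diff measurable_coordinate_borel)
        then show "{x. nrm d (x - b *\<^sub>R w) \<le> r} \<in> events"
          by simp
      qed
      also have "\<dots> \<le> 2 ^ d * r ^ (d - 1)"
        using elim d by (intro near_measure_le) auto
      finally show ?case .
    qed
    moreover have "((\<lambda>r. 2 ^ d * r ^ (d - 1)) \<longlongrightarrow> 2 ^ d * (0::real) ^ (d - 1)) (at_right 0)"
      by (intro tendsto_intros)
    ultimately have "prob {x. ip d x w = b} \<le> 2 ^ d * (0::real) ^ (d - 1)"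
      by (intro tendsto_lowerbound[of _ _ "at_right (0::real)"]) auto
    then show ?thesis
      using d measure_nonneg[of "unif_sphere d"] by (simp add: power_0_left antisym)
  next
    case True
    define C where "C = {x \<in> space (leb d). 0 < nrm d x \<and> nrm d x \<le> 1 \<and> radial_proj d x \<in> {x. ip d x w = b}}"
    have [measurable]: "C \<in> sets (leb d)"
      unfolding C_def by measurable
    have C: "measure (leb d) C = bvol d * prob {x. ip d x w = b}"
      unfolding C_def using measure_cone_shell[of "{x. ip d x w = b}" 0 1 d] d by simp
    \<comment> \<open>The translates \<open>D k\<close> of \<open>C\<close> are shifted by at most 1
      along \<open>w\<close>, so they stay in the ball of radius 2.\<close>
    define s where "s k = 1 / real (Suc k)" for k
    define D where "D k = {x \<in> space (leb d). restrict ((- s k) *\<^sub>R w + 1 *\<^sub>R x) {..<d} \<in> C}" for k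
    have D_iff: "x \<in> D k \<longleftrightarrow> x \<in> space (leb d) \<and> 0 < nrm d (x - s k *\<^sub>R w) \<and>
        nrm d (x - s k *\<^sub>R w) \<le> 1 \<and> ip d x w - s k = b * nrm d (x - s k *\<^sub>R w)" for x k
    proof -
      define z where "z = x - s k *\<^sub>R w"
      have z: "(- s k) *\<^sub>R w + 1 *\<^sub>R x = z"
        by (simp add: z_def)
      have ipz: "ip d z w = ip d x w - s k"
        using w nrm_power2[of d w] by (simp add: z_def)
      have sp: "restrict z {..<d} \<in> space (leb d)"
        by (auto simp: space_PiM)
      have div: "ip d z w / nrm d z = b \<longleftrightarrow> ip d z w = b * nrm d z" if "0 < nrm d z"
        using that by (simp add: divide_eq_eq)
      show ?thesis
        unfolding D_def C_def mem_Collect_eq nrm_restrict radial_proj_restrict ip_radial_proj z ip_restrict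
          z_def[symmetric] ipz[symmetric]
        using sp div by blast
    qed
    have eD: "emeasure (leb d) (D k) = emeasure (leb d) C" for k
      using emeasure_leb_affine[of 1 C d "(- s k) *\<^sub>R w"] by (simp add: D_def)
    have Dm: "D k \<in> sets (leb d)" for k
    proof -
      have "(\<lambda>x. restrict ((- s k) *\<^sub>R w + 1 *\<^sub>R x) {..<d}) \<in> leb d \<rightarrow>\<^sub>M leb d"
        by (intro measurable_restrict) (auto simp: fun_apply)
      from measurable_sets[OF this, of C] show ?thesis
        by (simp add: D_def vimage_def Int_def conj_commute)
    qed
    have "disjoint_family D"
      unfolding disjoint_family_on_def
    proof (intro ballI impI)
      fix k l :: nat assume "k \<noteq> l"
      then have "s k \<noteq> s l"
        by (simp add: s_def)
      show "D k \<inter> D l = {}"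
      proof (rule ccontr)
        assume "D k \<inter> D l \<noteq> {}"
        then obtain x where x: "x \<in> D k" "x \<in> D l" by auto
        let ?p = "nrm d (x - s k *\<^sub>R w)" and ?q = "nrm d (x - s l *\<^sub>R w)"
        have shift: "x - a *\<^sub>R w + (a - c) *\<^sub>R w = x - c *\<^sub>R w" for a c
          by (simp add: algebra_simps)
        have "?p \<le> ?q + \<bar>s l - s k\<bar>" "?q \<le> ?p + \<bar>s k - s l\<bar>"
          using nrm_triangle[of d "x - s l *\<^sub>R w" "(s l - s k) *\<^sub>R w"]
            nrm_triangle[of d "x - s k *\<^sub>R w" "(s k - s l) *\<^sub>R w"]
          unfolding shift by (simp_all add: w)
        then have pq: "\<bar>?p - ?q\<bar> \<le> \<bar>s l - s k\<bar>"
          by linarith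
        \<comment> \<open>A common point expresses |s l - s k| as |b| times a difference of norms
          that is itself at most |s l - s k|, impossible for |b| < 1 and distinct shifts.\<close>
        have "s l - s k = b * (?p - ?q)"
          using x unfolding D_iff by (simp add: algebra_simps)
        then have "\<bar>s l - s k\<bar> = \<bar>b\<bar> * \<bar>?p - ?q\<bar>"
          by (simp add: abs_mult)
        also have "\<dots> \<le> \<bar>b\<bar> * \<bar>s l - s k\<bar>"
          using pq by (intro mult_left_mono) auto
        also have "\<dots> < 1 * \<bar>s l - s k\<bar>"
          using True \<open>s k \<noteq> s l\<close> by (intro mult_strict_right_mono) auto
        finally show False by simp
      qed
    qed
    then have "(\<Sum>k. emeasure (leb d) (D k)) = emeasure (leb d) (\<Union>k. D k)"
      using Dm by (intro suminf_emeasure) auto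
    also have "\<dots> \<le> emeasure (leb d) (bll d 0 2)"
    proof (intro emeasure_mono UN_least subsetI)
      fix k x assume "x \<in> D k"
      then have x: "x \<in> space (leb d)" "nrm d (x - s k *\<^sub>R w) \<le> 1"
        unfolding D_iff by auto
      have "nrm d x \<le> nrm d (x - s k *\<^sub>R w) + nrm d (s k *\<^sub>R w)"
        using nrm_triangle[of d "x - s k *\<^sub>R w" "s k *\<^sub>R w"] by simp
      also have "nrm d (s k *\<^sub>R w) \<le> 1"
        using w by (simp add: s_def)
      finally show "x \<in> bll d 0 2"
        using x by (simp add: mem_bll_0)
    qed simp
    also have "\<dots> = ennreal (bvol d * 2 ^ d)"
      by (simp add: emeasure_bll)
    finally have suminf: "(\<Sum>k. emeasure (leb d) (D k)) \<le> ennreal (bvol d * 2 ^ d)" .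
    have "C \<in> fmeasurable (leb d)"
      by (rule fmeasurable_subset_bll[of _ d 0 1]) (auto simp: C_def mem_bll_0)
    then have eC: "emeasure (leb d) C = ennreal (measure (leb d) C)"
      by (simp add: emeasure_eq_measure2)
    have "real n * measure (leb d) C \<le> bvol d * 2 ^ d" for n
    proof -
      have "ennreal (real n * measure (leb d) C) = (\<Sum>k<n. emeasure (leb d) (D k))"
        by (simp add: eD eC ennreal_mult ennreal_of_nat_eq_real_of_nat)
      also have "\<dots> \<le> (\<Sum>k. emeasure (leb d) (D k))"
        by (intro sum_le_suminf) auto
      also note suminf
      finally show ?thesis
        by (simp add: less_imp_le)
    qed
    then have "measure (leb d) C = 0"
      using reals_Archimedean3[of "measure (leb d) C"] measure_nonneg[of "leb d" C]
      by (metis linorder_not_less order_le_less)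
    then show ?thesis
      using C by simp
  qed
  then show ?thesis
    by (intro null_setsI) (auto simp: emeasure_eq_measure)
qed

section \<open>Points in general position\<close>

text \<open>Elimination by induction on the unknowns: a pivot equation \<open>p\<close> containing
  \<open>k\<close> clears \<open>k\<close> from the other equations, and \<open>t\<close> then
  solves equation \<open>p\<close>. Later the unknowns are sometimes coordinates of a normal and
  sometimes weights of points.\<close>

lemma homogeneous_system_solution:
  fixes a :: "'i \<Rightarrow> 'k \<Rightarrow> real"
  assumes "finite K" "finite I" "card I < card K"
  shows "\<exists>c. (\<exists>k\<in>K. c k \<noteq> 0) \<and> (\<forall>i\<in>I. (\<Sum>k\<in>K. a i k * c k) = 0)"
  using assms
proof (induction K arbitrary: I a rule: finite_induct)
  case (insert k K)
  show ?case
  proof (cases "\<forall>i\<in>I. a i k = 0")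
    case True
    then show ?thesis
      using insert.hyps by (intro exI[of _ "\<lambda>j. if j = k then 1 else 0"]) (auto intro!: sum.neutral)
  next
    case False
    then obtain p where p: "p \<in> I" "a p k \<noteq> 0" by auto
    define b where "b i j = a i j - a i k / a p k * a p j" for i j
    have "card (I - {p}) < card K"
      using insert p by (simp add: card_Diff_singleton_if) (metis Suc_pred card_gt_0_iff empty_iff not_less_eq)
    then obtain c where c: "\<exists>j\<in>K. c j \<noteq> 0" "\<forall>i\<in>I - {p}. (\<Sum>j\<in>K. b i j * c j) = 0"
      using insert.IH[of "I - {p}" b] insert.prems by auto
    define t where "t = - (\<Sum>j\<in>K. a p j * c j) / a p k"
    have sum: "(\<Sum>j\<in>insert k K. a i j * (c(k := t)) j) = a i k * t + (\<Sum>j\<in>K. a i j * c j)" for i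
    proof -
      have "(\<Sum>j\<in>K. a i j * (c(k := t)) j) = (\<Sum>j\<in>K. a i j * c j)"
        using insert.hyps by (intro sum.cong) auto
      then show ?thesis
        using insert.hyps by simp
    qed
    have p0: "a p k * t + (\<Sum>j\<in>K. a p j * c j) = 0"
      using p by (simp add: t_def)
    have "(\<Sum>j\<in>insert k K. a i j * (c(k := t)) j) = 0" if "i \<in> I" for i
    proof (cases "i = p")
      case False
      have "(\<Sum>j\<in>K. a i j * c j) = (\<Sum>j\<in>K. b i j * c j) + a i k / a p k * (\<Sum>j\<in>K. a p j * c j)"
        by (simp add: b_def sum_distrib_left left_diff_distrib sum_subtractf mult.assoc)
      also have "(\<Sum>j\<in>K. a p j * c j) = - a p k * t"
        using p0 by linarith
      also have "(\<Sum>j\<in>K. b i j * c j) = 0"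
        using c(2) False that by simp
      finally show ?thesis
        unfolding sum using p by simp
    qed (unfold sum, use p0 in simp)
    moreover have "\<exists>j\<in>insert k K. (c(k := t)) j \<noteq> 0"
      using c(1) insert.hyps by (metis fun_upd_other insertCI)
    ultimately show ?thesis by blast
  qed
qed simp

lemma exists_orthogonal:
  assumes "finite I" "card I < d"
  shows "\<exists>w\<in>usphere d. \<forall>i\<in>I. ip d (a i) w = 0"
proof -
  obtain c where c: "\<exists>k\<in>{..<d}. c k \<noteq> 0" "\<forall>i\<in>I. (\<Sum>k<d. a i k * c k) = 0"
    using homogeneous_system_solution[of "{..<d}" I a] assms by auto
  have c0: "nrm d c \<noteq> 0"
    using c by (auto simp: nrm_def ip_self_eq_0_iff)
  show ?thesis
  proof (rule bexI[OF _ radial_proj_in_usphere[OF c0]], rule ballI)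
    fix i assume "i \<in> I"
    then show "ip d (a i) (radial_proj d c) = 0"
      using c(2) by (subst ip_commute) (simp add: ip_radial_proj ip_commute[of d c], simp add: ip_def)
  qed
qed

text \<open>Affine independence of any \<open>d + 1\<close> of the points, phrased by indices so
  that coinciding points count as dependent.\<close>

definition general_position :: "nat \<Rightarrow> nat \<Rightarrow> (nat \<Rightarrow> nat \<Rightarrow> real) \<Rightarrow> bool"
  where "general_position d n x \<longleftrightarrow>
    (\<forall>I c. I \<subseteq> {..<n} \<longrightarrow> card I \<le> d + 1 \<longrightarrow> (\<Sum>i\<in>I. c i) = 0 \<longrightarrow>
      (\<forall>j<d. (\<Sum>i\<in>I. c i * x i j) = 0) \<longrightarrow> (\<forall>i\<in>I. c i = 0))"

lemma general_positionD:
  assumes "general_position d n x" "I \<subseteq> {..<n}" "card I \<le> d + 1" "(\<Sum>i\<in>I. c i) = 0"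
    "\<And>j. j < d \<Longrightarrow> (\<Sum>i\<in>I. c i * x i j) = 0" "i \<in> I"
  shows "c i = 0"
  using assms unfolding general_position_def by blast

lemma ip_sum_scale: "ip d (\<lambda>j. \<Sum>i\<in>I. c i * x i j) u = (\<Sum>i\<in>I. c i * ip d (x i) u)"
  unfolding ip_def by (simp add: sum_distrib_right sum_distrib_left mult.assoc) (rule sum.swap)

lemma hyperplane_card_le:
  assumes gp: "general_position d n x" and u: "nrm d u \<noteq> 0"
    and I: "I \<subseteq> {..<n}" "\<And>i. i \<in> I \<Longrightarrow> ip d (x i) u = b"
  shows "card I \<le> d"
proof (rule ccontr)
  assume "\<not> card I \<le> d"
  then obtain K where K: "K \<subseteq> I" "card K = d + 1" "finite K"
    using obtain_subset_with_card_n[of "d + 1" I] by (metis Suc_eq_plus1 not_less_eq_eq)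
  obtain m where m: "m < d" "u m \<noteq> 0"
    using u by (auto simp: nrm_def ip_self_eq_0_iff)
  \<comment> \<open>Equation \<open>m\<close> of the system is the affine one; the omitted coordinate equation
    follows from the others because all points lie in the hyperplane.\<close>
  obtain c where c: "\<exists>k\<in>K. c k \<noteq> 0" "\<forall>j\<in>{..<d}. (\<Sum>k\<in>K. (if j = m then 1 else x k j) * c k) = 0"
    using homogeneous_system_solution[of K "{..<d}" "\<lambda>j k. if j = m then 1 else x k j"] K by auto
  have c0: "(\<Sum>k\<in>K. c k) = 0"
    using c(2) m by force
  have cj: "(\<Sum>k\<in>K. c k * x k j) = 0" if "j < d" "j \<noteq> m" for j
    using c(2) that by (force simp: mult.commute)
  have "ip d (\<lambda>j. \<Sum>i\<in>K. c i * x i j) u = (\<Sum>i\<in>K. c i * b)"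
    unfolding ip_sum_scale using K I(2) by (intro sum.cong) auto
  also have "\<dots> = 0"
    using c0 by (simp flip: sum_distrib_right)
  also have "ip d (\<lambda>j. \<Sum>i\<in>K. c i * x i j) u = (\<Sum>j\<in>{m}. (\<Sum>i\<in>K. c i * x i j) * u j)"
    unfolding ip_def using m cj by (intro sum.mono_neutral_right) auto
  finally have "(\<Sum>i\<in>K. c i * x i m) = 0"
    using m by simp
  then have "(\<Sum>k\<in>K. c k * x k j) = 0" if "j < d" for j
    using cj that by (cases "j = m") auto
  then show False
    using general_positionD[OF gp, of K c] K I c c0 by fastforce
qed

text \<open>A linear relation among the \<open>d\<close> points and both normals, with total weight
  0 on the points, exists by counting. Its normal part \<open>z\<close> is minus the combination of
  the points, hence orthogonal to \<open>u\<close> and \<open>u'\<close> and so to itself. Thus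
  \<open>z\<close> vanishes, general position kills the weights of the points, and \<open>u\<close>,
  \<open>u'\<close> are dependent unit vectors.\<close>

lemma normal_unique:
  assumes gp: "general_position d n x" and n: "d \<le> n"
    and u: "u \<in> usphere d" "u' \<in> usphere d"
    and I: "\<And>i. i < d \<Longrightarrow> ip d (x i) u = b" "\<And>i. i < d \<Longrightarrow> ip d (x i) u' = b'"
  shows "u' = u \<or> u' = - u"
proof -
  \<comment> \<open>Rows below \<open>d\<close> are coordinates and row \<open>d\<close> is the
    total weight of the points; columns below \<open>d\<close> are the points, followed by
    \<open>u\<close> and \<open>u'\<close>. That makes \<open>d + 1\<close> equations in
    \<open>d + 2\<close> unknowns.\<close>
  define a where "a j k = (if k < d then (if j < d then x k j else 1)
      else if d \<le> j then 0 else if k = d then u j else u' j)" for j k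
  obtain c where c: "\<exists>k\<in>{..<d + 2}. c k \<noteq> 0" "\<forall>j\<in>{..<d + 1}. (\<Sum>k<d + 2. a j k * c k) = 0"
    using homogeneous_system_solution[of "{..<d + 2}" "{..<d + 1}" a] by auto
  define z where "z = c d *\<^sub>R u + c (d + 1) *\<^sub>R u'"
  have c0: "(\<Sum>k<d. c k) = 0"
    using c(2)[rule_format, of d] by (simp add: a_def)
  have cj: "(\<Sum>k<d. c k * x k j) = - z j" if "j < d" for j
    using c(2)[rule_format, of j] that by (simp add: a_def z_def fun_apply mult.commute)
  have "ip d z v = - (\<Sum>i<d. c i * ip d (x i) v)" for v
  proof -
    have "ip d z v = ip d (- (\<lambda>j. \<Sum>i<d. c i * x i j)) v"
      using cj by (intro ip_cong) (auto simp: fun_apply)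
    then show ?thesis
      by (simp add: ip_sum_scale)
  qed
  then have "ip d z u = - (\<Sum>i<d. c i * b)" "ip d z u' = - (\<Sum>i<d. c i * b')"
    using I by simp_all
  then have "ip d z u = 0" "ip d z u' = 0"
    using c0 by (simp_all flip: sum_distrib_right)
  then have "ip d z z = 0"
    by (subst (2) z_def) simp
  then have z0: "z j = 0" if "j < d" for j
    using that by (simp add: ip_self_eq_0_iff)
  have Rsp: "u j = 0" "u' j = 0" if "d \<le> j" for j
    using u that by (auto simp: usphere_eq)
  have zz: "z = 0"
  proof (rule ext)
    fix j show "z j = 0 j"
      using z0[of j] Rsp[of j] by (cases "j < d") (auto simp: z_def fun_apply)
  qed
  have "\<forall>k<d. c k = 0"
    using general_positionD[OF gp, of "{..<d}" c] n c0 cj z0 by auto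
  then have nz: "c d \<noteq> 0 \<or> c (d + 1) \<noteq> 0"
    using c(1) by (metis Suc_eq_plus1 add_2_eq_Suc' lessThan_iff less_antisym)
  have uu: "ip d u u = 1" "ip d u' u' = 1"
    using u by (auto simp: usphere_def)
  have rel: "c d *\<^sub>R u = (- c (d + 1)) *\<^sub>R u'"
    using zz unfolding z_def by (simp add: eq_neg_iff_add_eq_0)
  then have "ip d (c d *\<^sub>R u) (c d *\<^sub>R u) = ip d ((- c (d + 1)) *\<^sub>R u') ((- c (d + 1)) *\<^sub>R u')"
    by simp
  then have "(c d)\<^sup>2 = (c (d + 1))\<^sup>2"
    using uu by (simp add: power2_eq_square)
  then consider "c d = c (d + 1)" | "c d = - c (d + 1)"
    by (auto simp: power2_eq_iff)
  then show ?thesis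
  proof cases
    case 1
    then have "c d *\<^sub>R u = c d *\<^sub>R (- u')"
      using rel by simp
    then show ?thesis
      using nz 1 by (metis minus_minus scaleR_cancel_left)
  next
    case 2
    then show ?thesis
      using rel nz by (metis neg_equal_0_iff_equal scaleR_cancel_left)
  qed
qed

text \<open>Among the hyperplanes supporting the points at \<open>x 0\<close>, one with the most
  contacts is taken; the tangent hyperplane at \<open>x 0\<close> shows that there are any. With
  fewer than \<open>d\<close> contacts it could be tilted, keeping them, until it meets a further
  point. General position excludes more than \<open>d\<close>.\<close>

lemma exists_supporting_facet:
  assumes gp: "general_position d n x" and x: "\<And>i. i < n \<Longrightarrow> x i \<in> usphere d"
    and d: "0 < d" "d < n"
  obtains J u where "J \<subseteq> {..<n}" "0 \<in> J" "card J = d" "u \<in> usphere d"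
    "\<And>j. j \<in> J \<Longrightarrow> ip d (x j) u = ip d (x 0) u"
    "\<And>j. j < n \<Longrightarrow> j \<notin> J \<Longrightarrow> ip d (x j) u < ip d (x 0) u"
proof -
  define T where "T u = {j. j < n \<and> ip d (x j) u = ip d (x 0) u}" for u
  define F where "F u \<longleftrightarrow> nrm d u \<noteq> 0 \<and> (\<forall>j<n. ip d (x j) u \<le> ip d (x 0) u)" for u
  have x0: "ip d (x 0) (x 0) = 1"
    using x[of 0] d by (auto simp: usphere_def)
  have "F (x 0)"
    unfolding F_def
  proof (intro conjI allI impI)
    fix j assume "j < n"
    then show "ip d (x j) (x 0) \<le> ip d (x 0) (x 0)"
      using ip_le_nrm[of d "x j" "x 0"] nrm_usphere[OF x] d x0 by simp
  qed (use x0 in \<open>simp add: nrm_def\<close>)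
  moreover have bound: "card (T u) \<le> n" for u
    using card_mono[of "{..<n}" "T u"] by (auto simp: T_def)
  ultimately obtain u where u: "F u" "\<And>v. F v \<Longrightarrow> card (T v) \<le> card (T u)"
    using ex_has_greatest_nat[of F "x 0" "\<lambda>u. card (T u)" "Suc n"] by (auto simp: less_Suc_eq_le)
  have fin: "finite (T u)" for u
    by (auto simp: T_def)
  have T0: "0 \<in> T u" for u
    using d by (auto simp: T_def)
  have le: "card (T u) \<le> d"
    using u(1) by (intro hyperplane_card_le[OF gp, of u _ "ip d (x 0) u"]) (auto simp: F_def T_def)
  have cardT: "card (T u) = d"
  proof (rule ccontr)
    assume "card (T u) \<noteq> d"
    then have lt: "card (T u) < d" using le by simp
    \<comment> \<open>For \<open>j = 0\<close> the difference to \<open>x 0\<close> is zero, so this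
      slot carries the condition that \<open>w\<close> be orthogonal to \<open>u\<close>; the number
      of conditions remains \<open>card (T u)\<close>.\<close>
    obtain w where w: "w \<in> usphere d" "\<forall>j\<in>T u. ip d (if j = 0 then u else x j - x 0) w = 0"
      using exists_orthogonal[OF fin lt, of "\<lambda>j. if j = 0 then u else x j - x 0"] by (elim bexE)
    have wu: "ip d u w = 0"
      using bspec[OF w(2) T0] by simp
    have wT: "ip d (x j) w = ip d (x 0) w" if "j \<in> T u" for j
      using bspec[OF w(2) that] by (cases "j = 0") auto
    \<comment> \<open>Otherwise all \<open>n > d\<close> points would lie in one hyperplane. The
      sign of \<open>w\<close> is then chosen so that tilting moves towards some point.\<close>
    have "\<exists>j<n. ip d (x j) w \<noteq> ip d (x 0) w"
    proof (rule ccontr)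
      assume "\<not> (\<exists>j<n. ip d (x j) w \<noteq> ip d (x 0) w)"
      then have "ip d (x j) w = ip d (x 0) w" if "j \<in> {..<n}" for j
        using that by blast
      then have "card {..<n} \<le> d"
        using nrm_usphere[OF w(1)] by (intro hyperplane_card_le[OF gp, of w]) (simp, simp, blast)
      then show False using d by simp
    qed
    then obtain y where y: "y = w \<or> y = - w" "\<exists>j<n. ip d (x 0) y < ip d (x j) y"
    proof -
      obtain j where j: "j < n" "ip d (x j) w \<noteq> ip d (x 0) w"
        using \<open>\<exists>j<n. _ j\<close> by blast
      show ?thesis
      proof (cases "ip d (x 0) w < ip d (x j) w")
        case True
        then show ?thesis using j by (intro that[of w]) auto
      next
        case False
        then have "ip d (x 0) (- w) < ip d (x j) (- w)" using j by simp
        then show ?thesis using j by (intro that[of "- w"]) auto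
      qed
    qed
    have yu: "ip d u y = 0" and yT: "\<And>j. j \<in> T u \<Longrightarrow> ip d (x j) y = ip d (x 0) y"
      using y(1) wu wT by (auto simp del: ip_linear) simp_all
    define P where "P = {j. j < n \<and> ip d (x 0) y < ip d (x j) y}"
    \<comment> \<open>Tilting the normal to u + c y brings point \<open>j\<close> into the
      hyperplane at c = f j; the smallest of these values over \<open>P\<close> leaves no point on
      the wrong side.\<close>
    define f where "f j = (ip d (x 0) u - ip d (x j) u) / (ip d (x j) y - ip d (x 0) y)" for j
    have P: "finite P" "P \<noteq> {}"
      using y(2) by (auto simp: P_def)
    have "Min (f ` P) \<in> f ` P"
      using P by (intro Min_in) auto
    then obtain q where "q \<in> P" "Min (f ` P) = f q"
      by (rule imageE)
    then have q: "q \<in> P" "\<And>j. j \<in> P \<Longrightarrow> f q \<le> f j"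
      using P(1) Min_le[of "f ` P"] by (simp, metis finite_imageI image_eqI)
    have qT: "q \<notin> T u"
      using q(1) yT by (auto simp: P_def)
    have "0 < f q"
    proof -
      have "q < n" "ip d (x q) u \<noteq> ip d (x 0) u"
        using q(1) qT by (auto simp: T_def P_def)
      moreover from this have "ip d (x q) u \<le> ip d (x 0) u"
        using u(1) by (simp add: F_def)
      ultimately have "ip d (x q) u < ip d (x 0) u"
        by simp
      then show ?thesis
        using q(1) by (simp add: f_def P_def)
    qed
    define v where "v = u + f q *\<^sub>R y"
    have "ip d v u = ip d u u"
      using yu by (simp add: v_def ip_commute[of d y])
    moreover have "ip d u u \<noteq> 0"
      using u(1) by (simp add: F_def nrm_def)
    ultimately have "nrm d v \<noteq> 0"
      using abs_ip_le_nrm[of d v u] ip_self_nonneg[of d u] by (metis abs_le_zero_iff mult_zero_left)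
    moreover have "ip d (x j) v \<le> ip d (x 0) v" if "j < n" for j
    proof (cases "j \<in> P")
      case True
      then have "f q * (ip d (x j) y - ip d (x 0) y) \<le> f j * (ip d (x j) y - ip d (x 0) y)"
        using q(2) by (intro mult_right_mono) (auto simp: P_def)
      also have "\<dots> = ip d (x 0) u - ip d (x j) u"
        using True by (simp add: f_def P_def)
      finally show ?thesis
        by (simp add: v_def algebra_simps)
    next
      case False
      then have "f q * ip d (x j) y \<le> f q * ip d (x 0) y"
        using \<open>0 < f q\<close> that by (intro mult_left_mono) (auto simp: P_def)
      then show ?thesis
        using u(1) that by (simp add: v_def F_def add_mono)
    qed
    ultimately have "F v"
      by (simp add: F_def)
    moreover have "insert q (T u) \<subseteq> T v"
    proof -
      have "f q * (ip d (x q) y - ip d (x 0) y) = ip d (x 0) u - ip d (x q) u"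
        using q(1) by (simp add: f_def P_def)
      then have "ip d (x q) v = ip d (x 0) v"
        by (simp add: v_def algebra_simps)
      moreover have "ip d (x j) v = ip d (x 0) v" if "j \<in> T u" for j
        using yT[OF that] that by (simp add: v_def T_def)
      ultimately show ?thesis
        using q(1) unfolding T_def P_def by blast
    qed
    then have "card (insert q (T u)) \<le> card (T v)"
      by (intro card_mono fin)
    ultimately show False
      using u(2)[of v] qT fin[of u] by simp
  qed
  have nu: "nrm d u \<noteq> 0" "0 < nrm d u"
    using u(1) by (auto simp: F_def less_le)
  have rad: "ip d a (radial_proj d u) = ip d a u / nrm d u" for a
    by (metis ip_commute ip_radial_proj)
  show ?thesis
  proof (rule that[of "T u" "radial_proj d u"])
    show "radial_proj d u \<in> usphere d"
      by (rule radial_proj_in_usphere[OF nu(1)])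
    show "ip d (x j) (radial_proj d u) = ip d (x 0) (radial_proj d u)" if "j \<in> T u" for j
      using that unfolding rad T_def by simp
    show "ip d (x j) (radial_proj d u) < ip d (x 0) (radial_proj d u)" if "j < n" "j \<notin> T u" for j
    proof -
      have "ip d (x j) u \<noteq> ip d (x 0) u" "ip d (x j) u \<le> ip d (x 0) u"
        using that u(1) by (auto simp: T_def F_def)
      then show ?thesis
        unfolding rad using nu by (intro divide_strict_right_mono) auto
    qed
  qed (use T0 cardT in \<open>auto simp: T_def\<close>)
qed

text \<open>A point of the hull at level \<open>b\<close> is a convex combination of points at level
  at most \<open>b\<close>, so those strictly below get weight 0. The first \<open>d\<close> points
  are distinct and affinely independent by general position, which gives the dimension.\<close>

lemma is_facet_if_supported:
  assumes gp: "general_position d n x" and d: "0 < d" "d \<le> n"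
    and eq: "\<And>j. j < d \<Longrightarrow> ip d (x j) u = b"
    and less: "\<And>j. d \<le> j \<Longrightarrow> j < n \<Longrightarrow> ip d (x j) u < b"
  shows "is_facet d (convex hull (x ` {..<d})) (convex hull (x ` {..<n}))"
proof -
  let ?S = "x ` {..<n}" and ?J = "x ` {..<d}"
  have JS: "?J \<subseteq> ?S" using d by auto
  have ipS: "ip d p u \<le> b" if "p \<in> ?S" for p
    using that eq less by (metis imageE lessThan_iff less_eq_real_def not_le)
  have convex_le: "convex {p. ip d p u \<le> b}"
    unfolding convex_alt by (auto simp: convex_bound_le)
  have convex_ge: "convex {p. b \<le> ip d p u}"
  proof -
    have "(1 - s) * b + s * b \<le> (1 - s) * ip d p u + s * ip d q u"
      if "b \<le> ip d p u" "b \<le> ip d q u" "0 \<le> s" "s \<le> 1" for p q s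
      using that by (intro add_mono mult_left_mono) auto
    then show ?thesis
      unfolding convex_alt by (auto simp: algebra_simps)
  qed
  have P_le: "ip d p u \<le> b" if "p \<in> convex hull ?S" for p
    using hull_minimal[of ?S "{p. ip d p u \<le> b}" convex] ipS convex_le that by auto
  have F_ge: "b \<le> ip d p u" if "p \<in> convex hull ?J" for p
    using hull_minimal[of ?J "{p. b \<le> ip d p u}" convex] eq convex_ge that by auto
  have F_I: "p \<in> convex hull ?J" if p: "p \<in> convex hull ?S" "b \<le> ip d p u" for p
  proof -
    obtain c where c: "\<forall>q\<in>?S. 0 \<le> c q" "sum c ?S = 1" "(\<Sum>q\<in>?S. c q *\<^sub>R q) = p"
      using p(1) by (auto simp: convex_hull_finite)
    have "0 = b * sum c ?S - b" using c by simp
    also have "\<dots> \<ge> (\<Sum>q\<in>?S. c q * (b - ip d q u))"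
      using p(2) c(3)[symmetric] by (simp add: ip_sum_left algebra_simps sum_subtractf sum_distrib_left)
    finally have "(\<Sum>q\<in>?S. c q * (b - ip d q u)) \<le> 0" .
    moreover have nn: "0 \<le> c q * (b - ip d q u)" if "q \<in> ?S" for q
      using that c(1) ipS by (intro mult_nonneg_nonneg) auto
    ultimately have "\<forall>q\<in>?S. c q * (b - ip d q u) = 0"
      by (metis (no_types, lifting) antisym finite_imageI finite_lessThan sum_nonneg sum_nonneg_eq_0_iff)
    then have z: "c q = 0" if qS: "q \<in> ?S - ?J" for q
    proof -
      obtain i where i: "i < n" "q = x i"
        using qS by auto
      have "d \<le> i"
        using qS i by (intro leI) blast
      with i have "c q * (b - ip d q u) = 0" "b - ip d q u \<noteq> 0"
        using \<open>\<forall>q\<in>?S. _ q = 0\<close> less by force+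
      then show ?thesis by simp
    qed
    have "sum c ?J = 1" "(\<Sum>q\<in>?J. c q *\<^sub>R q) = p"
      using c z JS by (metis (no_types, lifting) finite_imageI finite_lessThan sum.mono_neutral_left,
        metis (no_types, lifting) finite_imageI finite_lessThan scaleR_zero_left sum.mono_neutral_left)
    moreover have "\<forall>q\<in>?J. 0 \<le> c q"
      using c(1) JS by blast
    ultimately show ?thesis
      unfolding convex_hull_finite[OF finite_imageI[OF finite_lessThan]] by blast
  qed
  have "convex hull ?J face_of convex hull ?S"
    unfolding face_of_def
  proof (intro conjI ballI impI)
    show "convex hull ?J \<subseteq> convex hull ?S"
      by (rule hull_mono[OF JS])
    fix p q r assume pq: "p \<in> convex hull ?S" "q \<in> convex hull ?S" and r: "r \<in> convex hull ?J"
      "r \<in> open_segment p q"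
    then obtain s where s: "0 < s" "s < 1" "r = (1 - s) *\<^sub>R p + s *\<^sub>R q"
      by (auto simp: in_segment)
    have 1: "ip d p u \<le> b" "ip d q u \<le> b" "b \<le> (1 - s) * ip d p u + s * ip d q u"
      using P_le pq F_ge[OF r(1)] s by auto
    have "b \<le> ip d p u"
    proof (rule ccontr)
      assume "\<not> ?thesis"
      then have "(1 - s) * ip d p u + s * ip d q u < (1 - s) * b + s * b"
        using 1 s by (intro add_less_le_mono mult_strict_left_mono mult_left_mono) auto
      then show False using 1 by (simp add: algebra_simps)
    qed
    moreover have "b \<le> ip d q u"
    proof (rule ccontr)
      assume "\<not> ?thesis"
      then have "(1 - s) * ip d p u + s * ip d q u < (1 - s) * b + s * b"
        using 1 s by (intro add_le_less_mono mult_strict_left_mono mult_left_mono) auto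
      then show False using 1 by (simp add: algebra_simps)
    qed
    ultimately show "p \<in> convex hull ?J" "q \<in> convex hull ?J"
      using F_I pq by auto
  qed (simp add: convex_convex_hull)
  moreover have "has_aff_dim (convex hull ?J) (d - 1)"
  proof -
    have inj: "inj_on x {..<d}"
    proof (rule inj_onI, rule ccontr)
      fix i j assume ij: "i \<in> {..<d}" "j \<in> {..<d}" "x i = x j" "i \<noteq> j"
      define c :: "nat \<Rightarrow> real" where "c k = (if k = i then 1 else - 1)" for k
      have c: "c i = 1" "c j = - 1"
        using ij by (simp_all add: c_def)
      have "c i = 0"
      proof (rule general_positionD[OF gp, of "{i, j}"])
        show "card {i, j} \<le> d + 1"
          using ij d by (simp add: card_insert_if)
        show "(\<Sum>k\<in>{i, j}. c k * x k l) = 0" for l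
          using ij c by simp
      qed (use ij d c in auto)
      then show False
        using c by simp
    qed
    have "\<not> affine_dependent ?J"
    proof
      assume "affine_dependent ?J"
      then obtain c v where c: "sum c ?J = 0" "v \<in> ?J" "c v \<noteq> 0" "(\<Sum>v\<in>?J. c v *\<^sub>R v) = 0"
        by (auto simp: affine_dependent_explicit_finite)
      obtain k where k: "k < d" "v = x k" using c(2) by auto
      have fun_sum: "(\<Sum>i\<in>A. f i) j = (\<Sum>i\<in>A. f i j)" for f :: "nat \<Rightarrow> nat \<Rightarrow> real" and A j
        by (induction A rule: infinite_finite_induct) (auto simp: fun_apply)
      have "(\<Sum>i<d. c (x i)) = 0"
        using c(1) by (simp add: sum.reindex[OF inj])
      moreover have "(\<Sum>i<d. c (x i) * x i j) = 0" for j
      proof -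
        have "(\<Sum>i<d. c (x i) *\<^sub>R x i) j = 0"
          using c(4) by (simp add: sum.reindex[OF inj] fun_apply)
        then show ?thesis
          by (simp add: fun_sum fun_apply)
      qed
      ultimately have "c (x k) = 0"
        using k d by (intro general_positionD[OF gp, of "{..<d}" "\<lambda>i. c (x i)" k]) auto
      then show False using c k by simp
    qed
    then show ?thesis
      unfolding has_aff_dim_def using d
      by (intro exI[of _ ?J]) (simp add: affine_hull_convex_hull card_image[OF inj])
  qed
  ultimately show ?thesis
    by (simp add: is_facet_def)
qed

section \<open>Independent points on the sphere\<close>

abbreviation sph :: "nat set \<Rightarrow> nat \<Rightarrow> (nat \<Rightarrow> nat \<Rightarrow> real) measure"
  where "sph I d \<equiv> Pi\<^sub>M I (\<lambda>_. unif_sphere d)"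

lemma product_prob_space_sphere: "product_prob_space (\<lambda>_::nat. unif_sphere d)"
proof -
  interpret prob_space "unif_sphere d" by (rule prob_space_unif_sphere)
  show ?thesis
    by unfold_locales
qed

lemma prob_space_sph: "prob_space (sph I d)"
  by (intro prob_space_PiM prob_space_unif_sphere)

lemma sets_sph: "sets (sph I d) = sets (Pi\<^sub>M I (\<lambda>_. borel))"
  by (intro sets_PiM_cong) auto

lemma measurable_component_sph [measurable]:
  assumes "i \<in> I"
  shows "(\<lambda>x. x i) \<in> sph I d \<rightarrow>\<^sub>M borel"
  using measurable_component_singleton[OF assms, of "\<lambda>_. unif_sphere d"]
  by (simp add: measurable_cong_sets[OF refl sets_unif_sphere])

lemma measurable_coordinate_sph: "i \<in> I \<Longrightarrow> (\<lambda>x. x i j) \<in> borel_measurable (sph I d)"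
  using measurable_compose[OF measurable_component_sph measurable_coordinate_borel] by simp

text \<open>Beyond \<open>{..<n}\<close> the elements of the product space are
  \<open>undefined\<close>, so those coordinates are constant. This transfers closed sets of the
  full function space to the product space.\<close>

lemma measurable_inclusion_sph: "(\<lambda>x. x) \<in> sph {..<n} d \<rightarrow>\<^sub>M borel"
proof (rule measurable_coordinatewise_then_product)
  fix i show "(\<lambda>x. x i) \<in> sph {..<n} d \<rightarrow>\<^sub>M borel"
  proof (cases "i < n")
    case False
    then have "(\<lambda>x. x i) \<in> sph {..<n} d \<rightarrow>\<^sub>M borel \<longleftrightarrow> (\<lambda>x. undefined) \<in> sph {..<n} d \<rightarrow>\<^sub>M (borel :: (nat \<Rightarrow> real) measure)"
      by (intro measurable_cong) (auto simp: space_PiM PiE_def extensional_def)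
    then show ?thesis by simp
  qed auto
qed

section \<open>Measurability of events that ask for a direction\<close>

lemma closed_sets_sph:
  assumes "closed C"
  shows "{x \<in> space (sph {..<n} d). x \<in> C} \<in> sets (sph {..<n} d)"
  using measurable_sets[OF measurable_inclusion_sph, of C n d] assms
  by (simp add: vimage_def Int_def conj_commute)

text \<open>Projection of a closed relation along a compact factor. It serves for events that ask
  for a unit vector, and for events that ask for bounded coefficients.\<close>

lemma closed_bex_compact:
  fixes K :: "'b::metric_space set" and Q :: "'a::metric_space \<Rightarrow> 'b \<Rightarrow> bool"
  assumes "compact K" "closed {p. Q (fst p) (snd p)}"
  shows "closed {x. \<exists>c\<in>K. Q x c}"
  unfolding closed_sequential_limits
proof (intro allI impI, elim conjE)
  fix X l assume X: "\<forall>n. X n \<in> {x. \<exists>c\<in>K. Q x c}" "X \<longlonglongrightarrow> l"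
  then obtain c where c: "\<And>n. c n \<in> K" "\<And>n. Q (X n) (c n)"
    by (auto simp: Bex_def) metis
  then obtain b r where br: "b \<in> K" "strict_mono (r :: nat \<Rightarrow> nat)" "(c \<circ> r) \<longlonglongrightarrow> b"
    using assms(1) unfolding compact_def by metis
  have "(\<lambda>n. (X (r n), c (r n))) \<longlonglongrightarrow> (l, b)"
    using LIMSEQ_subseq_LIMSEQ[OF X(2) br(2)] br(3) by (intro tendsto_Pair) (auto simp: o_def)
  then have "(l, b) \<in> {p. Q (fst p) (snd p)}"
    using closed_sequentially[OF assms(2), of "\<lambda>n. (X (r n), c (r n))"] c(2) by auto
  then show "l \<in> {x. \<exists>c\<in>K. Q x c}"
    using br(1) by auto
qed

lemma compact_box: "compact {c::nat \<Rightarrow> real. \<forall>i. c i \<in> {- m..m}}"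
proof -
  have "compactin (product_topology (\<lambda>_. euclidean) UNIV) (PiE UNIV (\<lambda>_::nat. {- m..m::real}))"
    by (subst compactin_PiE) (simp add: compactin_euclidean_iff)
  then show ?thesis
    by (simp add: euclidean_product_topology compactin_euclidean_iff PiE_def Pi_def)
qed

lemma compact_usphere: "compact (usphere d)"
proof -
  have "x i \<in> {- 1..1}" if "x \<in> usphere d" for x i
  proof (cases "i < d")
    case True
    have "(x i)\<^sup>2 \<le> (\<Sum>j<d. (x j)\<^sup>2)"
      using True by (intro member_le_sum) auto
    also have "\<dots> = 1"
      using that by (simp add: usphere_def ip_def power2_eq_square)
    finally show ?thesis
      by (simp add: abs_square_le_1 abs_le_iff)
  qed (use that in \<open>auto simp: usphere_eq\<close>)
  then have "usphere d = {c. \<forall>i. c i \<in> {- 1..1}} \<inter> usphere d"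
    by auto
  then show ?thesis
    using compact_Int_closed[OF compact_box[of 1] closed_usphere[of d]] by simp
qed

lemma continuous_on_eval2:
  "continuous_on UNIV (\<lambda>p :: (nat \<Rightarrow> nat \<Rightarrow> real) \<times> (nat \<Rightarrow> real). fst p i j)"
  "continuous_on UNIV (\<lambda>p :: (nat \<Rightarrow> nat \<Rightarrow> real) \<times> (nat \<Rightarrow> real). snd p i)"
proof -
  have "continuous_on UNIV (\<lambda>p :: (nat \<Rightarrow> nat \<Rightarrow> real) \<times> (nat \<Rightarrow> real). fst p i)"
    by (rule continuous_on_product_then_coordinatewise[OF continuous_on_fst[OF continuous_on_id]])
  from continuous_on_product_then_coordinatewise[OF this]
  show "continuous_on UNIV (\<lambda>p :: (nat \<Rightarrow> nat \<Rightarrow> real) \<times> (nat \<Rightarrow> real). fst p i j)" .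
  show "continuous_on UNIV (\<lambda>p :: (nat \<Rightarrow> nat \<Rightarrow> real) \<times> (nat \<Rightarrow> real). snd p i)"
    by (rule continuous_on_product_then_coordinatewise[OF continuous_on_snd[OF continuous_on_id]])
qed

lemma continuous_on_ip_pair:
  "continuous_on UNIV (\<lambda>p :: (nat \<Rightarrow> nat \<Rightarrow> real) \<times> (nat \<Rightarrow> real). ip d (fst p i) (snd p))"
  by (intro continuous_on_ip continuous_on_eval2)

text \<open>At most \<open>d\<close> points lie in a common hyperplane, which is a null set for one
  further independent point; hence integrating over \<open>x k\<close> first gives 0.\<close>

lemma AE_not_in_affine_hull:
  assumes d: "2 \<le> d" and k: "k < n" and I: "I \<subseteq> {..<n} - {k}" "card I \<le> d"
  shows "AE x in sph {..<n} d. \<not> (\<exists>c. (\<Sum>i\<in>I. c i) = 1 \<and> (\<forall>j<d. x k j = (\<Sum>i\<in>I. c i * x i j)))"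
proof -
  interpret product_prob_space "\<lambda>_::nat. unif_sphere d" by (rule product_prob_space_sphere)
  have finI: "finite I"
    using I finite_subset by blast
  define Q where "Q x c \<longleftrightarrow> (\<Sum>i\<in>I. c i) = 1 \<and> (\<forall>j<d. x k j = (\<Sum>i\<in>I. c i * x i j))"
    for x :: "nat \<Rightarrow> nat \<Rightarrow> real" and c :: "nat \<Rightarrow> real"
  \<comment> \<open>Bounding the coefficients by \<open>m\<close> makes them range over a compact
    set, so the event becomes closed; the full event is a countable union over
    \<open>m\<close>.\<close>
  define Nm where "Nm m = {x \<in> space (sph {..<n} d). \<exists>c\<in>{c. \<forall>i. c i \<in> {- real m..real m}}. Q x c}" for m
  have Nm_sets: "Nm m \<in> sets (sph {..<n} d)" for m
  proof -
    have "closed {p :: (nat \<Rightarrow> nat \<Rightarrow> real) \<times> (nat \<Rightarrow> real). Q (fst p) (snd p)}"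
      unfolding Q_def
      by (intro closed_Collect_conj closed_Collect_all closed_Collect_imp closed_Collect_eq
          continuous_on_sum continuous_on_mult continuous_on_eval2 continuous_on_const) auto
    from closed_sets_sph[OF closed_bex_compact[OF compact_box this]]
    show ?thesis by (simp add: Nm_def)
  qed
  have null: "emeasure (sph {..<n} d) (Nm m) = 0" for m
  proof -
    have ins: "insert k ({..<n} - {k}) = {..<n}"
      using k by auto
    have "emeasure (sph {..<n} d) (Nm m) = (\<integral>\<^sup>+x. indicator (Nm m) x \<partial>sph (insert k ({..<n} - {k})) d)"
      unfolding ins using Nm_sets by simp
    also have "\<dots> = (\<integral>\<^sup>+x. (\<integral>\<^sup>+y. indicator (Nm m) (x(k := y)) \<partial>unif_sphere d) \<partial>sph ({..<n} - {k}) d)"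
    proof (rule product_nn_integral_insert)
      show "indicator (Nm m) \<in> borel_measurable (sph (insert k ({..<n} - {k})) d)"
        unfolding ins using Nm_sets by simp
    qed auto
    also have "\<dots> = (\<integral>\<^sup>+x. 0 \<partial>sph ({..<n} - {k}) d)"
    proof (intro nn_integral_cong)
      fix x :: "nat \<Rightarrow> nat \<Rightarrow> real"
      obtain w b where w: "w \<in> usphere d" "\<And>i. i \<in> I \<Longrightarrow> ip d (x i) w = b"
      proof (cases "I = {}")
        case True
        obtain w where "w \<in> usphere d"
          using exists_orthogonal[of "{}" d] d by auto
        then show ?thesis using True that by blast
      next
        case False
        then obtain p where p: "p \<in> I" by auto
        have "card (I - {p}) < d"
          using p I(2) finI d by (simp add: card_Diff_singleton)
        then obtain w where w: "w \<in> usphere d" "\<forall>i\<in>I - {p}. ip d (x i - x p) w = 0"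
          using exists_orthogonal[of "I - {p}" d "\<lambda>i. x i - x p"] finI by auto
        have "ip d (x i) w = ip d (x p) w" if "i \<in> I" for i
          using w(2) that by (cases "i = p") auto
        then show ?thesis using w that by blast
      qed
      have "{y. x(k := y) \<in> Nm m} \<subseteq> {y. ip d y w = b}"
      proof
        fix y assume "y \<in> {y. x(k := y) \<in> Nm m}"
        then obtain c where c: "Q (x(k := y)) c"
          by (auto simp: Nm_def)
        have "(\<Sum>i\<in>I. c i * (x(k := y)) i j) = (\<Sum>i\<in>I. c i * x i j)" for j
          using I by (intro sum.cong) auto
        then have "ip d y w = ip d (\<lambda>j. \<Sum>i\<in>I. c i * x i j) w"
          using c by (intro ip_cong) (auto simp: Q_def)
        also have "\<dots> = (\<Sum>i\<in>I. c i * b)"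
          unfolding ip_sum_scale using w by simp
        also have "\<dots> = b"
          using c by (simp add: Q_def flip: sum_distrib_right)
        finally show "y \<in> {y. ip d y w = b}" by simp
      qed
      moreover have "{y. ip d y w = b} \<in> null_sets (unif_sphere d)"
        using nrm_usphere[OF w(1)] d by (rule hyperplane_null_sets)
      ultimately have "AE y in unif_sphere d. x(k := y) \<notin> Nm m"
        by (intro AE_I'[of "{y. ip d y w = b}"]) auto
      then have "(\<integral>\<^sup>+y. indicator (Nm m) (x(k := y)) \<partial>unif_sphere d) = (\<integral>\<^sup>+y. 0 \<partial>unif_sphere d)"
        by (intro nn_integral_cong_AE) (auto simp: indicator_def)
      then show "(\<integral>\<^sup>+y. indicator (Nm m) (x(k := y)) \<partial>unif_sphere d) = 0"
        by simp
    qed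
    finally show ?thesis by simp
  qed
  have "AE x in sph {..<n} d. \<forall>m. x \<notin> Nm m"
    unfolding AE_all_countable using null Nm_sets by (intro allI AE_not_in null_setsI) auto
  then show ?thesis
    using AE_space
  proof (eventually_elim, goal_cases)
    case (1 x)
    show ?case
    proof (rule notI)
      assume "\<exists>c. (\<Sum>i\<in>I. c i) = 1 \<and> (\<forall>j<d. x k j = (\<Sum>i\<in>I. c i * x i j))"
      then obtain c where c: "Q x c"
        unfolding Q_def by blast
      define m where "m = nat \<lceil>\<Sum>i\<in>I. \<bar>c i\<bar>\<rceil>"
      \<comment> \<open>The box constrains all coordinates, including those outside \<open>I\<close>
        where \<open>c\<close> is arbitrary.\<close>
      define c' where "c' i = (if i \<in> I then c i else 0)" for i
      have "\<bar>c' i\<bar> \<le> real m" for i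
      proof (cases "i \<in> I")
        case True
        then have "\<bar>c i\<bar> \<le> (\<Sum>i\<in>I. \<bar>c i\<bar>)"
          using finI by (intro member_le_sum) auto
        then show ?thesis
          using True unfolding m_def c'_def by simp linarith
      qed (simp add: c'_def)
      then have "c' \<in> {c. \<forall>i. c i \<in> {- real m..real m}}"
        by (simp add: abs_le_iff minus_le_iff)
      moreover have "Q x c'"
        using c by (simp add: Q_def c'_def cong: sum.cong)
      ultimately show False
        using 1(1)[rule_format, of m] 1(2) unfolding Nm_def by blast
    qed
  qed
qed

text \<open>A dependence with nonzero weight at \<open>k\<close> expresses \<open>x k\<close> as an
  affine combination of the others, and only finitely many pairs of \<open>k\<close> and
  \<open>I\<close> occur.\<close>

lemma AE_general_position:
  assumes d: "2 \<le> d"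
  shows "AE x in sph {..<n} d. general_position d n x"
proof -
  define S where "S = {(k, I). k < n \<and> I \<subseteq> {..<n} - {k} \<and> card I \<le> d}"
  define B where "B k I x \<longleftrightarrow> (\<exists>c. (\<Sum>i\<in>I. c i) = 1 \<and> (\<forall>j<d. x k j = (\<Sum>i\<in>I. c i * x i j)))"
    for k and I :: "nat set" and x :: "nat \<Rightarrow> nat \<Rightarrow> real"
  have "finite S"
    by (rule finite_subset[of _ "{..<n} \<times> Pow {..<n}"]) (auto simp: S_def)
  then have "AE x in sph {..<n} d. \<forall>p\<in>S. \<not> B (fst p) (snd p) x"
  proof (rule AE_finite_allI)
    fix p assume "p \<in> S"
    then show "AE x in sph {..<n} d. \<not> B (fst p) (snd p) x"
      unfolding B_def by (intro AE_not_in_affine_hull d) (auto simp: S_def)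
  qed
  then show ?thesis
  proof eventually_elim
    case (elim x)
    show ?case
      unfolding general_position_def
    proof (intro allI impI ballI, rule ccontr)
      fix I c k assume I: "I \<subseteq> {..<n}" "card I \<le> d + 1" "(\<Sum>i\<in>I. c i) = 0"
        "\<forall>j<d. (\<Sum>i\<in>I. c i * x i j) = 0" "k \<in> I" "c k \<noteq> 0"
      have fin: "finite I"
        using I(1) finite_subset by blast
      have "B k (I - {k}) x"
        unfolding B_def
      proof (intro exI[of _ "\<lambda>i. - c i / c k"] conjI allI impI)
        show "(\<Sum>i\<in>I - {k}. - c i / c k) = 1"
          using I fin by (simp add: sum_diff1 sum_negf flip: sum_divide_distrib)
        fix j assume "j < d"
        then have "(\<Sum>i\<in>I - {k}. c i * x i j) = - (c k * x k j)"
          using I fin by (simp add: sum_diff1)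
        moreover have "(\<Sum>i\<in>I - {k}. - c i / c k * x i j) = - (\<Sum>i\<in>I - {k}. c i * x i j) / c k"
          by (simp add: sum_negf sum_divide_distrib)
        ultimately show "x k j = (\<Sum>i\<in>I - {k}. - c i / c k * x i j)"
          using I by simp
      qed
      moreover have "(k, I - {k}) \<in> S"
        using I fin by (auto simp: S_def card_Diff_singleton)
      ultimately show False
        using elim by force
    qed
  qed
qed

subsection \<open>The probability of a facet\<close>

text \<open>Measurable substitute for the facet event: exactly the points of \<open>J\<close> touch
  the hyperplane, which by \<open>is_facet_if_supported\<close> gives a facet in general position
  when \<open>J\<close> is \<open>{..<d}\<close>.\<close>

definition support_event :: "nat \<Rightarrow> nat \<Rightarrow> nat set \<Rightarrow> (nat \<Rightarrow> nat \<Rightarrow> real) set"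
  where "support_event d n J = {x \<in> space (sph {..<n} d). \<exists>u\<in>usphere d.
    (\<forall>i\<in>J. \<forall>i'\<in>J. ip d (x i) u = ip d (x i') u) \<and>
    (\<forall>i\<in>J. \<forall>j<n. j \<notin> J \<longrightarrow> ip d (x j) u < ip d (x i) u)}"

lemma support_event_sets:
  assumes "finite J"
  shows "support_event d n J \<in> sets (sph {..<n} d)"
proof -
  \<comment> \<open>A strict inequality is not a closed condition; it is exhausted by gaps of size
    1/(m + 1), for which the relation between \<open>x\<close> and \<open>u\<close> is
    closed.\<close>
  define Q where "Q m x u \<longleftrightarrow> (\<forall>i\<in>J. \<forall>i'\<in>J. ip d (x i) u = ip d (x i') u) \<and>
    (\<forall>i\<in>J. \<forall>j<n. j \<notin> J \<longrightarrow> ip d (x j) u + 1 / real (Suc m) \<le> ip d (x i) u)"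
    for m :: nat and x :: "nat \<Rightarrow> nat \<Rightarrow> real" and u :: "nat \<Rightarrow> real"
  have "closed {p :: (nat \<Rightarrow> nat \<Rightarrow> real) \<times> (nat \<Rightarrow> real). Q m (fst p) (snd p)}" for m
    unfolding Q_def Ball_def
    by (intro closed_Collect_conj closed_Collect_all closed_Collect_imp closed_Collect_eq closed_Collect_le
        continuous_on_add continuous_on_ip_pair continuous_on_const) auto
  then have meas: "{x \<in> space (sph {..<n} d). x \<in> {x. \<exists>u\<in>usphere d. Q m x u}} \<in> sets (sph {..<n} d)" for m
    by (intro closed_sets_sph closed_bex_compact[where Q = "Q m"] compact_usphere)
  have "support_event d n J = (\<Union>m. {x \<in> space (sph {..<n} d). x \<in> {x. \<exists>u\<in>usphere d. Q m x u}})"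
  proof (intro set_eqI iffI)
    fix x assume "x \<in> support_event d n J"
    then obtain u where x: "x \<in> space (sph {..<n} d)" and u: "u \<in> usphere d"
      "\<forall>i\<in>J. \<forall>i'\<in>J. ip d (x i) u = ip d (x i') u"
      "\<forall>i\<in>J. \<forall>j<n. j \<notin> J \<longrightarrow> ip d (x j) u < ip d (x i) u"
      unfolding support_event_def by blast
    \<comment> \<open>Inserting 1 keeps the minimum defined when there are no gaps to
      compare.\<close>
    define G where "G = insert 1 ((\<lambda>(i, j). ip d (x i) u - ip d (x j) u) ` (J \<times> ({..<n} - J)))"
    have "finite G"
      using assms by (simp add: G_def)
    moreover have "\<forall>g\<in>G. 0 < g"
      using u(3) by (auto simp: G_def)
    ultimately have "0 < Min G"
      by (subst Min_gr_iff) (auto simp: G_def)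
    then obtain m where m: "1 / real (Suc m) < Min G"
      using nat_approx_posE by blast
    have "ip d (x j) u + 1 / real (Suc m) \<le> ip d (x i) u" if "i \<in> J" "j < n" "j \<notin> J" for i j
    proof -
      have "ip d (x i) u - ip d (x j) u \<in> G"
        using that by (force simp: G_def)
      then have "Min G \<le> ip d (x i) u - ip d (x j) u"
        using \<open>finite G\<close> by (rule Min_le[rotated])
      then show ?thesis using m by linarith
    qed
    then have "Q m x u"
      using u(2) unfolding Q_def by blast
    then show "x \<in> (\<Union>m. {x \<in> space (sph {..<n} d). x \<in> {x. \<exists>u\<in>usphere d. Q m x u}})"
      using x u(1) by blast
  next
    fix x assume "x \<in> (\<Union>m. {x \<in> space (sph {..<n} d). x \<in> {x. \<exists>u\<in>usphere d. Q m x u}})"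
    then obtain m u where x: "x \<in> space (sph {..<n} d)" "u \<in> usphere d" "Q m x u"
      by blast
    have "ip d (x j) u < ip d (x i) u" if "i \<in> J" "j < n" "j \<notin> J" for i j
    proof -
      have "ip d (x j) u + 1 / real (Suc m) \<le> ip d (x i) u"
        using x(3) that unfolding Q_def by blast
      moreover have "0 < 1 / real (Suc m)" by simp
      ultimately show ?thesis by linarith
    qed
    then show "x \<in> support_event d n J"
      using x unfolding support_event_def Q_def by blast
  qed
  then show ?thesis
    using meas by (simp only: sets.countable_UN image_subset_iff) auto
qed

text \<open>Exchangeability: a permutation of the indices carrying \<open>{..<d}\<close> onto
  \<open>J\<close> preserves the product measure.\<close>

lemma measure_support_event_eq:
  assumes J: "J \<subseteq> {..<n}" "card J = d"
  shows "measure (sph {..<n} d) (support_event d n J) = measure (sph {..<n} d) (support_event d n {..<d})"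
proof -
  have fin: "finite J" and dn: "d \<le> n"
    using J finite_subset card_mono[of "{..<n}" J] by auto
  obtain f where f: "bij_betw f {..<d} J"
    using finite_same_card_bij[of "{..<d}" J] J fin by auto
  have "card ({..<n} - {..<d}) = card ({..<n} - J)"
    using J fin dn by (simp add: card_Diff_subset)
  then obtain g where g: "bij_betw g ({..<n} - {..<d}) ({..<n} - J)"
    using finite_same_card_bij[of "{..<n} - {..<d}" "{..<n} - J"] by auto
  define p where "p i = (if i < d then f i else g i)" for i
  have pf: "bij_betw p {..<d} J" and pg: "bij_betw p ({..<n} - {..<d}) ({..<n} - J)"
    using bij_betw_cong[of "{..<d}" f p] bij_betw_cong[of "{..<n} - {..<d}" g p] f g by (auto simp: p_def)
  have "bij_betw p ({..<d} \<union> ({..<n} - {..<d})) (J \<union> ({..<n} - J))"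
    using pf pg by (rule bij_betw_combine) auto
  then have p: "bij_betw p {..<n} {..<n}"
    using J dn by (metis Un_Diff_cancel Un_absorb1 ivl_subset lessThan_subset_iff)
  define T where "T x = (\<lambda>i\<in>{..<n}. x (p i))" for x :: "nat \<Rightarrow> nat \<Rightarrow> real"
  have distr: "distr (sph {..<n} d) (sph {..<n} d) T = sph {..<n} d"
    unfolding T_def using distr_PiM_reindex[of "{..<n}" "\<lambda>_. unif_sphere d" p "{..<n}"]
      bij_betw_imp_inj_on[OF p] bij_betwE[OF p] prob_space_unif_sphere by auto
  have T: "T \<in> sph {..<n} d \<rightarrow>\<^sub>M sph {..<n} d"
    unfolding T_def using bij_betwE[OF p]
    by (intro measurable_restrict) (auto simp: measurable_cong_sets[OF refl sets_unif_sphere])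
  have "measure (sph {..<n} d) (support_event d n {..<d})
      = measure (sph {..<n} d) (T -` support_event d n {..<d} \<inter> space (sph {..<n} d))"
    using measure_distr[OF T support_event_sets[of "{..<d}"]] distr by simp
  also have "T -` support_event d n {..<d} \<inter> space (sph {..<n} d) = support_event d n J"
  proof -
    have img: "p ` {..<d} = J" "p ` ({..<n} - {..<d}) = {..<n} - J"
      using pf pg by (auto simp: bij_betw_def)
    have all_J: "(\<forall>i\<in>J. P i) \<longleftrightarrow> (\<forall>i<d. P (p i))" for P
      unfolding img(1)[symmetric] by auto
    have all_co: "(\<forall>j<n. j \<notin> J \<longrightarrow> P j) \<longleftrightarrow> (\<forall>j<n. \<not> j < d \<longrightarrow> P (p j))" for P
    proof -
      have "(\<forall>j<n. j \<notin> J \<longrightarrow> P j) \<longleftrightarrow> (\<forall>j\<in>{..<n} - J. P j)" by auto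
      also have "\<dots> \<longleftrightarrow> (\<forall>j\<in>{..<n} - {..<d}. P (p j))"
        unfolding img(2)[symmetric] by auto
      finally show ?thesis by auto
    qed
    have Ti: "T x i = x (p i)" if "i < n" for x i
      using that by (simp add: T_def)
    have "T x \<in> support_event d n {..<d} \<longleftrightarrow> x \<in> support_event d n J" if "x \<in> space (sph {..<n} d)" for x
    proof -
      have "T x \<in> support_event d n {..<d} \<longleftrightarrow> (\<exists>u\<in>usphere d.
          (\<forall>i<d. \<forall>i'<d. ip d (x (p i)) u = ip d (x (p i')) u) \<and>
          (\<forall>i<d. \<forall>j<n. \<not> j < d \<longrightarrow> ip d (x (p j)) u < ip d (x (p i)) u))"
        using measurable_space[OF T that] dn by (simp add: support_event_def Ti Ball_def)
      also have "\<dots> \<longleftrightarrow> x \<in> support_event d n J"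
        using that by (simp add: support_event_def all_J all_co)
      finally show ?thesis .
    qed
    moreover have "support_event d n J \<subseteq> space (sph {..<n} d)"
      by (auto simp: support_event_def)
    ultimately show ?thesis by blast
  qed
  finally show ?thesis ..
qed

lemma AE_sph_component:
  assumes "finite I" "AE x in unif_sphere d. P x"
  shows "AE x in sph I d. \<forall>i\<in>I. P (x i)"
proof (rule AE_finite_allI[OF assms(1)])
  fix i assume "i \<in> I"
  then show "AE x in sph I d. P (x i)"
    using AE_PiM_component[of I "\<lambda>_. unif_sphere d" i P] prob_space_unif_sphere assms(2) by auto
qed

text \<open>Counting only the index sets that contain 0, rather than all of size \<open>d\<close>,
  saves a factor n / d, which is decisive for bounded \<open>d\<close>.\<close>

lemma measure_support_event_ge:
  assumes d: "2 \<le> d" "d < n"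
  shows "1 \<le> real ((n - 1) choose (d - 1)) * measure (sph {..<n} d) (support_event d n {..<d})"
proof -
  interpret prob_space "sph {..<n} d" by (rule prob_space_sph)
  define JJ where "JJ = {J. J \<subseteq> {..<n} \<and> 0 \<in> J \<and> card J = d}"
  have finJ: "finite J" if "J \<in> JJ" for J
    using that finite_subset by (auto simp: JJ_def)
  have "JJ \<subseteq> insert 0 ` {K. K \<subseteq> {1..<n} \<and> card K = d - 1}"
  proof
    fix J assume J: "J \<in> JJ"
    then have "J - {0} \<in> {K. K \<subseteq> {1..<n} \<and> card K = d - 1}"
      by (auto simp: JJ_def card_Diff_singleton Suc_le_eq)
    moreover have "J = insert 0 (J - {0})"
      using J by (auto simp: JJ_def)
    ultimately show "J \<in> insert 0 ` {K. K \<subseteq> {1..<n} \<and> card K = d - 1}"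
      by (rule rev_image_eqI)
  qed
  then have "card JJ \<le> card {K. K \<subseteq> {1..<n} \<and> card K = d - 1}"
    by (rule surj_card_le[rotated]) simp
  also have "\<dots> = (n - 1) choose (d - 1)"
    by (simp add: n_subsets)
  finally have cardJJ: "card JJ \<le> (n - 1) choose (d - 1)" .
  have finJJ: "finite JJ"
    by (rule finite_subset[of _ "Pow {..<n}"]) (auto simp: JJ_def)
  have sets: "support_event d n J \<in> events" if "J \<in> JJ" for J
    by (rule support_event_sets[OF finJ[OF that]])
  have "AE x in sph {..<n} d. \<forall>i\<in>{..<n}. x i \<in> usphere d"
    using AE_usphere[of d] d by (intro AE_sph_component) auto
  then have "AE x in sph {..<n} d. x \<in> (\<Union>J\<in>JJ. support_event d n J)"
    using AE_general_position[OF d(1)] AE_space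
  proof eventually_elim
    case (elim x)
    have "x i \<in> usphere d" if "i < n" for i
      using elim(1) that by blast
    from exists_supporting_facet[OF elim(2) this]
    obtain J u where J: "J \<subseteq> {..<n}" "0 \<in> J" "card J = d" "u \<in> usphere d"
      "\<And>j. j \<in> J \<Longrightarrow> ip d (x j) u = ip d (x 0) u"
      "\<And>j. j < n \<Longrightarrow> j \<notin> J \<Longrightarrow> ip d (x j) u < ip d (x 0) u"
      using d by (metis gr0I less_le_not_le not_numeral_le_zero)
    have "\<forall>i\<in>J. \<forall>i'\<in>J. ip d (x i) u = ip d (x i') u"
      using J(5) by metis
    moreover have "\<forall>i\<in>J. \<forall>j<n. j \<notin> J \<longrightarrow> ip d (x j) u < ip d (x i) u"
      using J(5,6) by metis
    ultimately have "x \<in> support_event d n J"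
      using elim(3) J(4) unfolding support_event_def by blast
    then show ?case
      using J(1-3) by (auto simp: JJ_def)
  qed
  moreover have "(\<Union>J\<in>JJ. support_event d n J) \<in> events"
    using sets finJJ by (intro sets.finite_UN) auto
  ultimately have "1 = prob (\<Union>J\<in>JJ. support_event d n J)"
    using prob_eq_1[of "\<Union>J\<in>JJ. support_event d n J"] by simp
  also have "\<dots> \<le> (\<Sum>J\<in>JJ. prob (support_event d n J))"
    using sets finJJ by (intro finite_measure_subadditive_finite) auto
  also have "\<dots> = real (card JJ) * prob (support_event d n {..<d})"
    using measure_support_event_eq by (simp add: JJ_def)
  also have "\<dots> \<le> real ((n - 1) choose (d - 1)) * prob (support_event d n {..<d})"
    using cardJJ by (intro mult_right_mono) auto
  finally show ?thesis .
qed

subsection \<open>Low facets\<close>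

text \<open>Contacts of further points are allowed, so a facet of height below \<open>t\<close>
  implies the event directly, without an appeal to general position.\<close>

definition low_event :: "nat \<Rightarrow> nat \<Rightarrow> real \<Rightarrow> (nat \<Rightarrow> nat \<Rightarrow> real) set"
  where "low_event d n t = {x \<in> space (sph {..<n} d). \<exists>u\<in>usphere d.
    (\<forall>i<d. ip d (x i) u = ip d (x 0) u) \<and> (\<forall>j<n. ip d (x j) u \<le> ip d (x 0) u) \<and> ip d (x 0) u < t}"

lemma low_event_sets: "low_event d n t \<in> sets (sph {..<n} d)"
proof -
  define Q where "Q m x u \<longleftrightarrow> (\<forall>i<d. ip d (x i) u = ip d (x 0) u) \<and>
    (\<forall>j<n. ip d (x j) u \<le> ip d (x 0) u) \<and> ip d (x 0) u \<le> t - 1 / real (Suc m)"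
    for m :: nat and x :: "nat \<Rightarrow> nat \<Rightarrow> real" and u :: "nat \<Rightarrow> real"
  have "closed {p :: (nat \<Rightarrow> nat \<Rightarrow> real) \<times> (nat \<Rightarrow> real). Q m (fst p) (snd p)}" for m
    unfolding Q_def
    by (intro closed_Collect_conj closed_Collect_all closed_Collect_imp closed_Collect_eq closed_Collect_le
        continuous_on_ip_pair continuous_on_const) auto
  then have meas: "{x \<in> space (sph {..<n} d). x \<in> {x. \<exists>u\<in>usphere d. Q m x u}} \<in> sets (sph {..<n} d)" for m
    by (intro closed_sets_sph closed_bex_compact[where Q = "Q m"] compact_usphere)
  have less_iff: "a < t \<longleftrightarrow> (\<exists>m. a \<le> t - 1 / real (Suc m))" for a
  proof
    assume "a < t"
    then obtain m where "1 / real (Suc m) < t - a"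
      using nat_approx_posE[of "t - a"] by auto
    then show "\<exists>m. a \<le> t - 1 / real (Suc m)"
      by (intro exI[of _ m]) linarith
  next
    assume "\<exists>m. a \<le> t - 1 / real (Suc m)"
    then obtain m where "a \<le> t - 1 / real (Suc m)" by blast
    moreover have "0 < 1 / real (Suc m)" by simp
    ultimately show "a < t" by linarith
  qed
  have "low_event d n t = (\<Union>m. {x \<in> space (sph {..<n} d). x \<in> {x. \<exists>u\<in>usphere d. Q m x u}})"
    unfolding low_event_def Q_def less_iff by blast
  then show ?thesis
    using meas by (simp only: sets.countable_UN image_subset_iff) auto
qed

lemma emeasure_sph_power:
  assumes "finite I" "A \<in> sets borel"
  shows "emeasure (sph I d) {x \<in> space (sph I d). \<forall>i\<in>I. x i \<in> A} = emeasure (unif_sphere d) A ^ card I"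
proof -
  interpret U: prob_space "unif_sphere d" by (rule prob_space_unif_sphere)
  interpret product_prob_space "\<lambda>_::nat. unif_sphere d" by (rule product_prob_space_sphere)
  have "{x \<in> space (sph I d). \<forall>i\<in>I. x i \<in> A} = Pi\<^sub>E I (\<lambda>_. A)"
    by (auto simp: space_PiM PiE_iff extensional_def)
  then show ?thesis
    using assms by (simp add: emeasure_PiM)
qed

text \<open>Almost surely the first \<open>d\<close> points determine the normal of their hyperplane up to sign;
  hence, given these points, each of the two signs forces all other points into one half space.\<close>

lemma measure_low_event_le:
  assumes d: "2 \<le> d" "d \<le> n" and q: "0 \<le> q" "q \<le> 1"
    and cap: "\<And>u. u \<in> usphere d \<Longrightarrow> q \<le> measure (unif_sphere d) {x. t \<le> ip d x u}"
  shows "measure (sph {..<n} d) (low_event d n t) \<le> 2 * (1 - q) ^ (n - d)"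
proof -
  interpret U: prob_space "unif_sphere d" by (rule prob_space_unif_sphere)
  interpret product_prob_space "\<lambda>_::nat. unif_sphere d" by (rule product_prob_space_sphere)
  interpret PP: prob_space "sph {..<n} d" by (rule prob_space_sph)
  interpret Q: prob_space "sph {..<d} d" by (rule prob_space_sph)
  let ?I = "{..<d}" and ?J = "{d..<n}"
  let ?L = "low_event d n t"
  have IJ: "?I \<union> ?J = {..<n}"
    using d by auto
  have half: "emeasure (sph ?J d) {z \<in> space (sph ?J d). \<forall>j\<in>?J. z j \<in> {x. ip d x u < t}} \<le> ennreal ((1 - q) ^ (n - d))"
    if "u \<in> usphere d" for u
  proof -
    have "U.prob {x. ip d x u < t} = 1 - U.prob {x. t \<le> ip d x u}"
      using U.prob_compl[of "{x. t \<le> ip d x u}"] by (simp add: set_diff_eq not_le)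
    then have "U.prob {x. ip d x u < t} \<le> 1 - q"
      using cap[OF that] by simp
    then have "U.prob {x. ip d x u < t} ^ (n - d) \<le> (1 - q) ^ (n - d)"
      by (intro power_mono) auto
    then show ?thesis
      by (subst emeasure_sph_power) (auto simp: U.emeasure_eq_measure ennreal_power intro!: ennreal_leI)
  qed
  have "emeasure (sph {..<n} d) ?L = (\<integral>\<^sup>+x. indicator ?L x \<partial>sph (?I \<union> ?J) d)"
    unfolding IJ using low_event_sets by simp
  also have "\<dots> = (\<integral>\<^sup>+y. (\<integral>\<^sup>+z. indicator ?L (merge ?I ?J (y, z)) \<partial>sph ?J d) \<partial>sph ?I d)"
  proof (rule product_nn_integral_fold)
    show "indicator ?L \<in> borel_measurable (sph (?I \<union> ?J) d)"
      unfolding IJ using low_event_sets by simp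
  qed auto
  also have "\<dots> \<le> (\<integral>\<^sup>+y. ennreal (2 * (1 - q) ^ (n - d)) \<partial>sph ?I d)"
  proof (rule nn_integral_mono_AE)
    show "AE y in sph ?I d. (\<integral>\<^sup>+z. indicator ?L (merge ?I ?J (y, z)) \<partial>sph ?J d) \<le> ennreal (2 * (1 - q) ^ (n - d))"
      using AE_general_position[OF d(1), of d]
    proof eventually_elim
      case (elim y)
      let ?B = "\<lambda>u. {z \<in> space (sph ?J d). \<forall>j\<in>?J. z j \<in> {x. ip d x u < t}}"
      have B_sets: "?B u \<in> sets (sph ?J d)" for u
      proof -
        have "?B u = Pi\<^sub>E ?J (\<lambda>_. {x. ip d x u < t})"
          by (auto simp: space_PiM PiE_iff extensional_def)
        also have "\<dots> \<in> sets (sph ?J d)"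
          by (intro sets_PiM_I_finite) auto
        finally show ?thesis .
      qed
      have mI: "merge ?I ?J (y, z) i = y i" if "i < d" for i z
        using that by (simp add: merge_def)
      have mJ: "merge ?I ?J (y, z) j = z j" if "d \<le> j" "j < n" for j z
        using that by (simp add: merge_def)
      \<comment> \<open>\<open>u0\<close> depends on the first \<open>d\<close> points
        \<open>y\<close> only, so for fixed \<open>y\<close> both half-space conditions are events
        in \<open>z\<close> to which independence applies.\<close>
      obtain u0 where u0: "u0 \<in> usphere d"
        and sub: "\<And>z. z \<in> space (sph ?J d) \<Longrightarrow> merge ?I ?J (y, z) \<in> ?L \<Longrightarrow> z \<in> ?B u0 \<union> ?B (- u0)"
      proof (cases "\<exists>u\<in>usphere d. \<forall>i<d. ip d (y i) u = ip d (y 0) u")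
        case True
        then obtain u0 where u0: "u0 \<in> usphere d" "\<And>i. i < d \<Longrightarrow> ip d (y i) u0 = ip d (y 0) u0"
          by blast
        show ?thesis
        proof (rule that[OF u0(1)])
          fix z assume z: "z \<in> space (sph ?J d)" "merge ?I ?J (y, z) \<in> ?L"
          then obtain u where u: "u \<in> usphere d"
            "\<forall>i<d. ip d (merge ?I ?J (y, z) i) u = ip d (merge ?I ?J (y, z) 0) u"
            "\<forall>j<n. ip d (merge ?I ?J (y, z) j) u \<le> ip d (merge ?I ?J (y, z) 0) u"
            "ip d (merge ?I ?J (y, z) 0) u < t"
            unfolding low_event_def by blast
          have "ip d (y i) u = ip d (y 0) u" if "i < d" for i
          proof -
            have "0 < d" using d by simp
            then show ?thesis
              using u(2) that mI[of i z] mI[of 0 z] by metis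
          qed
          then have "u = u0 \<or> u = - u0"
            using normal_unique[OF elim order_refl u0(1) u(1) u0(2), of "ip d (y 0) u"] by blast
          moreover have "z \<in> ?B u"
          proof -
            have "ip d (z j) u < t" if "d \<le> j" "j < n" for j
              using u(3)[rule_format, of j] u(4) that by (simp add: mJ)
            then show ?thesis
              using z(1) by auto
          qed
          ultimately show "z \<in> ?B u0 \<union> ?B (- u0)"
            by blast
        qed
      next
        \<comment> \<open>Without a common normal for \<open>y\<close> the event is impossible, and
          any unit vector may stand for \<open>u0\<close>.\<close>
        case False
        obtain w where w: "w \<in> usphere d"
          using exists_orthogonal[of "{}" d] d by auto
        show ?thesis
        proof (rule that[OF w])
          fix z assume "merge ?I ?J (y, z) \<in> ?L"
          then obtain u where u: "u \<in> usphere d"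
            "\<forall>i<d. ip d (merge ?I ?J (y, z) i) u = ip d (merge ?I ?J (y, z) 0) u"
            unfolding low_event_def by blast
          have "ip d (y i) u = ip d (y 0) u" if "i < d" for i
          proof -
            have "0 < d" using d by simp
            then show ?thesis
              using u(2) that mI[of i z] mI[of 0 z] by metis
          qed
          then show "z \<in> ?B w \<union> ?B (- w)"
            using False u(1) by blast
        qed
      qed
      have u0': "- u0 \<in> usphere d"
        using u0 by (simp add: usphere_eq fun_apply)
      have "(\<integral>\<^sup>+z. indicator ?L (merge ?I ?J (y, z)) \<partial>sph ?J d)
          \<le> (\<integral>\<^sup>+z. indicator (?B u0 \<union> ?B (- u0)) z \<partial>sph ?J d)"
        using sub by (intro nn_integral_mono) (simp add: indicator_def)
      also have "\<dots> = emeasure (sph ?J d) (?B u0 \<union> ?B (- u0))"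
        using B_sets by (intro nn_integral_indicator sets.Un)
      also have "\<dots> \<le> emeasure (sph ?J d) (?B u0) + emeasure (sph ?J d) (?B (- u0))"
        using B_sets by (intro emeasure_subadditive)
      also have "\<dots> \<le> ennreal ((1 - q) ^ (n - d)) + ennreal ((1 - q) ^ (n - d))"
        by (intro add_mono half u0 u0')
      also have "\<dots> = ennreal (2 * (1 - q) ^ (n - d))"
        using q by (simp flip: ennreal_plus)
      finally show ?case .
    qed
  qed
  also have "\<dots> = ennreal (2 * (1 - q) ^ (n - d))"
    by (simp add: Q.emeasure_space_1)
  finally show ?thesis
    using q by (simp add: PP.emeasure_eq_measure)
qed

subsection \<open>High facets\<close>

text \<open>The other \<open>n - d\<close> points are ignored and equal heights are relaxed to a
  lower bound: \<open>d\<close> points sharing a high cap is already rare enough. Membership in the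
  sphere is included because it holds only almost surely.\<close>

definition high_event :: "nat \<Rightarrow> real \<Rightarrow> (nat \<Rightarrow> nat \<Rightarrow> real) set"
  where "high_event d t = {x \<in> space (sph {..<d} d). (\<forall>i<d. x i \<in> usphere d) \<and>
    (\<exists>u\<in>usphere d. \<forall>i<d. t \<le> ip d (x i) u)}"

text \<open>Points in a cap of height \<open>t\<close> are within distance \<open>2 \<surd>(1 - t\<^sup>2)\<close> of the first one.\<close>

lemma high_event_near:
  assumes d: "2 \<le> d" and t: "0 < t" "t < 1" and r: "r = 2 * sqrt (1 - t\<^sup>2)" "r \<le> 1"
  shows "\<exists>A\<in>sets (sph {..<d} d). high_event d t \<subseteq> A \<and>
    measure (sph {..<d} d) A \<le> (2 ^ d * r ^ (d - 1)) ^ (d - 1)"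
proof -
  interpret U: prob_space "unif_sphere d" by (rule prob_space_unif_sphere)
  interpret product_prob_space "\<lambda>_::nat. unif_sphere d" by (rule product_prob_space_sphere)
  interpret PP: prob_space "sph {..<d} d" by (rule prob_space_sph)
  have t2: "0 < 1 - t\<^sup>2" "0 < r"
    using t r by (simp_all add: abs_square_less_1)
  \<comment> \<open>A measurable superset that no longer mentions a direction.\<close>
  define A where "A = {x \<in> space (sph {..<d} d). \<forall>i\<in>{1..<d}. nrm d (x i - x 0) \<le> r}"
  have A_sets: "A \<in> sets (sph {..<d} d)"
  proof -
    have "{x \<in> space (sph {..<d} d). nrm d (x i - x 0) \<le> r} \<in> sets (sph {..<d} d)" if "i \<in> {1..<d}" for i
    proof -
      have "(\<lambda>x. nrm d (x i - x 0)) \<in> borel_measurable (sph {..<d} d)"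
        unfolding nrm_def fun_diff_def using that
        by (intro borel_measurable_sqrt_comp measurable_ip borel_measurable_diff measurable_coordinate_sph) auto
      then show ?thesis by measurable
    qed
    then show ?thesis
      unfolding A_def by (intro sets.sets_Collect_finite_All) auto
  qed
  have sub: "high_event d t \<subseteq> A"
  proof
    fix x assume "x \<in> high_event d t"
    then obtain u where x: "x \<in> space (sph {..<d} d)" "\<forall>i<d. x i \<in> usphere d"
      and u: "u \<in> usphere d" "\<forall>i<d. t \<le> ip d (x i) u"
      unfolding high_event_def by blast
    have near: "nrm d (x i - t *\<^sub>R u) \<le> sqrt (1 - t\<^sup>2)" if "i < d" for i
    proof (rule real_le_rsqrt)
      have "(nrm d (x i - t *\<^sub>R u))\<^sup>2 = 1 - 2 * t * ip d (x i) u + t\<^sup>2"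
        unfolding nrm_power2_diff using x(2) u(1) that by (simp add: nrm_usphere del: nrm_power2)
      also have "\<dots> \<le> 1 - 2 * t * t + t\<^sup>2"
        using u(2) that t by (intro add_mono diff_mono mult_left_mono) auto
      finally show "(nrm d (x i - t *\<^sub>R u))\<^sup>2 \<le> 1 - t\<^sup>2"
        by (simp add: power2_eq_square)
    qed
    have "nrm d (x i - x 0) \<le> r" if "i \<in> {1..<d}" for i
    proof -
      have "nrm d (x i - x 0) \<le> nrm d (x i - t *\<^sub>R u) + nrm d ((- 1) *\<^sub>R (x 0 - t *\<^sub>R u))"
        using nrm_triangle[of d "x i - t *\<^sub>R u" "(- 1) *\<^sub>R (x 0 - t *\<^sub>R u)"] by simp
      also have "\<dots> \<le> r"
        unfolding nrm_scaleR r(1) using near[of i] near[of 0] that d by simp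
      finally show ?thesis .
    qed
    then show "x \<in> A"
      using x(1) by (simp add: A_def)
  qed
  have ins: "insert 0 {1..<d} = {..<d}"
    using d by auto
  let ?B = "\<lambda>y. {x. nrm d (x - y) \<le> r}"
  have B_sets: "?B y \<in> sets borel" for y
  proof -
    have "(\<lambda>x. nrm d (x - y)) \<in> borel_measurable borel"
      unfolding nrm_def fun_diff_def
      by (intro borel_measurable_sqrt_comp measurable_ip borel_measurable_diff measurable_coordinate_borel) auto
    then show ?thesis by measurable
  qed
  have "emeasure (sph {..<d} d) A = (\<integral>\<^sup>+x. indicator A x \<partial>sph (insert 0 {1..<d}) d)"
    unfolding ins using A_sets by simp
  \<comment> \<open>Given the first point, the other \<open>d - 1\<close> are independent and each
    lies close to it. In the bound the outer exponent \<open>d - 1\<close> counts these points,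
    while the inner one is the dimension of the sphere.\<close>
  also have "\<dots> = (\<integral>\<^sup>+y. (\<integral>\<^sup>+x. indicator A (x(0 := y)) \<partial>sph {1..<d} d) \<partial>unif_sphere d)"
  proof (rule product_nn_integral_insert_rev)
    show "indicator A \<in> borel_measurable (sph (insert 0 {1..<d}) d)"
      unfolding ins using A_sets by simp
  qed auto
  also have "\<dots> \<le> (\<integral>\<^sup>+y. ennreal ((2 ^ d * r ^ (d - 1)) ^ (d - 1)) \<partial>unif_sphere d)"
  proof (rule nn_integral_mono)
    fix y
    let ?D = "{x \<in> space (sph {1..<d} d). \<forall>i\<in>{1..<d}. x i \<in> ?B y}"
    have D_sets: "?D \<in> sets (sph {1..<d} d)"
    proof -
      have "?D = Pi\<^sub>E {1..<d} (\<lambda>_. ?B y)"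
        by (auto simp: space_PiM PiE_iff extensional_def)
      also have "\<dots> \<in> sets (sph {1..<d} d)"
        using B_sets by (intro sets_PiM_I_finite) auto
      finally show ?thesis .
    qed
    have "(\<integral>\<^sup>+x. indicator A (x(0 := y)) \<partial>sph {1..<d} d) \<le> (\<integral>\<^sup>+x. indicator ?D x \<partial>sph {1..<d} d)"
      by (intro nn_integral_mono) (auto simp: A_def indicator_def)
    also have "\<dots> = emeasure (sph {1..<d} d) ?D"
      using D_sets by (rule nn_integral_indicator)
    also have "\<dots> = emeasure (unif_sphere d) (?B y) ^ (d - 1)"
      using B_sets by (subst emeasure_sph_power) auto
    also have "\<dots> \<le> ennreal ((2 ^ d * r ^ (d - 1)) ^ (d - 1))"
      unfolding U.emeasure_eq_measure ennreal_power[OF measure_nonneg]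
      using near_measure_le[of r d y] t2 r d by (intro ennreal_leI power_mono) auto
    finally show "(\<integral>\<^sup>+x. indicator A (x(0 := y)) \<partial>sph {1..<d} d) \<le> ennreal ((2 ^ d * r ^ (d - 1)) ^ (d - 1))" .
  qed
  also have "\<dots> = ennreal ((2 ^ d * r ^ (d - 1)) ^ (d - 1))"
    using U.emeasure_space_1 by simp
  finally have "measure (sph {..<d} d) A \<le> (2 ^ d * r ^ (d - 1)) ^ (d - 1)"
    using t2 by (simp add: PP.emeasure_eq_measure)
  then show ?thesis
    using A_sets sub by blast
qed

text \<open>Instead of a union bound over an \<open>e\<close>-net of directions \<open>u\<close>: if a relaxed event \<open>G\<close> holds
  for all \<open>v\<close> in a ball of radius \<open>e\<close> inside the unit ball, then its probability for a typical
  \<open>v\<close> of the unit ball is at most \<open>e ^ d\<close> times smaller.\<close>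

lemma averaging_bound:
  assumes P: "prob_space P"
    and G: "{p \<in> space (P \<Otimes>\<^sub>M leb d). G (fst p) (snd p)} \<in> sets (P \<Otimes>\<^sub>M leb d)"
    and e: "0 < e" "e \<le> 1"
    and p: "\<And>v. v \<in> space (leb d) \<Longrightarrow> nrm d v \<le> 1 \<Longrightarrow> measure P {x \<in> space P. G x v} \<le> p"
    and E: "\<And>x. x \<in> E \<Longrightarrow> x \<in> space P \<and>
      (\<exists>u. nrm d u = 1 \<and> (\<forall>v. nrm d (v - (1 - e) *\<^sub>R u) \<le> e \<longrightarrow> G x v))"
  shows "\<exists>A\<in>sets P. E \<subseteq> A \<and> measure P A \<le> p / e ^ d"
proof -
  interpret P: prob_space P by (rule P)
  interpret S: product_sigma_finite "\<lambda>_::nat. lborel :: real measure" by standard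
  interpret L: sigma_finite_measure "leb d" by (rule S.sigma_finite) simp
  interpret PL: pair_sigma_finite P "leb d" by standard
  let ?B = "bll d 0 1"
  define W where "W = {p \<in> space (P \<Otimes>\<^sub>M leb d). G (fst p) (snd p) \<and> snd p \<in> ?B}"
  have W: "W \<in> sets (P \<Otimes>\<^sub>M leb d)"
  proof -
    have "W = {p \<in> space (P \<Otimes>\<^sub>M leb d). G (fst p) (snd p)} \<inter> (snd -` ?B \<inter> space (P \<Otimes>\<^sub>M leb d))"
      by (auto simp: W_def)
    then show ?thesis
      using G measurable_sets[OF measurable_snd bll_sets] by auto
  qed
  define f where "f x = emeasure (leb d) (Pair x -` W)" for x
  have f: "f \<in> borel_measurable P"
    unfolding f_def by (rule L.measurable_emeasure_Pair[OF W])
  have "(\<integral>\<^sup>+x. f x \<partial>P) = emeasure (P \<Otimes>\<^sub>M leb d) W"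
    unfolding f_def by (rule L.emeasure_pair_measure_alt[OF W, symmetric])
  also have "\<dots> = (\<integral>\<^sup>+v. emeasure P ((\<lambda>x. (x, v)) -` W) \<partial>leb d)"
    by (rule PL.emeasure_pair_measure_alt2[OF W])
  also have "\<dots> \<le> (\<integral>\<^sup>+v. ennreal p * indicator ?B v \<partial>leb d)"
  proof (rule nn_integral_mono)
    fix v assume v: "v \<in> space (leb d)"
    show "emeasure P ((\<lambda>x. (x, v)) -` W) \<le> ennreal p * indicator ?B v"
    proof (cases "v \<in> ?B")
      case True
      then have "(\<lambda>x. (x, v)) -` W = {x \<in> space P. G x v}"
        using v by (auto simp: W_def space_pair_measure)
      then show ?thesis
        using p[OF v] True by (simp add: P.emeasure_eq_measure mem_bll_0 ennreal_leI)
    next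
      case False
      then have "(\<lambda>x. (x, v)) -` W = {}"
        by (auto simp: W_def)
      then show ?thesis by simp
    qed
  qed
  also have "\<dots> = ennreal p * ennreal (bvol d)"
    by (simp add: nn_integral_cmult_indicator emeasure_bll_unit)
  finally have int: "(\<integral>\<^sup>+x. f x \<partial>P) \<le> ennreal p * ennreal (bvol d)" .
  \<comment> \<open>Markov's inequality for \<open>f\<close>, the volume of the directions for which
    \<open>G\<close> holds. For \<open>x\<close> in \<open>E\<close> they fill a ball of radius
    \<open>e\<close>; its centre is (1 - e) u instead of u so that the ball stays inside the unit
    ball.\<close>
  define A where "A = {x \<in> space P. ennreal (bvol d * e ^ d) \<le> f x}"
  have A: "A \<in> sets P"
    unfolding A_def using f by measurable
  have "E \<subseteq> A"
  proof
    fix x assume "x \<in> E"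
    then obtain u where x: "x \<in> space P" and u: "nrm d u = 1"
      "\<And>v. nrm d (v - (1 - e) *\<^sub>R u) \<le> e \<Longrightarrow> G x v"
      using E by blast
    have "bll d ((1 - e) *\<^sub>R u) e \<subseteq> Pair x -` W"
    proof
      fix v assume v: "v \<in> bll d ((1 - e) *\<^sub>R u) e"
      then have n: "v \<in> space (leb d)" "nrm d (v - (1 - e) *\<^sub>R u) \<le> e"
        by (simp_all add: bll_def)
      have "nrm d v \<le> nrm d (v - (1 - e) *\<^sub>R u) + nrm d ((1 - e) *\<^sub>R u)"
        using nrm_triangle[of d "v - (1 - e) *\<^sub>R u" "(1 - e) *\<^sub>R u"] by simp
      also have "\<dots> \<le> 1"
        using n(2) u(1) e by simp
      finally show "v \<in> Pair x -` W"
        using u(2)[OF n(2)] n(1) x by (simp add: W_def mem_bll_0 space_pair_measure)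
    qed
    then have "emeasure (leb d) (bll d ((1 - e) *\<^sub>R u) e) \<le> f x"
      unfolding f_def by (rule emeasure_mono) (rule sets_Pair1[OF W])
    then show "x \<in> A"
      using x e by (simp add: A_def emeasure_bll)
  qed
  moreover have "measure P A \<le> p / e ^ d"
  proof -
    have p0: "0 \<le> p"
    proof -
      have "nrm d (\<lambda>i\<in>{..<d}. 0) = 0"
        by (simp add: nrm_def ip_def)
      then show ?thesis
        by (intro order_trans[OF measure_nonneg p[of "\<lambda>i\<in>{..<d}. 0"]]) (auto simp: space_PiM)
    qed
    have "ennreal (bvol d * e ^ d) * emeasure P A = (\<integral>\<^sup>+x. ennreal (bvol d * e ^ d) * indicator A x \<partial>P)"
      using A by (simp add: nn_integral_cmult_indicator)
    also have "\<dots> \<le> (\<integral>\<^sup>+x. f x \<partial>P)"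
      by (intro nn_integral_mono) (auto simp: A_def indicator_def)
    also note int
    finally have "ennreal (bvol d * e ^ d * measure P A) \<le> ennreal (p * bvol d)"
      using e p0 by (simp add: P.emeasure_eq_measure ennreal_mult)
    then have "bvol d * (e ^ d * measure P A) \<le> bvol d * p"
      using p0 by (simp add: mult_ac)
    then have "e ^ d * measure P A \<le> p"
      by (simp only: mult_le_cancel_left_pos[OF bvol_pos(1)])
    then show ?thesis
      using e by (simp add: field_simps)
  qed
  ultimately show ?thesis
    using A by blast
qed

lemma ip_ball_ge:
  assumes "nrm d u = 1" "nrm d (v - (1 - e) *\<^sub>R u) \<le> e"
  shows "(1 - e) * ip d x u - e * nrm d x \<le> ip d x v"
proof -
  have "\<bar>ip d x (v - (1 - e) *\<^sub>R u)\<bar> \<le> nrm d x * nrm d (v - (1 - e) *\<^sub>R u)"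
    by (rule abs_ip_le_nrm)
  also have "\<dots> \<le> nrm d x * e"
    using assms(2) by (intro mult_left_mono) auto
  finally show ?thesis
    by (simp add: algebra_simps)
qed

lemma measurable_ip_pair:
  assumes "i < d"
  shows "(\<lambda>p. ip d (fst p i) (snd p)) \<in> borel_measurable (sph {..<d} d \<Otimes>\<^sub>M leb d)"
proof (rule measurable_ip)
  fix j assume "j < d"
  show "(\<lambda>p. fst p i j) \<in> borel_measurable (sph {..<d} d \<Otimes>\<^sub>M leb d)"
    using measurable_compose[OF measurable_fst measurable_coordinate_sph[of i "{..<d}" j d]] assms by simp
  show "(\<lambda>p. snd p j) \<in> borel_measurable (sph {..<d} d \<Otimes>\<^sub>M leb d)"
    by (rule measurable_compose[OF measurable_snd measurable_component_leb[OF \<open>j < d\<close>]])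
qed

text \<open>Replacing \<open>u\<close> by some \<open>v\<close> within \<open>e\<close> of (1 - e) u
  lowers a height t < 1 to no less than (1 - e) t - e >= t - 2 e. For fixed \<open>v\<close>
  independence raises the cap bound to the power \<open>d\<close>. This suits heights bounded away
  from 0.\<close>

lemma high_event_cap:
  assumes d: "2 \<le> d" and e: "0 < e" "e \<le> 1" and t: "2 * e < t" "t < 1"
  shows "\<exists>A\<in>sets (sph {..<d} d). high_event d t \<subseteq> A \<and>
    measure (sph {..<d} d) A \<le> (sqrt (1 - (t - 2 * e)\<^sup>2) ^ (d - 2)) ^ d / e ^ d"
proof (rule averaging_bound[where G = "\<lambda>x v. \<forall>i\<in>{..<d}. t - 2 * e \<le> ip d (x i) v"])
  interpret U: prob_space "unif_sphere d" by (rule prob_space_unif_sphere)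
  show "prob_space (sph {..<d} d)" by (rule prob_space_sph)
  interpret PP: prob_space "sph {..<d} d" by (rule prob_space_sph)
  show "{p \<in> space (sph {..<d} d \<Otimes>\<^sub>M leb d). \<forall>i\<in>{..<d}. t - 2 * e \<le> ip d (fst p i) (snd p)}
      \<in> sets (sph {..<d} d \<Otimes>\<^sub>M leb d)"
    using measurable_ip_pair by (intro sets.sets_Collect_finite_All) auto
  show "measure (sph {..<d} d) {x \<in> space (sph {..<d} d). \<forall>i\<in>{..<d}. t - 2 * e \<le> ip d (x i) v}
      \<le> (sqrt (1 - (t - 2 * e)\<^sup>2) ^ (d - 2)) ^ d" if "nrm d v \<le> 1" for v
  proof -
    have "emeasure (sph {..<d} d) {x \<in> space (sph {..<d} d). \<forall>i\<in>{..<d}. x i \<in> {x. t - 2 * e \<le> ip d x v}}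
        = emeasure (unif_sphere d) {x. t - 2 * e \<le> ip d x v} ^ d"
      by (subst emeasure_sph_power) auto
    then have "PP.prob {x \<in> space (sph {..<d} d). \<forall>i\<in>{..<d}. t - 2 * e \<le> ip d (x i) v}
        = U.prob {x. t - 2 * e \<le> ip d x v} ^ d"
      by (simp add: PP.emeasure_eq_measure U.emeasure_eq_measure ennreal_power)
    also have "\<dots> \<le> (sqrt (1 - (t - 2 * e)\<^sup>2) ^ (d - 2)) ^ d"
      using e t d that by (intro power_mono cap_measure_le) auto
    finally show ?thesis .
  qed
  fix x assume "x \<in> high_event d t"
  then obtain u where x: "x \<in> space (sph {..<d} d)" "\<forall>i<d. x i \<in> usphere d"
    and u: "u \<in> usphere d" "\<forall>i<d. t \<le> ip d (x i) u"
    unfolding high_event_def by blast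
  have "t - 2 * e \<le> ip d (x i) v" if "nrm d (v - (1 - e) *\<^sub>R u) \<le> e" "i < d" for v i
  proof -
    have "t - e - e * t \<le> (1 - e) * ip d (x i) u - e"
      using mult_left_mono[of t "ip d (x i) u" "1 - e"] u(2) that(2) e by (simp add: algebra_simps)
    also have "\<dots> \<le> ip d (x i) v"
      using ip_ball_ge[OF nrm_usphere[OF u(1)] that(1), of "x i"] x(2) that(2) by (simp add: nrm_usphere)
    finally have "t - e - e * t \<le> ip d (x i) v" .
    moreover have "e * t \<le> e"
      using t e by (simp add: mult_left_le)
    ultimately show ?thesis by linarith
  qed
  then show "x \<in> space (sph {..<d} d) \<and> (\<exists>u. nrm d u = 1 \<and> (\<forall>v. nrm d (v - (1 - e) *\<^sub>R u) \<le> e \<longrightarrow>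
      (\<forall>i\<in>{..<d}. t - 2 * e \<le> ip d (x i) v)))"
    using x(1) nrm_usphere[OF u(1)] by blast
qed (use e in auto)

text \<open>Here the direction \<open>u\<close> of the averaging argument is that of \<open>\<Sum>i. x i\<close>, whose norm is at
  least \<open>d t\<close>, so that the error made by moving \<open>u\<close> is only a multiple of \<open>t\<close>.\<close>

lemma high_event_sum:
  assumes d: "2 < d" and e: "0 < e" "2 * e < 1" and t: "0 < t"
    and k: "0 < k" "k < (real d - 2) / 2"
  defines "K \<equiv> exp 1 / (1 - exp (1 - (real d - 2) / 2 / k))"
  shows "\<exists>A\<in>sets (sph {..<d} d). high_event d t \<subseteq> A \<and>
    measure (sph {..<d} d) A \<le> exp (- k * (real d * ((1 - 2 * e) * t)\<^sup>2)) * K ^ d / e ^ d"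
proof (rule averaging_bound[where G = "\<lambda>x v. real d * ((1 - 2 * e) * t)\<^sup>2 \<le> (\<Sum>i<d. (max 0 (ip d (x i) v))\<^sup>2)"])
  interpret U: prob_space "unif_sphere d" by (rule prob_space_unif_sphere)
  interpret product_prob_space "\<lambda>_::nat. unif_sphere d" by (rule product_prob_space_sphere)
  show "prob_space (sph {..<d} d)" by (rule prob_space_sph)
  interpret PP: prob_space "sph {..<d} d" by (rule prob_space_sph)
  let ?s = "(1 - 2 * e) * t"
  have K: "0 \<le> K"
    using k unfolding K_def by (intro divide_nonneg_nonneg) (auto simp: field_simps)
  show "{p \<in> space (sph {..<d} d \<Otimes>\<^sub>M leb d). real d * ?s\<^sup>2 \<le> (\<Sum>i<d. (max 0 (ip d (fst p i) (snd p)))\<^sup>2)}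
      \<in> sets (sph {..<d} d \<Otimes>\<^sub>M leb d)"
  proof -
    have "(\<lambda>p. \<Sum>i<d. (max 0 (ip d (fst p i) (snd p)))\<^sup>2) \<in> borel_measurable (sph {..<d} d \<Otimes>\<^sub>M leb d)"
      using measurable_ip_pair
      by (intro borel_measurable_sum borel_measurable_power borel_measurable_max borel_measurable_const) auto
    then show ?thesis by measurable
  qed
  show "PP.prob {x \<in> space (sph {..<d} d). real d * ?s\<^sup>2 \<le> (\<Sum>i<d. (max 0 (ip d (x i) v))\<^sup>2)}
      \<le> exp (- k * (real d * ?s\<^sup>2)) * K ^ d" if v: "nrm d v \<le> 1" for v
  proof -
    \<comment> \<open>Squares of positive parts match the Gaussian decay of the cap bound, so
      \<open>k\<close> may come close to (d - 2) / 2 and the exponent k d t^2 keeps its leading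
      constant.\<close>
    let ?Z = "\<lambda>x. (max 0 (ip d x v))\<^sup>2"
    have Z_meas: "(\<lambda>x. \<Sum>i<d. ?Z (x i)) \<in> borel_measurable (sph {..<d} d)"
      using measurable_compose[OF measurable_component_sph sqr_max_measurable]
      by (intro borel_measurable_sum) auto
    have "emeasure (sph {..<d} d) {x \<in> space (sph {..<d} d). real d * ?s\<^sup>2 \<le> (\<Sum>i<d. ?Z (x i))}
        \<le> ennreal (exp (- k * (real d * ?s\<^sup>2))) *
          (\<integral>\<^sup>+x. ennreal (exp (k * (\<Sum>i<d. ?Z (x i)))) * indicator (space (sph {..<d} d)) x \<partial>sph {..<d} d)"
      by (intro Chernoff_ineq_nn_integral_ge k(1) sets.top borel_measurable_times Z_meas borel_measurable_indicator)
    also have "(\<integral>\<^sup>+x. ennreal (exp (k * (\<Sum>i<d. ?Z (x i)))) * indicator (space (sph {..<d} d)) x \<partial>sph {..<d} d)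
        = (\<integral>\<^sup>+x. (\<Prod>i<d. ennreal (exp (k * ?Z (x i)))) \<partial>sph {..<d} d)"
      by (intro nn_integral_cong) (simp add: sum_distrib_left exp_sum prod_ennreal)
    also have "\<dots> = (\<Prod>i<d. \<integral>\<^sup>+x. ennreal (exp (k * ?Z x)) \<partial>unif_sphere d)"
    proof (rule product_nn_integral_prod)
      show "(\<lambda>x. ennreal (exp (k * ?Z x))) \<in> borel_measurable (unif_sphere d)" for i :: nat
        unfolding measurable_cong_sets[OF sets_unif_sphere refl] using sqr_max_measurable[of d v] by measurable
    qed simp
    also have "\<dots> \<le> (\<Prod>i<d. ennreal K)"
      unfolding K_def using exp_cap_moment[OF v d k] by (intro prod_mono_ennreal)
    also have "\<dots> = ennreal (K ^ d)"
      using K by (simp add: ennreal_power)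
    finally have "emeasure (sph {..<d} d) {x \<in> space (sph {..<d} d). real d * ?s\<^sup>2 \<le> (\<Sum>i<d. ?Z (x i))}
        \<le> ennreal (exp (- k * (real d * ?s\<^sup>2)) * K ^ d)"
      using K by (simp add: mult_left_mono ennreal_mult)
    then show ?thesis
      using K by (simp add: PP.emeasure_eq_measure)
  qed
  fix x assume "x \<in> high_event d t"
  then obtain w where x: "x \<in> space (sph {..<d} d)"
    and w: "w \<in> usphere d" "\<forall>i<d. t \<le> ip d (x i) w"
    unfolding high_event_def by blast
  define S where "S = (\<Sum>i<d. x i)"
  have ipS: "ip d S y = (\<Sum>i<d. ip d (x i) y)" for y
    by (simp add: S_def ip_sum_left)
  have "real d * t = (\<Sum>i<d. t)" by simp
  also have "\<dots> \<le> ip d S w"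
    unfolding ipS using w by (intro sum_mono) auto
  also have "\<dots> \<le> nrm d S"
    using ip_le_nrm[of d S w] nrm_usphere[OF w(1)] by simp
  finally have S: "real d * t \<le> nrm d S" .
  moreover have "0 < real d * t" using d t by simp
  ultimately have S0: "nrm d S \<noteq> 0" "0 < nrm d S" by auto
  let ?u = "radial_proj d S"
  have u: "nrm d ?u = 1"
    by (rule nrm_radial_proj[OF S0(1)])
  have Su: "ip d S ?u = nrm d S"
  proof -
    have "ip d S ?u = ip d S S / nrm d S"
      by (subst ip_commute) (rule ip_radial_proj)
    also have "\<dots> = (nrm d S)\<^sup>2 / nrm d S" by simp
    also have "\<dots> = nrm d S"
      by (simp add: power2_eq_square del: nrm_power2)
    finally show ?thesis .
  qed
  have "real d * ?s\<^sup>2 \<le> (\<Sum>i<d. (max 0 (ip d (x i) v))\<^sup>2)" if "nrm d (v - (1 - e) *\<^sub>R ?u) \<le> e" for v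
  proof -
    \<comment> \<open>The loss \<open>e * nrm d S\<close> is proportional to \<open>nrm d S\<close>
      itself, so it only rescales the height; Cauchy-Schwarz then passes from the sum of the
      projections to the sum of their squares.\<close>
    have "real d * ?s = (1 - 2 * e) * (real d * t)" by simp
    also have "\<dots> \<le> (1 - 2 * e) * nrm d S"
      using S e by (intro mult_left_mono) auto
    also have "\<dots> = (1 - e) * ip d S ?u - e * nrm d S"
      unfolding Su by (simp add: algebra_simps)
    also have "\<dots> \<le> ip d S v"
      by (rule ip_ball_ge[OF u that])
    also have "\<dots> \<le> (\<Sum>i<d. max 0 (ip d (x i) v) * 1)"
      unfolding ipS by (intro sum_mono) auto
    finally have "(real d * ?s)\<^sup>2 \<le> (\<Sum>i<d. max 0 (ip d (x i) v) * 1)\<^sup>2"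
      using e t by (intro power_mono) auto
    also have "\<dots> \<le> (\<Sum>i<d. (max 0 (ip d (x i) v))\<^sup>2) * (\<Sum>i<d. 1\<^sup>2)"
      by (rule Cauchy_Schwarz_ineq_sum)
    finally have "real d * (real d * ?s\<^sup>2) \<le> real d * (\<Sum>i<d. (max 0 (ip d (x i) v))\<^sup>2)"
      by (simp add: power2_eq_square mult_ac)
    then show ?thesis
      using d by (subst (asm) mult_le_cancel_left_pos) auto
  qed
  then show "x \<in> space (sph {..<d} d) \<and> (\<exists>u. nrm d u = 1 \<and> (\<forall>v. nrm d (v - (1 - e) *\<^sub>R u) \<le> e \<longrightarrow>
      real d * ?s\<^sup>2 \<le> (\<Sum>i<d. (max 0 (ip d (x i) v))\<^sup>2)))"
    using x u by blast
qed (use e in auto)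

section \<open>Tails of the typical height\<close>

locale sphere_sample =
  fixes M :: "'a measure" and X :: "nat \<Rightarrow> 'a \<Rightarrow> nat \<Rightarrow> real" and n d :: nat
  assumes d: "2 \<le> d" "d < n" and iid: "iid_unif_sphere M X n d"
begin

sublocale prob_space M
  using iid by (simp add: iid_unif_sphere_def)

definition sample :: "nat \<Rightarrow> 'a \<Rightarrow> nat \<Rightarrow> nat \<Rightarrow> real"
  where "sample k \<omega> = (\<lambda>i\<in>{..<k}. X i \<omega>)"

abbreviation facet_event :: "'a set"
  where "facet_event \<equiv> {\<omega> \<in> space M. is_facet d (hull_first X d \<omega>) (hull_first X n \<omega>)}"

lemma random_variable_X: "i < n \<Longrightarrow> random_variable borel (X i)"
  using iid by (auto simp: iid_unif_sphere_def indep_vars_def)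

lemma sample_measurable:
  assumes "k \<le> n"
  shows "sample k \<in> M \<rightarrow>\<^sub>M sph {..<k} d"
  unfolding sample_def using assms random_variable_X
  by (intro measurable_restrict) (auto simp: measurable_cong_sets[OF refl sets_unif_sphere])

lemma distr_sample:
  assumes k: "0 < k" "k \<le> n"
  shows "distr M (sph {..<k} d) (sample k) = sph {..<k} d"
proof -
  have "indep_vars (\<lambda>_. borel) X {..<k}"
    using iid k by (auto simp: iid_unif_sphere_def intro: indep_vars_subset)
  moreover have "{..<k} \<noteq> {}" using k by auto
  ultimately have "distr M (Pi\<^sub>M {..<k} (\<lambda>_. borel)) (\<lambda>x. \<lambda>i\<in>{..<k}. X i x) = Pi\<^sub>M {..<k} (\<lambda>i. distr M borel (X i))"
    using k random_variable_X by (subst (asm) indep_vars_iff_distr_eq_PiM') auto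
  also have "Pi\<^sub>M {..<k} (\<lambda>i. distr M borel (X i)) = sph {..<k} d"
    using iid k by (intro PiM_cong) (auto simp: iid_unif_sphere_def)
  also have "distr M (Pi\<^sub>M {..<k} (\<lambda>_. borel)) (\<lambda>x. \<lambda>i\<in>{..<k}. X i x) = distr M (sph {..<k} d) (sample k)"
    by (intro distr_cong) (auto simp: sets_sph sample_def)
  finally show ?thesis .
qed

lemma prob_sample:
  assumes "0 < k" "k \<le> n" "A \<in> sets (sph {..<k} d)"
  shows "prob (sample k -` A \<inter> space M) = measure (sph {..<k} d) A"
  using measure_distr[OF sample_measurable[OF assms(2)] assms(3)] distr_sample[OF assms(1,2)] by simp

lemma AE_sample:
  assumes "0 < k" "k \<le> n" "AE x in sph {..<k} d. P x"
  shows "AE \<omega> in M. P (sample k \<omega>)"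
proof (rule AE_distrD[OF sample_measurable[OF assms(2)]])
  show "AE x in distr M (sph {..<k} d) (sample k). P x"
    unfolding distr_sample[OF assms(1,2)] by (rule assms(3))
qed

lemma hull_first_sample: "k \<le> n \<Longrightarrow> hull_first X k \<omega> = convex hull (sample n \<omega> ` {..<k})"
  unfolding hull_first_def sample_def by (intro arg_cong[where f = "\<lambda>S. convex hull S"] image_cong) auto

lemma facet_height_imp:
  assumes "facet_height d (hull_first X d \<omega>) (hull_first X n \<omega>) h"
  obtains u where "u \<in> usphere d" "\<And>i. i < d \<Longrightarrow> ip d (X i \<omega>) u = h" "\<And>j. j < n \<Longrightarrow> ip d (X j \<omega>) u \<le> h"
proof -
  obtain u where u: "u \<in> usphere d" "hull_first X n \<omega> \<subseteq> {x \<in> Rspace d. ip d x u \<le> h}"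
    "hull_first X d \<omega> = hull_first X n \<omega> \<inter> {x \<in> Rspace d. ip d x u = h}"
    using assms unfolding facet_height_def by blast
  have inc: "X i \<omega> \<in> hull_first X k \<omega>" if "i < k" for i k
    unfolding hull_first_def using that by (intro hull_inc) auto
  show ?thesis
    by (rule that[OF u(1)]) (use u inc in blast)+
qed

text \<open>Measurability of the facet event is assumed here; it will be extracted from the
  normalisation of the law of the height.\<close>

lemma facet_prob_ge:
  assumes "facet_event \<in> events"
  shows "1 \<le> real ((n - 1) choose (d - 1)) * prob facet_event"
proof -
  have "AE \<omega> in M. general_position d n (sample n \<omega>)"
    using d by (intro AE_sample AE_general_position) auto
  then have "AE \<omega> in M. \<omega> \<in> sample n -` support_event d n {..<d} \<inter> space M \<longrightarrow> \<omega> \<in> facet_event"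
  proof (eventually_elim, intro impI)
    fix \<omega> assume gp: "general_position d n (sample n \<omega>)"
      and \<omega>: "\<omega> \<in> sample n -` support_event d n {..<d} \<inter> space M"
    then obtain u where u:
      "\<forall>i\<in>{..<d}. \<forall>i'\<in>{..<d}. ip d (sample n \<omega> i) u = ip d (sample n \<omega> i') u"
      "\<forall>i\<in>{..<d}. \<forall>j<n. j \<notin> {..<d} \<longrightarrow> ip d (sample n \<omega> j) u < ip d (sample n \<omega> i) u"
      unfolding support_event_def by blast
    have d0: "0 \<in> {..<d}" "0 < d" "d \<le> n" using d by auto
    have "is_facet d (convex hull (sample n \<omega> ` {..<d})) (convex hull (sample n \<omega> ` {..<n}))"
    proof (rule is_facet_if_supported[OF gp d0(2,3)])
      show "ip d (sample n \<omega> j) u = ip d (sample n \<omega> 0) u" if "j < d" for j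
        using u(1) d0(1) that by blast
      show "ip d (sample n \<omega> j) u < ip d (sample n \<omega> 0) u" if "d \<le> j" "j < n" for j
        using u(2) d0(1) that by auto
    qed
    then show "\<omega> \<in> facet_event"
      using \<omega> d hull_first_sample[of d \<omega>] hull_first_sample[of n \<omega>] by simp
  qed
  then have "prob (sample n -` support_event d n {..<d} \<inter> space M) \<le> prob facet_event"
    by (rule finite_measure_mono_AE[OF _ assms])
  also have "prob (sample n -` support_event d n {..<d} \<inter> space M) = measure (sph {..<n} d) (support_event d n {..<d})"
    using d by (intro prob_sample support_event_sets) auto
  finally have "real ((n - 1) choose (d - 1)) * measure (sph {..<n} d) (support_event d n {..<d})
      \<le> real ((n - 1) choose (d - 1)) * prob facet_event"
    by (intro mult_left_mono) auto
  then show ?thesis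
    using measure_support_event_ge[OF d] by linarith
qed

end

locale typical_height_sample = sphere_sample +
  fixes N :: "'b measure" and H :: "'b \<Rightarrow> real"
  assumes typical: "typical_height M X n d N H"
begin

lemma prob_space_N: "prob_space N"
  using typical by (simp add: typical_height_def)

lemma H_measurable: "H \<in> borel_measurable N"
  using typical by (simp add: typical_height_def)

lemma law_H:
  "B \<in> sets borel \<Longrightarrow> \<P>(\<omega> in N. H \<omega> \<in> B) =
    prob {\<omega> \<in> space M. (\<exists>h\<in>B. facet_height d (hull_first X d \<omega>) (hull_first X n \<omega>) h) \<and>
      is_facet d (hull_first X d \<omega>) (hull_first X n \<omega>)} / prob facet_event"
  using typical by (simp add: typical_height_def cond_prob_def)

text \<open>For \<open>B = UNIV\<close> the law must give 1, which rules out a zero denominator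
  since division by zero yields 0. A set outside the sigma-algebra has \<open>measure\<close> 0, so
  measurability follows from the probability being nonzero.\<close>

lemma facet_event: "facet_event \<in> events" "prob facet_event \<noteq> 0"
proof -
  interpret N: prob_space N by (rule prob_space_N)
  have "\<P>(\<omega> in N. H \<omega> \<in> UNIV) = 1"
    using N.prob_space by simp
  then show *: "prob facet_event \<noteq> 0"
    using law_H[of UNIV] by auto
  then show "facet_event \<in> events"
    by (metis measure_notin_sets)
qed

text \<open>\<open>A\<close> contains, up to a null set, all outcomes with height in
  \<open>B\<close>; the division by the facet probability costs the binomial factor.\<close>

lemma law_H_le:
  assumes "B \<in> sets borel" "A \<in> events"
    and "AE \<omega> in M. \<forall>h\<in>B. facet_height d (hull_first X d \<omega>) (hull_first X n \<omega>) h \<longrightarrow> \<omega> \<in> A"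
  shows "\<P>(\<omega> in N. H \<omega> \<in> B) \<le> real ((n - 1) choose (d - 1)) * prob A"
proof -
  have "prob {\<omega> \<in> space M. (\<exists>h\<in>B. facet_height d (hull_first X d \<omega>) (hull_first X n \<omega>) h) \<and>
      is_facet d (hull_first X d \<omega>) (hull_first X n \<omega>)} \<le> prob A"
    using assms(3) by (intro finite_measure_mono_AE assms(2)) auto
  then have "\<P>(\<omega> in N. H \<omega> \<in> B) \<le> prob A / prob facet_event"
    unfolding law_H[OF assms(1)] by (intro divide_right_mono) auto
  also have "\<dots> \<le> real ((n - 1) choose (d - 1)) * prob A"
  proof -
    have pos: "0 < prob facet_event"
      using facet_event(2) by (simp add: less_le)
    have "prob A * 1 \<le> prob A * (real ((n - 1) choose (d - 1)) * prob facet_event)"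
      by (intro mult_left_mono facet_prob_ge facet_event) auto
    then show ?thesis
      using pos by (simp add: field_simps)
  qed
  finally show ?thesis .
qed

lemma high_le:
  assumes "\<exists>A\<in>sets (sph {..<d} d). high_event d t \<subseteq> A \<and> measure (sph {..<d} d) A \<le> p"
  shows "\<P>(\<omega> in N. t < H \<omega>) \<le> real ((n - 1) choose (d - 1)) * p"
proof -
  obtain A where A: "A \<in> sets (sph {..<d} d)" "high_event d t \<subseteq> A" "measure (sph {..<d} d) A \<le> p"
    using assms by blast
  have d': "0 < d" "d \<le> n" using d by auto
  have "AE \<omega> in M. \<forall>i\<in>{..<d}. sample d \<omega> i \<in> usphere d"
    using d AE_usphere[of d] by (intro AE_sample[where P = "\<lambda>x. \<forall>i\<in>{..<d}. x i \<in> usphere d"] AE_sph_component) auto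
  then have "AE \<omega> in M. \<forall>h\<in>{t<..}. facet_height d (hull_first X d \<omega>) (hull_first X n \<omega>) h \<longrightarrow>
      \<omega> \<in> sample d -` A \<inter> space M"
    using AE_space
  proof (eventually_elim, intro ballI impI)
    fix \<omega> h assume \<omega>: "\<forall>i\<in>{..<d}. sample d \<omega> i \<in> usphere d" "\<omega> \<in> space M"
      and h: "h \<in> {t<..}" "facet_height d (hull_first X d \<omega>) (hull_first X n \<omega>) h"
    obtain u where u: "u \<in> usphere d" "\<And>i. i < d \<Longrightarrow> ip d (X i \<omega>) u = h"
      using facet_height_imp[OF h(2)] by metis
    have "sample d \<omega> \<in> space (sph {..<d} d)"
      by (rule measurable_space[OF sample_measurable[OF d'(2)] \<omega>(2)])
    moreover have "\<forall>i<d. t \<le> ip d (sample d \<omega> i) u"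
      using u(2) h(1) by (simp add: sample_def)
    ultimately have "sample d \<omega> \<in> high_event d t"
      using \<omega>(1) u(1) unfolding high_event_def by blast
    then show "\<omega> \<in> sample d -` A \<inter> space M"
      using A(2) \<omega>(2) by blast
  qed
  moreover have "sample d -` A \<inter> space M \<in> events"
    by (rule measurable_sets[OF sample_measurable[OF d'(2)] A(1)])
  ultimately have "\<P>(\<omega> in N. H \<omega> \<in> {t<..}) \<le> real ((n - 1) choose (d - 1)) * prob (sample d -` A \<inter> space M)"
    by (intro law_H_le) auto
  also have "\<dots> \<le> real ((n - 1) choose (d - 1)) * p"
    using prob_sample[OF d' A(1)] A(3) by (intro mult_left_mono) auto
  finally show ?thesis by simp
qed

lemma low_le:
  assumes q: "0 \<le> q" "q \<le> 1" and "\<And>u. u \<in> usphere d \<Longrightarrow> q \<le> measure (unif_sphere d) {x. t \<le> ip d x u}"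
  shows "\<P>(\<omega> in N. H \<omega> < t) \<le> real ((n - 1) choose (d - 1)) * (2 * (1 - q) ^ (n - d))"
proof -
  have n: "0 < n" "n \<le> n" and dn: "d \<le> n" "0 < d" using d by auto
  have "AE \<omega> in M. \<forall>h\<in>{..<t}. facet_height d (hull_first X d \<omega>) (hull_first X n \<omega>) h \<longrightarrow>
      \<omega> \<in> sample n -` low_event d n t \<inter> space M"
    using AE_space
  proof (eventually_elim, intro ballI impI)
    fix \<omega> h assume \<omega>: "\<omega> \<in> space M"
      and h: "h \<in> {..<t}" "facet_height d (hull_first X d \<omega>) (hull_first X n \<omega>) h"
    obtain u where u: "u \<in> usphere d" "\<And>i. i < d \<Longrightarrow> ip d (X i \<omega>) u = h" "\<And>j. j < n \<Longrightarrow> ip d (X j \<omega>) u \<le> h"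
      using facet_height_imp[OF h(2)] by metis
    have X: "sample n \<omega> i = X i \<omega>" if "i < n" for i
      using that by (simp add: sample_def)
    have x0: "ip d (sample n \<omega> 0) u = h"
      using u(2)[OF dn(2)] X[OF n(1)] by simp
    have "sample n \<omega> \<in> space (sph {..<n} d)"
      by (rule measurable_space[OF sample_measurable[OF n(2)] \<omega>])
    moreover have "\<forall>i<d. ip d (sample n \<omega> i) u = ip d (sample n \<omega> 0) u"
      unfolding x0 using u(2) X dn by simp
    moreover have "\<forall>j<n. ip d (sample n \<omega> j) u \<le> ip d (sample n \<omega> 0) u"
      unfolding x0 using u(3) X by simp
    moreover have "ip d (sample n \<omega> 0) u < t"
      unfolding x0 using h(1) by simp
    ultimately have "sample n \<omega> \<in> low_event d n t"
      using u(1) unfolding low_event_def by blast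
    then show "\<omega> \<in> sample n -` low_event d n t \<inter> space M"
      using \<omega> by blast
  qed
  moreover have "sample n -` low_event d n t \<inter> space M \<in> events"
    by (rule measurable_sets[OF sample_measurable[OF n(2)] low_event_sets])
  ultimately have "\<P>(\<omega> in N. H \<omega> \<in> {..<t})
      \<le> real ((n - 1) choose (d - 1)) * prob (sample n -` low_event d n t \<inter> space M)"
    by (intro law_H_le) auto
  also have "\<dots> \<le> real ((n - 1) choose (d - 1)) * (2 * (1 - q) ^ (n - d))"
    using prob_sample[OF n low_event_sets] measure_low_event_le[OF d(1) dn(1) assms]
    by (intro mult_left_mono) auto
  finally show ?thesis by simp
qed

end

section \<open>Asymptotics\<close>

lemma binomial_le_exp:
  assumes "1 \<le> d" "d \<le> n"
  shows "real ((n - 1) choose (d - 1)) \<le> exp (real d * (1 + ln (real n / real d)))"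
proof -
  have "(n - 1) choose (d - 1) \<le> n choose d"
    using assms choose_reduce_nat[of n d] by simp
  then have "real ((n - 1) choose (d - 1)) \<le> real (n choose d)" by simp
  also have "\<dots> \<le> real n ^ d / fact d"
  proof -
    have "real ((n choose d) * fact d) \<le> real (n ^ d)"
      by (rule of_nat_mono) (rule binomial_fact_pow)
    then show ?thesis
      by (simp add: field_simps)
  qed
  also have "\<dots> \<le> real n ^ d * (exp (real d) / real d ^ d)"
  proof -
    \<comment> \<open>The single term of index \<open>d\<close> in the exponential series gives d^d
      / d! <= exp d.\<close>
    have "(\<Sum>k\<in>{d}. real d ^ k /\<^sub>R fact k) \<le> exp (real d)"
      unfolding exp_def using summable_exp_generic[of "real d"] by (intro sum_le_suminf) auto
    then have "1 / fact d \<le> exp (real d) / real d ^ d"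
      using assms by (simp add: field_simps)
    then have "real n ^ d * (1 / fact d) \<le> real n ^ d * (exp (real d) / real d ^ d)"
      by (intro mult_left_mono) auto
    then show ?thesis by simp
  qed
  also have "\<dots> = exp (real d) * (real n / real d) ^ d"
    by (simp add: power_divide)
  also have "(real n / real d) ^ d = exp (real d * ln (real n / real d))"
    using assms by (simp add: exp_of_nat_mult)
  finally show ?thesis
    by (simp add: distrib_left exp_add)
qed

lemma power_diff_le:
  fixes a b :: real
  assumes "0 \<le> b" "b \<le> a"
  shows "a ^ Suc k - b ^ Suc k \<le> real (Suc k) * a ^ k * (a - b)"
proof (induction k)
  case (Suc k)
  have "a ^ Suc (Suc k) - b ^ Suc (Suc k) = a * (a ^ Suc k - b ^ Suc k) + b ^ Suc k * (a - b)"
    by (simp add: algebra_simps)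
  also have "\<dots> \<le> a * (real (Suc k) * a ^ k * (a - b)) + a ^ Suc k * (a - b)"
    using assms Suc.IH by (intro add_mono mult_left_mono mult_right_mono power_mono) auto
  finally show ?case
    by (simp add: algebra_simps)
qed simp

lemma exp_divide_le_shift: "exp a / c \<le> m * exp b \<Longrightarrow> exp (a - b) / c \<le> (m :: real)"
  using mult_right_mono[of "exp a / c" "m * exp b" "exp (- b)"] by (simp add: exp_diff exp_minus field_simps)

text \<open>Two choices of the inner radius in \<open>cap_measure_lower\<close>. With 0 the exponent
  is \<open>d\<close> and the error only exp (2 t sqrt d), which is small when t is small. With
  \<open>t\<^sup>2\<close> the shell has thickness of order \<open>s\<close> and one factor
  \<open>s\<close> cancels, so the exponent becomes \<open>d - 1\<close>, as needed for bounded
  \<open>d\<close>.\<close>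

lemma cap_lower_exp:
  assumes u: "nrm d u = 1" and t: "0 < t" "t < 1" and d: "2 \<le> d"
  shows "exp (real d / 2 * ln (1 - t\<^sup>2) - 2 * t * sqrt (real d)) / 4 \<le> measure (unif_sphere d) {x. t \<le> ip d x u}"
    and "exp ((real d - 1) / 2 * ln (1 - t\<^sup>2) - 2 * sqrt (real d)) / (12 * real d)
      \<le> measure (unif_sphere d) {x. t \<le> ip d x u}"
proof -
  let ?m = "measure (unif_sphere d) {x. t \<le> ip d x u}"
  define s where "s = sqrt (1 - t\<^sup>2)"
  define R where "R = sqrt (1 + 4 * t * s / sqrt (real d))"
  have t2: "0 < 1 - t\<^sup>2" "t\<^sup>2 < t"
    using t by (simp add: abs_square_less_1, simp add: power2_eq_square)
  have s: "0 < s" "s \<le> 1" "s\<^sup>2 = 1 - t\<^sup>2" "s = exp (ln (1 - t\<^sup>2) / 2)"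
    using t2 by (auto simp: s_def ln_sqrt[symmetric])
  have R2: "R\<^sup>2 = 1 + 4 * t * s / sqrt (real d)" "1 \<le> R"
    unfolding R_def using t s(1) by auto
  have sd: "1 \<le> sqrt (real d)" "sqrt (real d) * sqrt (real d) = real d"
    using d by auto
  have Rexp: "R \<le> exp (2 * t * s / sqrt (real d))"
  proof (rule power2_le_imp_le)
    have "R\<^sup>2 \<le> exp (4 * t * s / sqrt (real d))"
      unfolding R2 by (rule exp_ge_add_one_self)
    also have "\<dots> = (exp (2 * t * s / sqrt (real d)))\<^sup>2"
      by (simp add: power2_eq_square flip: exp_add)
    finally show "R\<^sup>2 \<le> (exp (2 * t * s / sqrt (real d)))\<^sup>2" .
  qed simp
  have Rpow: "R ^ k \<le> exp (2 * t * sqrt (real d))" if "k \<le> d" for k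
  proof -
    have "R ^ k \<le> R ^ d"
      using R2 that by (intro power_increasing) auto
    also have "\<dots> \<le> exp (2 * t * s / sqrt (real d)) ^ d"
      using Rexp R2 by (intro power_mono) auto
    also have "\<dots> = exp (2 * t * s * (real d / sqrt (real d)))"
      by (simp add: mult_ac flip: exp_of_nat_mult)
    also have "\<dots> \<le> exp (2 * t * 1 * sqrt (real d))"
      unfolding exp_le_cancel_iff real_div_sqrt[OF of_nat_0_le_iff]
      using s(1,2) t by (intro mult_right_mono mult_left_mono) auto
    finally show ?thesis by simp
  qed
  have spow: "s ^ k = exp (real k / 2 * ln (1 - t\<^sup>2))" for k
    unfolding s(4) by (simp flip: exp_of_nat_mult)
  have "s ^ d / 4 \<le> ?m * (R ^ d - 0 ^ d)"
    using cap_measure_lower[OF u t, of 0] t d by (simp add: s_def R_def)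
  also have "\<dots> \<le> ?m * exp (2 * t * sqrt (real d))"
    using Rpow[of d] d by (intro mult_left_mono) (auto simp: power_0_left)
  finally show "exp (real d / 2 * ln (1 - t\<^sup>2) - 2 * t * sqrt (real d)) / 4 \<le> ?m"
    unfolding spow by (rule exp_divide_le_shift)
  obtain k where k: "d = Suc k" using d by (cases d) auto
  \<comment> \<open>Here R - 1 <= 2 s and 1 - t^2 = s^2 <= s, so R - t^2 <= 3 s; together with the
    quarter this is the origin of the constant 12.\<close>
  have "s ^ d / 4 \<le> ?m * (R ^ d - (t\<^sup>2) ^ d)"
    using cap_measure_lower[OF u t, of "t\<^sup>2"] t2 d by (simp add: s_def R_def)
  also have "\<dots> \<le> ?m * (real d * exp (2 * sqrt (real d)) * (3 * s))"
  proof (intro mult_left_mono)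
    have "R - 1 \<le> 2 * t * s / sqrt (real d)"
    proof -
      have "R \<le> 1 + 2 * t * s / sqrt (real d)"
      proof (rule power2_le_imp_le)
        have "(1 + 2 * t * s / sqrt (real d))\<^sup>2 = R\<^sup>2 + (2 * t * s / sqrt (real d))\<^sup>2"
          unfolding R2 by (simp add: power2_eq_square algebra_simps)
        then show "R\<^sup>2 \<le> (1 + 2 * t * s / sqrt (real d))\<^sup>2"
          by simp
      qed (use t s(1) in auto)
      then show ?thesis by simp
    qed
    also have "\<dots> \<le> 2 * s"
    proof -
      have "t / sqrt (real d) \<le> 1"
        using t sd(1) by (subst divide_le_eq_1_pos) linarith+
      then have "2 * s * (t / sqrt (real d)) \<le> 2 * s * 1"
        using s by (intro mult_left_mono) auto
      then show ?thesis by (simp add: mult_ac)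
    qed
    finally have "R - t\<^sup>2 \<le> 3 * s"
      using s(1-3) power_decreasing[of 1 2 s] by simp
    moreover have "R ^ k \<le> exp (2 * sqrt (real d))"
    proof -
      have "R ^ k \<le> exp (2 * t * sqrt (real d))" using Rpow[of k] k by simp
      also have "\<dots> \<le> exp (2 * 1 * sqrt (real d))"
        using t by (subst exp_le_cancel_iff, intro mult_right_mono mult_left_mono) auto
      finally show ?thesis by simp
    qed
    ultimately have "real d * R ^ k * (R - t\<^sup>2) \<le> real d * exp (2 * sqrt (real d)) * (3 * s)"
      using t2 t R2 by (intro mult_mono mult_left_mono) auto
    moreover have "R ^ d - (t\<^sup>2) ^ d \<le> real d * R ^ k * (R - t\<^sup>2)"
      unfolding k using t2 t R2 by (intro power_diff_le) auto
    ultimately show "R ^ d - (t\<^sup>2) ^ d \<le> real d * exp (2 * sqrt (real d)) * (3 * s)"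
      by linarith
  qed simp
  finally have "s * (s ^ k / 4) \<le> s * (?m * (real d * exp (2 * sqrt (real d)) * 3))"
    by (simp add: k mult_ac)
  then have "s ^ k / 4 \<le> ?m * (real d * exp (2 * sqrt (real d)) * 3)"
    using s(1) by (subst (asm) mult_le_cancel_left_pos)
  then have "s ^ k / (12 * real d) \<le> ?m * exp (2 * sqrt (real d))"
    using d by (simp add: field_simps)
  moreover have "real k = real d - 1"
    by (simp add: k)
  ultimately show "exp ((real d - 1) / 2 * ln (1 - t\<^sup>2) - 2 * sqrt (real d)) / (12 * real d) \<le> ?m"
    unfolding spow by (intro exp_divide_le_shift) simp
qed

context typical_height_sample
begin

lemma high_le_exp:
  assumes "\<exists>A\<in>sets (sph {..<d} d). high_event d t \<subseteq> A \<and> measure (sph {..<d} d) A \<le> exp p"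
  shows "\<P>(\<omega> in N. t < H \<omega>) \<le> exp (real d * (1 + ln (real n / real d)) + p)"
proof -
  have "\<P>(\<omega> in N. t < H \<omega>) \<le> real ((n - 1) choose (d - 1)) * exp p"
    by (rule high_le[OF assms])
  also have "\<dots> \<le> exp (real d * (1 + ln (real n / real d))) * exp p"
    using d by (intro mult_right_mono binomial_le_exp) auto
  finally show ?thesis by (simp add: exp_add)
qed

lemma low_le_exp:
  assumes q: "\<And>u. u \<in> usphere d \<Longrightarrow> q \<le> measure (unif_sphere d) {x. t \<le> ip d x u}"
    and "0 \<le> q" and dn: "2 * d \<le> n"
  shows "\<P>(\<omega> in N. H \<omega> < t) \<le> 2 * exp (real d * (1 + ln (real n / real d)) - q * real n / 2)"
proof -
  interpret U: prob_space "unif_sphere d" by (rule prob_space_unif_sphere)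
  obtain w where "w \<in> usphere d"
    using exists_orthogonal[of "{}" d] d by auto
  then have q1: "q \<le> 1"
    using q[of w] U.prob_le_1[of "{x. t \<le> ip d x w}"] by linarith
  have "(1 - q) ^ (n - d) \<le> exp (- q) ^ (n - d)"
    using q1 exp_ge_add_one_self[of "- q"] by (intro power_mono) auto
  also have "\<dots> = exp (- (real (n - d) * q))"
    by (simp flip: exp_of_nat_mult)
  also have "\<dots> \<le> exp (- (q * real n / 2))"
  proof -
    have "real n / 2 \<le> real (n - d)"
      using dn d by (simp add: of_nat_diff)
    from mult_right_mono[OF this \<open>0 \<le> q\<close>] show ?thesis
      by (simp add: mult_ac)
  qed
  finally have *: "(1 - q) ^ (n - d) \<le> exp (- (q * real n / 2))" .
  have "\<P>(\<omega> in N. H \<omega> < t) \<le> real ((n - 1) choose (d - 1)) * (2 * (1 - q) ^ (n - d))"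
    by (rule low_le[OF \<open>0 \<le> q\<close> q1 q])
  also have "\<dots> \<le> exp (real d * (1 + ln (real n / real d))) * (2 * exp (- (q * real n / 2)))"
    using d * q1 by (intro mult_mono binomial_le_exp mult_left_mono) auto
  also have "\<dots> = 2 * exp (real d * (1 + ln (real n / real d)) - q * real n / 2)"
    unfolding diff_conv_add_uminus exp_add by (simp only: mult_ac)
  finally show ?thesis .
qed

end

lemma tendsto_0_exp_bound:
  fixes P :: "nat \<Rightarrow> real"
  assumes "\<And>n. 0 \<le> P n" "\<forall>\<^sub>F n in sequentially. P n \<le> c * exp (f n)" "filterlim f at_bot sequentially"
  shows "P \<longlonglongrightarrow> 0"
proof (rule tendsto_sandwich[OF _ assms(2) tendsto_const])
  have "(\<lambda>n. exp (f n)) \<longlonglongrightarrow> 0"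
    using exp_at_bot assms(3) by (rule filterlim_compose)
  from tendsto_mult_right_zero[OF this] show "(\<lambda>n. c * exp (f n)) \<longlonglongrightarrow> 0" .
qed (use assms(1) in auto)

lemma conv_in_prob_if_tails:
  fixes H :: "nat \<Rightarrow> 'b \<Rightarrow> real" and g :: "nat \<Rightarrow> real \<Rightarrow> real"
  assumes N: "\<forall>\<^sub>F n in sequentially. prob_space (N n) \<and> H n \<in> borel_measurable (N n)"
    and tails: "\<And>e. 0 < e \<Longrightarrow> \<exists>s t. (\<lambda>n. \<P>(\<omega> in N n. H n \<omega> < s n)) \<longlonglongrightarrow> 0 \<and>
      (\<lambda>n. \<P>(\<omega> in N n. t n < H n \<omega>)) \<longlonglongrightarrow> 0 \<and>
      (\<forall>\<^sub>F n in sequentially. \<forall>h. s n \<le> h \<longrightarrow> h \<le> t n \<longrightarrow> \<bar>g n h - c\<bar> \<le> e)"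
  shows "conv_in_prob N (\<lambda>n \<omega>. g n (H n \<omega>)) c"
  unfolding conv_in_prob_def
proof (intro allI impI)
  fix e :: real assume "0 < e"
  from tails[OF this] obtain s t where st: "(\<lambda>n. \<P>(\<omega> in N n. H n \<omega> < s n)) \<longlonglongrightarrow> 0"
    "(\<lambda>n. \<P>(\<omega> in N n. t n < H n \<omega>)) \<longlonglongrightarrow> 0"
    "\<forall>\<^sub>F n in sequentially. \<forall>h. s n \<le> h \<longrightarrow> h \<le> t n \<longrightarrow> \<bar>g n h - c\<bar> \<le> e"
    by blast
  have "\<forall>\<^sub>F n in sequentially. \<P>(\<omega> in N n. e < \<bar>g n (H n \<omega>) - c\<bar>)
      \<le> \<P>(\<omega> in N n. H n \<omega> < s n) + \<P>(\<omega> in N n. t n < H n \<omega>)"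
    using N st(3)
  proof eventually_elim
    case (elim n)
    interpret prob_space "N n" using elim by simp
    have [measurable]: "H n \<in> borel_measurable (N n)" using elim by simp
    have "prob {\<omega> \<in> space (N n). e < \<bar>g n (H n \<omega>) - c\<bar>}
        \<le> prob ({\<omega> \<in> space (N n). H n \<omega> < s n} \<union> {\<omega> \<in> space (N n). t n < H n \<omega>})"
    proof (rule finite_measure_mono)
      show "{\<omega> \<in> space (N n). e < \<bar>g n (H n \<omega>) - c\<bar>}
          \<subseteq> {\<omega> \<in> space (N n). H n \<omega> < s n} \<union> {\<omega> \<in> space (N n). t n < H n \<omega>}"
      proof
        fix \<omega> assume \<omega>: "\<omega> \<in> {\<omega> \<in> space (N n). e < \<bar>g n (H n \<omega>) - c\<bar>}"
        then have "\<not> (s n \<le> H n \<omega> \<and> H n \<omega> \<le> t n)"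
          using elim(2) by fastforce
        then show "\<omega> \<in> {\<omega> \<in> space (N n). H n \<omega> < s n} \<union> {\<omega> \<in> space (N n). t n < H n \<omega>}"
          using \<omega> by auto
      qed
    qed measurable
    also have "\<dots> \<le> \<P>(\<omega> in N n. H n \<omega> < s n) + \<P>(\<omega> in N n. t n < H n \<omega>)"
      by (intro measure_Un_le) measurable
    finally show ?case .
  qed
  moreover have "(\<lambda>n. \<P>(\<omega> in N n. H n \<omega> < s n) + \<P>(\<omega> in N n. t n < H n \<omega>)) \<longlonglongrightarrow> 0"
    using tendsto_add[OF st(1,2)] by simp
  ultimately show "(\<lambda>n. \<P>(\<omega> in N n. e < \<bar>g n (H n \<omega>) - c\<bar>)) \<longlonglongrightarrow> 0"
    by (rule tendsto_sandwich[OF always_eventually[OF allI[OF measure_nonneg]] _ tendsto_const])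
qed

locale height_asymptotics =
  fixes d :: "nat \<Rightarrow> nat"
    and M :: "nat \<Rightarrow> 'a measure" and X :: "nat \<Rightarrow> nat \<Rightarrow> 'a \<Rightarrow> nat \<Rightarrow> real"
    and N :: "nat \<Rightarrow> 'b measure" and H :: "nat \<Rightarrow> 'b \<Rightarrow> real"
  assumes d_range: "\<forall>\<^sub>F n in sequentially. d n \<in> {2..n - 1}"
    and sample: "\<And>n. d n \<in> {2..n - 1} \<Longrightarrow> iid_unif_sphere (M n) (X n) n (d n)"
    and H_typ: "\<And>n. d n \<in> {2..n - 1} \<Longrightarrow> typical_height (M n) (X n) n (d n) (N n) (H n)"
    and d_less_n: "(\<lambda>n. real (d n) / real n) \<longlonglongrightarrow> 0"
begin

abbreviation dr :: "nat \<Rightarrow> real"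
  where "dr n \<equiv> real (d n)"

definition L :: "nat \<Rightarrow> real"
  where "L n = ln (real n / dr n)"

lemma ev_typical: "\<forall>\<^sub>F n in sequentially. typical_height_sample (M n) (X n) n (d n) (N n) (H n)"
  using d_range
proof eventually_elim
  case (elim n)
  then show ?case
    using sample[of n] H_typ[of n]
    by (intro typical_height_sample.intro sphere_sample.intro typical_height_sample_axioms.intro) auto
qed

lemma ev_N: "\<forall>\<^sub>F n in sequentially. prob_space (N n) \<and> H n \<in> borel_measurable (N n)"
  using ev_typical
  by eventually_elim (auto intro: typical_height_sample.prob_space_N typical_height_sample.H_measurable)

lemma ev_d: "\<forall>\<^sub>F n in sequentially. 2 \<le> d n \<and> 2 * d n \<le> n \<and> d n < n"
proof -
  have "\<forall>\<^sub>F n in sequentially. dr n / real n < 1 / 2"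
    using d_less_n by (rule order_tendstoD(2)) simp
  then show ?thesis
    using d_range eventually_gt_at_top[of "0::nat"]
  proof eventually_elim
    case (elim n)
    then have "2 * dr n \<le> real n" by (simp add: field_simps)
    then have "real (2 * d n) \<le> real n" by simp
    then have "2 * d n \<le> n" by (simp only: of_nat_le_iff)
    then show ?case using elim by auto
  qed
qed

lemma L_at_top: "filterlim L at_top sequentially"
proof -
  have "filterlim (\<lambda>n. inverse (dr n / real n)) at_top sequentially"
    using ev_d by (intro filterlim_inverse_at_top d_less_n) (auto elim!: eventually_mono)
  then show ?thesis
    unfolding L_def using filterlim_compose[OF ln_at_top] by simp
qed

lemma ev_L: "\<forall>\<^sub>F n in sequentially. 0 \<le> L n \<and> L n \<le> ln (real n) \<and> real n = dr n * exp (L n)"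
  using ev_d
proof eventually_elim
  case (elim n)
  then have "1 \<le> dr n" "dr n \<le> real n" by auto
  then show ?case
    by (auto simp: L_def ln_div exp_diff)
qed

lemma ln_n_at_top: "filterlim (\<lambda>n. ln (real n)) at_top sequentially"
  by (rule filterlim_compose[OF ln_at_top filterlim_real_sequentially])

lemma tail_nonneg: "0 \<le> \<P>(\<omega> in N n. P n \<omega>)"
  by simp

lemma low_tendsto_0:
  assumes q: "\<forall>\<^sub>F n in sequentially. 0 \<le> q n \<and>
      (\<forall>u. nrm (d n) u = 1 \<longrightarrow> q n \<le> measure (unif_sphere (d n)) {x. s n \<le> ip (d n) x u})"
    and f: "\<forall>\<^sub>F n in sequentially. dr n * (1 + L n) - q n * real n / 2 \<le> f n" "filterlim f at_bot sequentially"
  shows "(\<lambda>n. \<P>(\<omega> in N n. H n \<omega> < s n)) \<longlonglongrightarrow> 0"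
proof (rule tendsto_0_exp_bound[OF tail_nonneg _ f(2), where c = 2])
  show "\<forall>\<^sub>F n in sequentially. \<P>(\<omega> in N n. H n \<omega> < s n) \<le> 2 * exp (f n)"
    using ev_typical ev_d q f(1)
  proof eventually_elim
    case (elim n)
    interpret typical_height_sample "M n" "X n" n "d n" "N n" "H n" by (rule elim(1))
    have "\<P>(\<omega> in N n. H n \<omega> < s n) \<le> 2 * exp (dr n * (1 + ln (real n / dr n)) - q n * real n / 2)"
      using elim(2,3) nrm_usphere by (intro low_le_exp) auto
    also have "\<dots> \<le> 2 * exp (f n)"
      using elim(4) by (simp add: L_def)
    finally show ?case .
  qed
qed

lemma high_tendsto_0:
  assumes p: "\<forall>\<^sub>F n in sequentially. \<exists>A\<in>sets (sph {..<d n} (d n)). high_event (d n) (t n) \<subseteq> A \<and>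
      measure (sph {..<d n} (d n)) A \<le> exp (p n)"
    and f: "\<forall>\<^sub>F n in sequentially. dr n * (1 + L n) + p n \<le> f n" "filterlim f at_bot sequentially"
  shows "(\<lambda>n. \<P>(\<omega> in N n. t n < H n \<omega>)) \<longlonglongrightarrow> 0"
proof (rule tendsto_0_exp_bound[OF tail_nonneg _ f(2), where c = 1])
  show "\<forall>\<^sub>F n in sequentially. \<P>(\<omega> in N n. t n < H n \<omega>) \<le> 1 * exp (f n)"
    using ev_typical p f(1)
  proof eventually_elim
    case (elim n)
    interpret typical_height_sample "M n" "X n" n "d n" "N n" "H n" by (rule elim(1))
    have "\<P>(\<omega> in N n. t n < H n \<omega>) \<le> exp (dr n * (1 + ln (real n / dr n)) + p n)"
      by (rule high_le_exp[OF elim(2)])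
    also have "\<dots> \<le> 1 * exp (f n)"
      using elim(3) by (simp add: L_def)
    finally show ?case .
  qed
qed

subsection \<open>Dimension much larger than the logarithm\<close>

text \<open>The critical height scaled by \<open>c\<close>: a cap of this height has measure about
  exp (- c^2 L) = (d/n)^(c^2), so c = 1 separates the two tails.\<close>

definition T :: "real \<Rightarrow> nat \<Rightarrow> real"
  where "T c n = c * sqrt (2 * L n / dr n)"

lemma T_power2: "\<forall>\<^sub>F n in sequentially. (T c n)\<^sup>2 = c\<^sup>2 * (2 * L n / dr n)"
  using ev_L by eventually_elim (simp add: T_def power_mult_distrib)

context
  assumes small: "(\<lambda>n. ln (real n) / dr n) \<longlonglongrightarrow> 0"
begin

lemma d_at_top_1: "filterlim dr at_top sequentially"
proof -
  have "\<forall>\<^sub>F n in sequentially. 0 < ln (real n) / dr n"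
    using ev_d by eventually_elim auto
  then have "filterlim (\<lambda>n. inverse (ln (real n) / dr n)) at_top sequentially"
    by (intro filterlim_inverse_at_top small)
  from filterlim_at_top_mult_at_top[OF this ln_n_at_top]
  show ?thesis
    by (rule filterlim_cong[THEN iffD1, OF refl refl, rotated])
      (use eventually_gt_at_top[of "1::nat"] in eventually_elim, simp)
qed

lemma L_over_d: "(\<lambda>n. L n / dr n) \<longlonglongrightarrow> 0"
  by (rule tendsto_sandwich[OF _ _ tendsto_const small])
    (use ev_L in \<open>eventually_elim, auto intro: divide_right_mono\<close>)+

lemma T_tendsto_0: "T c \<longlonglongrightarrow> 0"
proof -
  have "(\<lambda>n. c * sqrt (2 * (L n / dr n))) \<longlonglongrightarrow> c * sqrt (2 * 0)"
    by (intro tendsto_intros L_over_d)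
  then show ?thesis by (simp add: T_def[abs_def])
qed

text \<open>Per point, the binomial factor contributes exp (1 + L), against which the Chernoff bound
  still offers about exp (- (1 + e) L) after all losses.\<close>

lemma high_tail_1:
  assumes "0 < e"
  shows "(\<lambda>n. \<P>(\<omega> in N n. T (1 + e) n < H n \<omega>)) \<longlonglongrightarrow> 0"
proof -
  \<comment> \<open>The Chernoff parameter loses a factor 1 - y and the moved direction a factor (1
    - 2 y)^2, together at least 1 - 5 y. As (1 - 5 y)(1 + e) = 1, the squared height factor (1 +
    e)^2 still leaves 1 + e.\<close>
  define y where "y = e / (5 * (1 + e))"
  have y: "0 < y" "5 * y < 1" "(1 - 5 * y) * (1 + e) = 1"
    using assms by (auto simp: y_def field_simps)
  \<comment> \<open>\<open>K\<close> is the moment bound for the parameter \<open>k n\<close> and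
    does not depend on \<open>n\<close>; together with the averaging cost 1 / y it amounts to a
    factor exp c per point.\<close>
  define K where "K = exp 1 / (1 - exp (1 - 1 / (1 - y)))"
  have "1 < 1 / (1 - y)" using y by simp
  then have K: "0 < K" by (simp add: K_def)
  define c where "c = ln (K / y)"
  define k where "k n = (1 - y) * ((dr n - 2) / 2)" for n
  define p where "p n = - k n * (dr n * ((1 - 2 * y) * T (1 + e) n)\<^sup>2) + dr n * c" for n
  have "(1 - 5 * y) \<le> (1 - y) * (1 - 2 * y)\<^sup>2"
  proof -
    have "(1 - y) * (1 - 2 * y)\<^sup>2 - (1 - 5 * y) = y\<^sup>2 * (8 - 4 * y)"
      by (simp add: power2_eq_square algebra_simps)
    moreover have "0 \<le> y\<^sup>2 * (8 - 4 * y)"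
      using y by (intro mult_nonneg_nonneg) auto
    ultimately show ?thesis by linarith
  qed
  then have "(1 - 5 * y) * (1 + e)\<^sup>2 \<le> (1 - y) * (1 - 2 * y)\<^sup>2 * (1 + e)\<^sup>2"
    by (intro mult_right_mono) auto
  moreover have "(1 - 5 * y) * (1 + e)\<^sup>2 = 1 + e"
    using y(3) by (simp add: power2_eq_square flip: mult.assoc)
  ultimately have g: "1 + e \<le> (1 - y) * (1 - 2 * y)\<^sup>2 * (1 + e)\<^sup>2" by simp
  \<comment> \<open>For such \<open>dr n\<close> half of e d L absorbs the term 2 (1 + e) L that
    stems from d - 2 in place of d. For large \<open>L n\<close> the remaining bracket is
    nonpositive, so its factor \<open>dr n\<close> can be replaced by 1.\<close>
  have ev_large: "\<forall>\<^sub>F n in sequentially. 4 * (1 + e) / e + 3 \<le> dr n"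
    using d_at_top_1 by (simp add: filterlim_at_top)
  have ev_L_pos: "\<forall>\<^sub>F n in sequentially. 2 * (1 + \<bar>c\<bar>) / e + 1 \<le> L n"
    using L_at_top by (simp add: filterlim_at_top)
  show ?thesis
  proof (rule high_tendsto_0[where p = p and f = "\<lambda>n. 1 + c - e / 2 * L n"])
    show "\<forall>\<^sub>F n in sequentially. \<exists>A\<in>sets (sph {..<d n} (d n)). high_event (d n) (T (1 + e) n) \<subseteq> A \<and>
        measure (sph {..<d n} (d n)) A \<le> exp (p n)"
      using ev_large ev_L_pos ev_d
    proof eventually_elim
      case (elim n)
      have "0 < 4 * (1 + e) / e" "0 < 2 * (1 + \<bar>c\<bar>) / e"
        using assms by (auto intro!: divide_pos_pos)
      then have pos: "3 < dr n" "0 < L n" using elim by linarith+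
      then have d2: "2 < d n" by simp
      have k: "0 < k n" "k n < (dr n - 2) / 2"
        using pos y by (auto simp: k_def mult_less_cancel_right2)
      have eqK: "exp 1 / (1 - exp (1 - (dr n - 2) / 2 / k n)) = K"
      proof -
        have cancel: "z / ((1 - y) * z) = 1 / (1 - y)" if "z \<noteq> 0" for z :: real
          using that by simp
        have "(dr n - 2) / 2 / k n = 1 / (1 - y)"
          unfolding k_def using pos(1) by (intro cancel) simp
        then show ?thesis
          by (simp only: K_def)
      qed
      have "0 < T (1 + e) n"
        using pos assms by (simp add: T_def)
      moreover have "exp (- k n * (dr n * ((1 - 2 * y) * T (1 + e) n)\<^sup>2)) * K ^ d n / y ^ d n = exp (p n)"
      proof -
        have "exp (dr n * c) = (K / y) ^ d n"
          using K y by (simp add: c_def exp_of_nat_mult)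
        then show ?thesis
          unfolding p_def exp_add by (simp add: power_divide)
      qed
      ultimately show ?case
        using high_event_sum[of "d n" y "T (1 + e) n" "k n"] d2 y k unfolding eqK by simp
    qed
    show "\<forall>\<^sub>F n in sequentially. dr n * (1 + L n) + p n \<le> 1 + c - e / 2 * L n"
      using ev_large ev_L_pos T_power2[of "1 + e"]
    proof eventually_elim
      case (elim n)
      have "0 < 4 * (1 + e) / e" "0 < 2 * (1 + \<bar>c\<bar>) / e"
        using assms by (auto intro!: divide_pos_pos)
      then have pos: "3 < dr n" "0 < L n" using elim by linarith+
      have "k n * (dr n * ((1 - 2 * y) * T (1 + e) n)\<^sup>2)
          = ((1 - y) * (1 - 2 * y)\<^sup>2 * (1 + e)\<^sup>2) * (L n * (dr n - 2))"
        unfolding power_mult_distrib elim(3) using pos by (simp add: k_def field_simps)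
      also have "\<dots> \<ge> (1 + e) * (L n * (dr n - 2))"
        using g pos by (intro mult_right_mono) auto
      finally have "p n \<le> dr n * c - (1 + e) * (L n * (dr n - 2))"
        by (simp add: p_def)
      then have "dr n * (1 + L n) + p n \<le> dr n * (1 + c) - e * L n * dr n + 2 * (1 + e) * L n"
        by (simp add: algebra_simps)
      also have "2 * (1 + e) * L n \<le> e / 2 * dr n * L n"
      proof (rule mult_right_mono)
        have "4 * (1 + e) / e \<le> dr n" using elim by simp
        then show "2 * (1 + e) \<le> e / 2 * dr n"
          using assms by (simp add: field_simps)
      qed (use pos in simp)
      also have "dr n * (1 + c) - e * L n * dr n + e / 2 * dr n * L n = dr n * (1 + c - e / 2 * L n)"
        by (simp add: algebra_simps)
      also have "\<dots> \<le> 1 * (1 + c - e / 2 * L n)"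
      proof (rule mult_right_mono_neg)
        have "2 * (1 + \<bar>c\<bar>) / e \<le> L n" using elim by simp
        then have "1 + \<bar>c\<bar> \<le> e / 2 * L n"
          using assms by (simp add: field_simps)
        then show "1 + c - e / 2 * L n \<le> 0" by linarith
      qed (use pos in simp)
      finally show ?case by simp
    qed
    have "filterlim (\<lambda>x. 1 + c - e / 2 * x) at_bot at_top"
      using assms by real_asymp
    from filterlim_compose[OF this L_at_top]
    show "filterlim (\<lambda>n. 1 + c - e / 2 * L n) at_bot sequentially" .
  qed
qed

lemma low_tail_1:
  assumes "0 < e" "e < 1"
  shows "(\<lambda>n. \<P>(\<omega> in N n. H n \<omega> < T (1 - e) n)) \<longlonglongrightarrow> 0"
proof -
  let ?t = "T (1 - e)"
  \<comment> \<open>The cap has measure about exp (- (1 - e)^2 L). Claiming only the exponent 1 - e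
    leaves room for the second-order term of ln (1 - t^2) and for the error 2 t sqrt d, which is of
    order sqrt L; \<open>ev_e\<close> states this. Then \<open>q n * real n\<close> is d exp (e L) /
    4 and outgrows d (1 + L).\<close>
  define q where "q n = exp (- (1 - e) * L n) / 4" for n
  have "(\<lambda>n. (1 - e) * (1 + 2 * (?t n)\<^sup>2) + 2 * sqrt 2 * inverse (sqrt (L n))) \<longlonglongrightarrow> (1 - e) * (1 + 2 * 0\<^sup>2) + 2 * sqrt 2 * 0"
    by (intro tendsto_intros T_tendsto_0 tendsto_inverse_0_at_top
        filterlim_compose[OF sqrt_at_top L_at_top])
  then have ev_e: "\<forall>\<^sub>F n in sequentially. (1 - e) * (1 + 2 * (?t n)\<^sup>2) + 2 * sqrt 2 * inverse (sqrt (L n)) < 1"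
    by (rule order_tendstoD(2)) (use assms in simp)
  have ev_t: "\<forall>\<^sub>F n in sequentially. ?t n < 1 / 2"
    using T_tendsto_0 by (rule order_tendstoD(2)) simp
  have ev_L1: "\<forall>\<^sub>F n in sequentially. 1 \<le> L n"
    using L_at_top by (simp add: filterlim_at_top)
  show ?thesis
  proof (rule low_tendsto_0[where q = q and f = "\<lambda>n. 1 + L n - exp (e * L n) / 8"])
    show "\<forall>\<^sub>F n in sequentially. 0 \<le> q n \<and>
        (\<forall>u. nrm (d n) u = 1 \<longrightarrow> q n \<le> measure (unif_sphere (d n)) {x. ?t n \<le> ip (d n) x u})"
      using ev_e ev_t ev_L1 ev_d T_power2[of "1 - e"]
    proof eventually_elim
      case (elim n)
      have pos: "0 < dr n" "0 < L n" using elim by auto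
      have t: "0 < ?t n" "?t n < 1"
        using pos assms elim by (auto simp: T_def)
      have "(?t n)\<^sup>2 \<le> (1 / 2)\<^sup>2"
        using t elim by (intro power_mono) auto
      then have t2: "(?t n)\<^sup>2 \<le> 1 / 2" by (simp add: power2_eq_square)
      have "2 * ?t n * sqrt (dr n) = (1 - e) * (2 * sqrt 2 * sqrt (L n))"
        using pos by (simp add: T_def real_sqrt_mult real_sqrt_divide)
      also have "sqrt (L n) = inverse (sqrt (L n)) * L n"
        using real_div_sqrt[of "L n"] pos by (simp add: divide_inverse mult.commute)
      finally have a: "2 * ?t n * sqrt (dr n) = (1 - e) * (2 * sqrt 2 * (inverse (sqrt (L n)) * L n))" .
      have "dr n / 2 * (- (?t n)\<^sup>2 - 2 * ((?t n)\<^sup>2)\<^sup>2) \<le> dr n / 2 * ln (1 - (?t n)\<^sup>2)"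
        using t2 pos by (intro mult_left_mono ln_one_minus_pos_lower_bound) auto
      also have "dr n / 2 * (- (?t n)\<^sup>2 - 2 * ((?t n)\<^sup>2)\<^sup>2) = - (dr n / 2 * (?t n)\<^sup>2) * (1 + 2 * (?t n)\<^sup>2)"
        by (simp add: algebra_simps power2_eq_square)
      also have "dr n / 2 * (?t n)\<^sup>2 = (1 - e)\<^sup>2 * L n"
        unfolding elim(5) using pos by simp
      finally have "- (1 - e) * L n * ((1 - e) * (1 + 2 * (?t n)\<^sup>2) + 2 * sqrt 2 * inverse (sqrt (L n)))
          \<le> dr n / 2 * ln (1 - (?t n)\<^sup>2) - 2 * ?t n * sqrt (dr n)"
        using a by (simp add: algebra_simps power2_eq_square)
      moreover have "(1 - e) * L n * ((1 - e) * (1 + 2 * (?t n)\<^sup>2) + 2 * sqrt 2 * inverse (sqrt (L n))) \<le> (1 - e) * L n * 1"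
        using assms pos elim(1) by (intro mult_left_mono) auto
      ultimately have "- (1 - e) * L n \<le> dr n / 2 * ln (1 - (?t n)\<^sup>2) - 2 * ?t n * sqrt (dr n)"
        by linarith
      then have "q n \<le> exp (dr n / 2 * ln (1 - (?t n)\<^sup>2) - 2 * ?t n * sqrt (dr n)) / 4"
        by (simp add: q_def)
      then show ?case
        using cap_lower_exp(1)[OF _ t] elim(4) by (auto simp: q_def intro: order_trans)
    qed
    have lim: "filterlim (\<lambda>x. 1 + x - exp (e * x) / 8) at_bot at_top"
      using assms(1) by real_asymp
    from filterlim_compose[OF lim L_at_top]
    show *: "filterlim (\<lambda>n. 1 + L n - exp (e * L n) / 8) at_bot sequentially" .
    have "\<forall>\<^sub>F n in sequentially. 1 + L n - exp (e * L n) / 8 \<le> 0"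
      using * unfolding filterlim_at_bot by blast
    then show "\<forall>\<^sub>F n in sequentially. dr n * (1 + L n) - q n * real n / 2 \<le> 1 + L n - exp (e * L n) / 8"
      using ev_L ev_d
    proof eventually_elim
      case (elim n)
      have "q n * real n / 2 = dr n * (exp (e * L n) / 8)"
        using elim(2) by (simp add: q_def left_diff_distrib exp_diff exp_minus field_simps)
      then have "dr n * (1 + L n) - q n * real n / 2 = dr n * (1 + L n - exp (e * L n) / 8)"
        by (simp add: algebra_simps)
      also have "\<dots> \<le> 1 * (1 + L n - exp (e * L n) / 8)"
        using elim by (intro mult_right_mono_neg) auto
      finally show ?case by simp
    qed
  qed
qed

lemma conv_1:
  "conv_in_prob N (\<lambda>n \<omega>. sqrt (dr n / L n) * H n \<omega>) (sqrt 2)" "conv_in_prob N H 0"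
proof -
  show "conv_in_prob N (\<lambda>n \<omega>. sqrt (dr n / L n) * H n \<omega>) (sqrt 2)"
  proof (rule conv_in_prob_if_tails[OF ev_N, where g = "\<lambda>n h. sqrt (dr n / L n) * h"])
    fix e :: real assume "0 < e"
    \<comment> \<open>The scaling sqrt (d / L) takes \<open>T c\<close> to c sqrt 2, so a relative
      error of e / sqrt 2 suffices; 1/2 keeps 1 - y positive.\<close>
    define y where "y = min (1 / 2) (e / sqrt 2)"
    have y: "0 < y" "y < 1" "y * sqrt 2 \<le> e"
      using \<open>0 < e\<close> by (auto simp: y_def min_def field_simps)
    have "\<forall>\<^sub>F n in sequentially. 1 \<le> L n"
      using L_at_top by (simp add: filterlim_at_top)
    then have "\<forall>\<^sub>F n in sequentially. \<forall>h. T (1 - y) n \<le> h \<longrightarrow> h \<le> T (1 + y) n \<longrightarrow> \<bar>sqrt (dr n / L n) * h - sqrt 2\<bar> \<le> e"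
      using ev_d
    proof (eventually_elim, intro allI impI)
      fix n h assume n: "1 \<le> L n" "2 \<le> d n \<and> 2 * d n \<le> n \<and> d n < n" and h: "T (1 - y) n \<le> h" "h \<le> T (1 + y) n"
      have T: "sqrt (dr n / L n) * T c n = c * sqrt 2" for c
        using n by (simp add: T_def real_sqrt_mult real_sqrt_divide)
      have "sqrt (dr n / L n) * T (1 - y) n \<le> sqrt (dr n / L n) * h" "sqrt (dr n / L n) * h \<le> sqrt (dr n / L n) * T (1 + y) n"
        using h n by (intro mult_left_mono; simp)+
      then show "\<bar>sqrt (dr n / L n) * h - sqrt 2\<bar> \<le> e"
        using y(3) unfolding T abs_le_iff by (auto simp: algebra_simps)
    qed
    then show "\<exists>s t. (\<lambda>n. \<P>(\<omega> in N n. H n \<omega> < s n)) \<longlonglongrightarrow> 0 \<and> (\<lambda>n. \<P>(\<omega> in N n. t n < H n \<omega>)) \<longlonglongrightarrow> 0 \<and>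
      (\<forall>\<^sub>F n in sequentially. \<forall>h. s n \<le> h \<longrightarrow> h \<le> t n \<longrightarrow> \<bar>sqrt (dr n / L n) * h - sqrt 2\<bar> \<le> e)"
      using high_tail_1[OF y(1)] low_tail_1[OF y(1,2)] by blast
  qed
  show "conv_in_prob N H 0"
  proof (rule conv_in_prob_if_tails[OF ev_N, where g = "\<lambda>n h. h"])
    fix e :: real assume "0 < e"
    \<comment> \<open>As every \<open>T c\<close> tends to 0, any two fixed constants on the two
      sides of 1 will do.\<close>
    have "\<forall>\<^sub>F n in sequentially. T (1 + 1) n < e" "\<forall>\<^sub>F n in sequentially. - e < T (1 - 1 / 2) n"
      using order_tendstoD[OF T_tendsto_0] \<open>0 < e\<close> by auto
    then have "\<forall>\<^sub>F n in sequentially. \<forall>h. T (1 - 1 / 2) n \<le> h \<longrightarrow> h \<le> T (1 + 1) n \<longrightarrow> \<bar>h - 0\<bar> \<le> e"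
      by eventually_elim (auto simp: abs_le_iff)
    then show "\<exists>s t. (\<lambda>n. \<P>(\<omega> in N n. H n \<omega> < s n)) \<longlonglongrightarrow> 0 \<and> (\<lambda>n. \<P>(\<omega> in N n. t n < H n \<omega>)) \<longlonglongrightarrow> 0 \<and>
      (\<forall>\<^sub>F n in sequentially. \<forall>h. s n \<le> h \<longrightarrow> h \<le> t n \<longrightarrow> \<bar>h - 0\<bar> \<le> e)"
      using high_tail_1[of 1] low_tail_1[of "1 / 2"] by (intro exI[of _ "T (1 - 1 / 2)"] exI[of _ "T (1 + 1)"]) auto
  qed
qed

end

end

context height_asymptotics
begin

subsection \<open>Dimension proportional to the logarithm\<close>

lemma d_at_top_2:
  assumes "0 < \<rho>" and lim: "(\<lambda>n. ln (real n) / dr n) \<longlonglongrightarrow> \<rho>"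
  shows "filterlim dr at_top sequentially"
proof -
  have "(\<lambda>n. inverse (ln (real n) / dr n)) \<longlonglongrightarrow> inverse \<rho>"
    using assms by (intro tendsto_inverse) auto
  from filterlim_tendsto_pos_mult_at_top[OF this _ ln_n_at_top]
  have "filterlim (\<lambda>n. inverse (ln (real n) / dr n) * ln (real n)) at_top sequentially"
    using assms(1) by simp
  then show ?thesis
    by (rule filterlim_cong[THEN iffD1, OF refl refl, rotated])
      (use eventually_gt_at_top[of "1::nat"] in eventually_elim, simp)
qed

text \<open>A common cap at level \<open>s\<close> has probability about exp (- a d^2), while the
  binomial factor is about exp (rho d^2) at most; a > rho because \<open>s\<close> exceeds the
  critical height.\<close>

lemma high_tail_2:
  assumes \<rho>: "0 < \<rho>" and lim: "(\<lambda>n. ln (real n) / dr n) \<longlonglongrightarrow> \<rho>"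
    and t: "sqrt (1 - exp (- 2 * \<rho>)) < t" "t < 1"
  shows "(\<lambda>n. \<P>(\<omega> in N n. t < H n \<omega>)) \<longlonglongrightarrow> 0"
proof -
  define h where "h = sqrt (1 - exp (- 2 * \<rho>))"
  have h: "0 < h" "h\<^sup>2 = 1 - exp (- 2 * \<rho>)"
    using \<rho> by (auto simp: h_def)
  \<comment> \<open>Averaging with radius \<open>y\<close> lowers the height from \<open>t\<close>
    to t - 2 y = s, which must stay above the critical height \<open>h\<close>.\<close>
  define s where "s = (h + t) / 2"
  define y where "y = (t - s) / 2"
  have "h < t"
    using t(1) by (simp add: h_def)
  then have s: "h < s" "s < t" "0 < s"
    using h(1) by (simp_all add: s_def)
  have y: "0 < y" "y \<le> 1" "2 * y < t" "t - 2 * y = s"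
    using s t(2) by (auto simp: y_def field_simps)
  define a where "a = - ln (1 - s\<^sup>2) / 2"
  have s2: "0 < 1 - s\<^sup>2"
    using s t by (simp add: abs_square_less_1)
  have "h\<^sup>2 < s\<^sup>2"
    using s h by (intro power_strict_mono) auto
  then have "1 - s\<^sup>2 < exp (- 2 * \<rho>)"
    using h by simp
  then have "ln (1 - s\<^sup>2) < - 2 * \<rho>"
    using s2 by (metis exp_less_cancel_iff exp_ln)
  then have a: "\<rho> < a" by (simp add: a_def)
  have sqrt_s: "sqrt (1 - s\<^sup>2) = exp (- a)"
    using s2 by (simp add: a_def ln_sqrt[symmetric])
  define p where "p n = - a * dr n * (dr n - 2) - dr n * ln y" for n
  have dtop: "filterlim dr at_top sequentially"
    by (rule d_at_top_2[OF \<rho> lim])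
  have ev_rho: "\<forall>\<^sub>F n in sequentially. ln (real n) / dr n < (\<rho> + a) / 2"
    using lim by (rule order_tendstoD(2)) (use a in simp)
  show ?thesis
  proof (rule high_tendsto_0[where p = p and f = "\<lambda>n. - ((a - \<rho>) / 2) * (dr n)\<^sup>2 + (1 + 2 * a - ln y) * dr n"])
    show "\<forall>\<^sub>F n in sequentially. \<exists>A\<in>sets (sph {..<d n} (d n)). high_event (d n) t \<subseteq> A \<and>
        measure (sph {..<d n} (d n)) A \<le> exp (p n)"
      using ev_d
    proof eventually_elim
      case (elim n)
      have "(sqrt (1 - s\<^sup>2) ^ (d n - 2)) ^ d n / y ^ d n = exp (p n)"
      proof -
        have "(sqrt (1 - s\<^sup>2) ^ (d n - 2)) ^ d n = exp (- a * dr n * (dr n - 2))"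
          unfolding sqrt_s using elim by (simp add: of_nat_diff mult_ac flip: exp_of_nat_mult)
        moreover have "y ^ d n = exp (dr n * ln y)"
          using y by (simp add: exp_of_nat_mult)
        ultimately show ?thesis
          unfolding p_def exp_diff by simp
      qed
      then show ?case
        using high_event_cap[of "d n" y t] elim y t by simp
    qed
    show "\<forall>\<^sub>F n in sequentially. dr n * (1 + L n) + p n
        \<le> - ((a - \<rho>) / 2) * (dr n)\<^sup>2 + (1 + 2 * a - ln y) * dr n"
      using ev_rho ev_L ev_d
    proof eventually_elim
      case (elim n)
      have "0 < dr n"
        using elim by simp
      then have "ln (real n) < (\<rho> + a) / 2 * dr n"
        using elim(1) by (simp only: pos_divide_less_eq)
      then have "L n \<le> (\<rho> + a) / 2 * dr n"
        using elim(2) by linarith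
      then have "dr n * L n \<le> dr n * ((\<rho> + a) / 2 * dr n)"
        by (intro mult_left_mono) auto
      moreover have "dr n * ((\<rho> + a) / 2 * dr n) = a * (dr n)\<^sup>2 - (a - \<rho>) / 2 * (dr n)\<^sup>2"
        by (simp add: field_simps power2_eq_square)
      moreover have "dr n * (1 + L n) + p n = dr n * L n - a * (dr n)\<^sup>2 + (1 + 2 * a - ln y) * dr n"
        by (simp add: p_def algebra_simps power2_eq_square)
      ultimately show ?case
        by linarith
    qed
    have "filterlim (\<lambda>x. - ((a - \<rho>) / 2) * x\<^sup>2 + (1 + 2 * a - ln y) * x) at_bot at_top"
      using a by real_asymp
    from filterlim_compose[OF this dtop]
    show "filterlim (\<lambda>n. - ((a - \<rho>) / 2) * (dr n)\<^sup>2 + (1 + 2 * a - ln y) * dr n) at_bot sequentially" .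
  qed
qed

lemma low_tail_2:
  assumes \<rho>: "0 < \<rho>" and lim: "(\<lambda>n. ln (real n) / dr n) \<longlonglongrightarrow> \<rho>"
    and t: "0 < t" "t < sqrt (1 - exp (- 2 * \<rho>))"
  shows "(\<lambda>n. \<P>(\<omega> in N n. H n \<omega> < t)) \<longlonglongrightarrow> 0"
proof -
  have "t\<^sup>2 < (sqrt (1 - exp (- 2 * \<rho>)))\<^sup>2"
    using t by (intro power_strict_mono) auto
  then have t2: "exp (- 2 * \<rho>) < 1 - t\<^sup>2"
    using \<rho> by simp
  then have "- 2 * \<rho> < ln (1 - t\<^sup>2)"
    by (metis exp_gt_zero exp_less_cancel_iff exp_ln order_less_trans)
  moreover define b where "b = - ln (1 - t\<^sup>2) / 2"
  ultimately have b: "b < \<rho>" by simp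
  have t1: "t < 1"
    using t \<rho> by (metis add.commute diff_less_eq exp_gt_zero less_add_same_cancel1 less_trans real_sqrt_lt_1_iff)
  \<comment> \<open>The cap measure is about exp (- b d) and \<open>n\<close> is eventually at least
    exp ((rho - y) d). Hence q n is at least of order exp (y d - 2 sqrt d), which outgrows d L, a
    quantity at most quadratic in d.\<close>
  define y where "y = (\<rho> - b) / 2"
  have y: "0 < y" using b by (simp add: y_def)
  define q where "q n = exp (- b * dr n - 2 * sqrt (dr n)) / 4" for n
  have ev_rho: "\<forall>\<^sub>F n in sequentially. ln (real n) / dr n < \<rho> + 1" "\<forall>\<^sub>F n in sequentially. \<rho> - y < ln (real n) / dr n"
    using order_tendstoD[OF lim] y by auto
  show ?thesis
  proof (rule low_tendsto_0[where q = q and f = "\<lambda>n. dr n + (\<rho> + 1) * (dr n)\<^sup>2 - exp (y * dr n - 2 * sqrt (dr n)) / 8"])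
    show "\<forall>\<^sub>F n in sequentially. 0 \<le> q n \<and>
        (\<forall>u. nrm (d n) u = 1 \<longrightarrow> q n \<le> measure (unif_sphere (d n)) {x. t \<le> ip (d n) x u})"
      using ev_d
    proof eventually_elim
      case (elim n)
      have "2 * t * sqrt (dr n) \<le> 2 * 1 * sqrt (dr n)"
        using t1 by (intro mult_right_mono mult_left_mono) auto
      then have "q n \<le> exp (dr n / 2 * ln (1 - t\<^sup>2) - 2 * t * sqrt (dr n)) / 4"
        by (simp add: q_def b_def mult.commute)
      then show ?case
        using cap_lower_exp(1)[OF _ t(1) t1] elim by (auto simp: q_def intro: order_trans)
    qed
    show "\<forall>\<^sub>F n in sequentially. dr n * (1 + L n) - q n * real n / 2
        \<le> dr n + (\<rho> + 1) * (dr n)\<^sup>2 - exp (y * dr n - 2 * sqrt (dr n)) / 8"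
      using ev_rho ev_L ev_d
    proof eventually_elim
      case (elim n)
      have pos: "0 < dr n" "0 < real n" using elim by auto
      have "ln (real n) < (\<rho> + 1) * dr n"
        using elim(1) pos by (simp only: pos_divide_less_eq)
      then have "L n \<le> (\<rho> + 1) * dr n"
        using elim(3) by linarith
      then have "dr n * L n \<le> dr n * ((\<rho> + 1) * dr n)"
        by (intro mult_left_mono) auto
      moreover have "exp (y * dr n - 2 * sqrt (dr n)) / 8 \<le> q n * real n / 2"
      proof -
        have "(\<rho> - y) * dr n \<le> ln (real n)"
          using elim(2) pos by (simp add: field_simps)
        then have "exp ((\<rho> - y) * dr n) \<le> real n"
          using pos by (subst ln_ge_iff[symmetric])
        then have "q n * exp ((\<rho> - y) * dr n) / 2 \<le> q n * real n / 2"
          by (intro divide_right_mono mult_left_mono) (auto simp: q_def)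
        moreover have "q n * exp ((\<rho> - y) * dr n) / 2 = exp (y * dr n - 2 * sqrt (dr n)) / 8"
        proof -
          have "- b * dr n - 2 * sqrt (dr n) + (\<rho> - y) * dr n = y * dr n - 2 * sqrt (dr n)"
            by (simp add: y_def field_simps)
          then show ?thesis
            unfolding q_def by (simp flip: exp_add)
        qed
        ultimately show ?thesis by linarith
      qed
      ultimately show ?case
        by (simp add: algebra_simps power2_eq_square)
    qed
    have "filterlim (\<lambda>x. x + (\<rho> + 1) * x\<^sup>2 - exp (y * x - 2 * sqrt x) / 8) at_bot at_top"
      using y \<rho> by real_asymp
    from filterlim_compose[OF this d_at_top_2[OF \<rho> lim]]
    show "filterlim (\<lambda>n. dr n + (\<rho> + 1) * (dr n)\<^sup>2 - exp (y * dr n - 2 * sqrt (dr n)) / 8) at_bot sequentially" .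
  qed
qed

lemma conv_2:
  assumes \<rho>: "0 < \<rho>" and lim: "(\<lambda>n. ln (real n) / dr n) \<longlonglongrightarrow> \<rho>"
  shows "conv_in_prob N H (sqrt (1 - exp (- 2 * \<rho>)))"
proof (rule conv_in_prob_if_tails[OF ev_N, where g = "\<lambda>n h. h"])
  fix e :: real assume e: "0 < e"
  define h where "h = sqrt (1 - exp (- 2 * \<rho>))"
  have h: "0 < h" "h < 1"
    using \<rho> by (simp_all add: h_def)
  \<comment> \<open>The bounds h / 2 and (h + 1) / 2 keep \<open>s\<close> positive and
    \<open>t\<close> below 1, as the tail estimates require.\<close>
  define s where "s = max (h / 2) (h - e)"
  define t where "t = min ((h + 1) / 2) (h + e)"
  have s: "0 < s" "s < h" and t: "h < t" "t < 1"
    using h e by (auto simp: s_def t_def min_less_iff_disj)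
  have "\<bar>x - h\<bar> \<le> e" if "s \<le> x" "x \<le> t" for x
    using that by (auto simp: s_def t_def abs_le_iff)
  then show "\<exists>s t. (\<lambda>n. \<P>(\<omega> in N n. H n \<omega> < s n)) \<longlonglongrightarrow> 0 \<and> (\<lambda>n. \<P>(\<omega> in N n. t n < H n \<omega>)) \<longlonglongrightarrow> 0 \<and>
      (\<forall>\<^sub>F n in sequentially. \<forall>x. s n \<le> x \<longrightarrow> x \<le> t n \<longrightarrow> \<bar>x - sqrt (1 - exp (- 2 * \<rho>))\<bar> \<le> e)"
    using high_tail_2[OF \<rho> lim, of t] low_tail_2[OF \<rho> lim, of s] s t
    by (intro exI[of _ "\<lambda>_. s"] exI[of _ "\<lambda>_. t"]) (simp add: h_def)
qed

subsection \<open>Dimension much smaller than the logarithm\<close>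

text \<open>Solves (1 - S^2)^((d - 1) / 2) = n^(- c / 2). A cap of this height has measure roughly
  n^(- c / 2), so c = 2 is critical; \<open>d - 1\<close> instead of \<open>d\<close> matters
  because \<open>d\<close> may be bounded.\<close>

definition S :: "real \<Rightarrow> nat \<Rightarrow> real"
  where "S c n = sqrt (1 - exp (- (c * ln (real n) / (dr n - 1))))"

lemma S_props:
  assumes "2 \<le> d n" "d n < n" "0 < c"
  shows "0 < S c n" "S c n < 1" "1 - (S c n)\<^sup>2 = exp (- (c * ln (real n) / (dr n - 1)))"
proof -
  have "0 < c * ln (real n) / (dr n - 1)"
    using assms by (intro divide_pos_pos mult_pos_pos) auto
  then show "0 < S c n" "S c n < 1" "1 - (S c n)\<^sup>2 = exp (- (c * ln (real n) / (dr n - 1)))"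
    by (auto simp: S_def)
qed

context
  assumes small: "(\<lambda>n. dr n / ln (real n)) \<longlonglongrightarrow> 0"
begin

lemma ev_small: "0 < c \<Longrightarrow> \<forall>\<^sub>F n in sequentially. dr n \<le> c * ln (real n)"
proof -
  assume "0 < c"
  with order_tendstoD(2)[OF small] have "\<forall>\<^sub>F n in sequentially. dr n / ln (real n) < c" .
  then show ?thesis
    using eventually_gt_at_top[of "1::nat"] by eventually_elim (simp add: field_simps)
qed

text \<open>\<open>binomial_le_exp\<close> would be too weak, being of order n^d for bounded
  \<open>d\<close>. The bound n^(d - 1) has the same exponent as the probability that the other
  \<open>d - 1\<close> points are close to the first, so the product is a single power with base n
  2^d r^(d - 1), which is at most n^(- e / 4).\<close>

lemma high_tail_3:
  assumes e: "0 < e"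
  shows "(\<lambda>n. \<P>(\<omega> in N n. S (2 + e) n < H n \<omega>)) \<longlonglongrightarrow> 0"
proof (rule tendsto_0_exp_bound[OF tail_nonneg, where c = 1])
  have e8: "0 < e / 8" using e by simp
  show "\<forall>\<^sub>F n in sequentially. \<P>(\<omega> in N n. S (2 + e) n < H n \<omega>) \<le> 1 * exp (- (e / 4) * ln (real n))"
    using ev_typical ev_d ev_small[OF zero_less_one] ev_small[OF e8]
  proof (eventually_elim, goal_cases)
    case (1 n)
    interpret typical_height_sample "M n" "X n" n "d n" "N n" "H n" by (rule 1(1))
    let ?l = "ln (real n)"
    have dn: "2 \<le> d n" "d n < n" "0 < dr n - 1" and l: "0 < ?l"
      using 1 by auto
    note Sp = S_props[OF dn(1,2), of "2 + e"]
    define r where "r = 2 * sqrt (1 - (S (2 + e) n)\<^sup>2)"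
    have r_eq: "r = 2 * exp (- ((2 + e) * ?l / (dr n - 1)) / 2)"
    proof -
      have "sqrt (exp x) = exp (x / 2)" for x :: real
        by (rule real_sqrt_unique) (simp_all add: power2_eq_square flip: exp_add)
      then show ?thesis
        unfolding r_def using Sp(3) e by simp
    qed
    have "r \<le> 1"
    proof -
      have "1 \<le> ?l / (dr n - 1)"
        using 1 dn by simp
      then have "2 * 1 \<le> (2 + e) * (?l / (dr n - 1))"
        using e by (intro mult_mono) auto
      then have "1 \<le> (2 + e) * ?l / (dr n - 1) / 2"
        by (simp only: le_divide_eq_numeral1 times_divide_eq_right mult_1 mult_1_right)
      then have "exp 1 \<le> exp ((2 + e) * ?l / (dr n - 1) / 2)"
        by (simp only: exp_le_cancel_iff)
      moreover have "2 \<le> exp (1::real)"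
        using exp_ge_add_one_self[of 1] by simp
      ultimately have "2 \<le> exp ((2 + e) * ?l / (dr n - 1) / 2)"
        by linarith
      then show ?thesis
        by (simp add: r_eq exp_minus field_simps)
    qed
    have "\<P>(\<omega> in N n. S (2 + e) n < H n \<omega>) \<le> real ((n - 1) choose (d n - 1)) * (2 ^ d n * r ^ (d n - 1)) ^ (d n - 1)"
      using Sp e dn r_def \<open>r \<le> 1\<close> by (intro high_le high_event_near) auto
    also have "\<dots> \<le> real n ^ (d n - 1) * (2 ^ d n * r ^ (d n - 1)) ^ (d n - 1)"
    proof (intro mult_right_mono)
      have "(n - 1) choose (d n - 1) \<le> (n - 1) ^ (d n - 1)"
        using dn by (intro binomial_le_pow) auto
      also have "\<dots> \<le> n ^ (d n - 1)"
        by (intro power_mono) auto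
      finally show "real ((n - 1) choose (d n - 1)) \<le> real n ^ (d n - 1)"
        by (metis of_nat_le_iff of_nat_power)
    qed (simp add: r_eq)
    also have "\<dots> = (real n * (2 ^ d n * r ^ (d n - 1))) ^ (d n - 1)"
      by (simp add: power_mult_distrib)
    also have "\<dots> \<le> exp (- (e / 4) * ?l) ^ (d n - 1)"
    proof (intro power_mono)
      have "r ^ (d n - 1) = 2 ^ (d n - 1) * exp (- ((2 + e) * ?l / 2))"
      proof -
        have "real (d n - 1) = dr n - 1"
          using dn by (simp add: of_nat_diff)
        moreover have "k * (- (a / k) / 2) = - (a / 2)" if "0 < k" for a k :: real
          using that by simp
        ultimately show ?thesis
          unfolding r_eq power_mult_distrib exp_of_nat_mult[symmetric] using dn(3) by (simp only:)
      qed
      also have "\<dots> \<le> 2 ^ d n * exp (- ((2 + e) * ?l / 2))"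
        by (intro mult_right_mono power_increasing) auto
      finally have "real n * (2 ^ d n * r ^ (d n - 1)) \<le> real n * (2 ^ d n * (2 ^ d n * exp (- ((2 + e) * ?l / 2))))"
        by (intro mult_left_mono) auto
      also have "\<dots> \<le> real n * (exp (dr n) * (exp (dr n) * exp (- ((2 + e) * ?l / 2))))"
      proof -
        have "(2::real) ^ d n \<le> exp 1 ^ d n"
          using exp_ge_add_one_self[of 1] by (intro power_mono) auto
        then have "(2::real) ^ d n \<le> exp (dr n)"
          by (simp flip: exp_of_nat_mult)
        then show ?thesis
          by (intro mult_left_mono mult_mono mult_right_mono) auto
      qed
      also have "\<dots> = exp (?l + (dr n + (dr n + - ((2 + e) * ?l / 2))))"
      proof -
        have "exp ?l = real n" using dn by simp
        then show ?thesis
          by (simp only: exp_add)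
      qed
      \<comment> \<open>The exponent equals 2 d - e l / 2 with l = ln n, and d <= e l / 8.\<close>
      also have "\<dots> \<le> exp (- (e / 4) * ?l)"
        using 1(4) by (simp add: algebra_simps)
      finally show "real n * (2 ^ d n * r ^ (d n - 1)) \<le> exp (- (e / 4) * ?l)" .
    qed (simp add: r_eq)
    also have "\<dots> \<le> exp (- (e / 4) * ?l) ^ 1"
      using e l dn by (intro power_decreasing) auto
    finally show ?case by simp
  qed
  have "filterlim (\<lambda>x. - (e / 4) * x) at_bot at_top"
    using e by real_asymp
  from filterlim_compose[OF this ln_n_at_top]
  show "filterlim (\<lambda>n. - (e / 4) * ln (real n)) at_bot sequentially" .
qed

text \<open>The second form of the cap bound makes q n at least n^(e / 2) exp (- 2 sqrt d) / (12 d).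
  By d <= (e / 8) ln n the exponential costs at most n^(e / 4), and a power of n divided by ln n
  still outgrows ln n (1 + ln n).\<close>

lemma low_tail_3:
  assumes e: "0 < e" "e < 2"
  shows "(\<lambda>n. \<P>(\<omega> in N n. H n \<omega> < S (2 - e) n)) \<longlonglongrightarrow> 0"
proof -
  have e8: "0 < e / 8" using e by simp
  define q where "q n = exp (- ((1 - e / 2) * ln (real n)) - 2 * sqrt (dr n)) / (12 * dr n)" for n
  show ?thesis
  proof (rule low_tendsto_0[where q = q and
        f = "\<lambda>n. ln (real n) * (1 + ln (real n)) - exp (e / 4 * ln (real n)) / (24 * ln (real n))"])
    show "\<forall>\<^sub>F n in sequentially. 0 \<le> q n \<and>
        (\<forall>u. nrm (d n) u = 1 \<longrightarrow> q n \<le> measure (unif_sphere (d n)) {x. S (2 - e) n \<le> ip (d n) x u})"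
      using ev_d
    proof eventually_elim
      case (elim n)
      note Sp = S_props[of n "2 - e"]
      have S2: "1 - (S (2 - e) n)\<^sup>2 = exp (- ((2 - e) * ln (real n) / (dr n - 1)))"
        using Sp(3) e elim by auto
      have "(dr n - 1) / 2 * ln (1 - (S (2 - e) n)\<^sup>2) = - ((1 - e / 2) * ln (real n))"
        unfolding S2 ln_exp using elim by (simp add: field_simps)
      then show ?case
        using cap_lower_exp(2)[of "d n" _ "S (2 - e) n"] Sp(1,2) e elim by (auto simp: q_def)
    qed
    show "\<forall>\<^sub>F n in sequentially. dr n * (1 + L n) - q n * real n / 2
        \<le> ln (real n) * (1 + ln (real n)) - exp (e / 4 * ln (real n)) / (24 * ln (real n))"
      using ev_L ev_d ev_small[OF zero_less_one] ev_small[OF e8]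
    proof (eventually_elim, goal_cases)
      case (1 n)
      let ?l = "ln (real n)"
      have dn: "1 \<le> dr n" "0 < ?l" using 1 by auto
      have "dr n * (1 + L n) \<le> ?l * (1 + ?l)"
        using 1 dn by (intro mult_mono) auto
      moreover have "exp (e / 4 * ?l) / (24 * ?l) \<le> q n * real n / 2"
      proof -
        have "sqrt (dr n) \<le> dr n"
          using dn real_sqrt_le_mono[of "dr n" "(dr n)\<^sup>2"] by (simp add: power2_eq_square)
        then have "e / 4 * ?l \<le> e / 2 * ?l - 2 * sqrt (dr n)"
          using 1 by (simp add: algebra_simps)
        then have "exp (e / 4 * ?l) / (24 * ?l) \<le> exp (e / 2 * ?l - 2 * sqrt (dr n)) / (24 * dr n)"
          using 1 dn by (intro frac_le) auto
        also have "\<dots> = exp (?l + (- ((1 - e / 2) * ?l) - 2 * sqrt (dr n))) / (24 * dr n)"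
          by (simp add: algebra_simps)
        also have "\<dots> = q n * real n / 2"
          unfolding exp_add using 1 by (simp add: q_def)
        finally show ?thesis .
      qed
      ultimately show ?case by linarith
    qed
    have "filterlim (\<lambda>x. x * (1 + x) - exp (e / 4 * x) / (24 * x)) at_bot at_top"
      using e by real_asymp
    from filterlim_compose[OF this ln_n_at_top]
    show "filterlim (\<lambda>n. ln (real n) * (1 + ln (real n)) - exp (e / 4 * ln (real n)) / (24 * ln (real n))) at_bot sequentially" .
  qed
qed

lemma conv_3:
  "conv_in_prob N (\<lambda>n \<omega>. - ((dr n - 1) / ln (real n)) * ln (1 - (H n \<omega>)\<^sup>2)) 2" "conv_in_prob N H 1"
proof -
  show "conv_in_prob N (\<lambda>n \<omega>. - ((dr n - 1) / ln (real n)) * ln (1 - (H n \<omega>)\<^sup>2)) 2"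
  proof (rule conv_in_prob_if_tails[OF ev_N, where g = "\<lambda>n h. - ((dr n - 1) / ln (real n)) * ln (1 - h\<^sup>2)"])
    fix e :: real assume "0 < e"
    \<comment> \<open>The cap at 1 keeps 2 - y positive.\<close>
    define y where "y = min 1 e"
    have y: "0 < y" "y < 2" "y \<le> e"
      using \<open>0 < e\<close> by (auto simp: y_def)
    have "\<forall>\<^sub>F n in sequentially. \<forall>h. S (2 - y) n \<le> h \<longrightarrow> h \<le> S (2 + y) n \<longrightarrow>
        \<bar>- ((dr n - 1) / ln (real n)) * ln (1 - h\<^sup>2) - 2\<bar> \<le> e"
      using ev_d
    proof (eventually_elim, intro allI impI)
      fix n h assume n: "2 \<le> d n \<and> 2 * d n \<le> n \<and> d n < n" and h: "S (2 - y) n \<le> h" "h \<le> S (2 + y) n"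
      let ?k = "(dr n - 1) / ln (real n)"
      have k: "0 < ?k" using n by (intro divide_pos_pos) auto
      have S: "0 < S c n" "S c n < 1" "?k * ln (1 - (S c n)\<^sup>2) = - c" if "0 < c" for c
        using S_props[of n c] n that by auto
      have "0 < h" using h(1) S(1)[of "2 - y"] y by linarith
      have "(S (2 - y) n)\<^sup>2 \<le> h\<^sup>2" "h\<^sup>2 \<le> (S (2 + y) n)\<^sup>2" "(S (2 + y) n)\<^sup>2 < 1"
        using h \<open>0 < h\<close> S(1)[of "2 - y"] S(1,2)[of "2 + y"] y by (auto intro: power_mono simp: abs_square_less_1)
      then have "ln (1 - (S (2 + y) n)\<^sup>2) \<le> ln (1 - h\<^sup>2)" "ln (1 - h\<^sup>2) \<le> ln (1 - (S (2 - y) n)\<^sup>2)"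
        by simp_all
      then have "?k * ln (1 - (S (2 + y) n)\<^sup>2) \<le> ?k * ln (1 - h\<^sup>2)" "?k * ln (1 - h\<^sup>2) \<le> ?k * ln (1 - (S (2 - y) n)\<^sup>2)"
        using k by (intro mult_left_mono; simp)+
      then have "- (2 + y) \<le> ?k * ln (1 - h\<^sup>2)" "?k * ln (1 - h\<^sup>2) \<le> - (2 - y)"
        using S(3)[of "2 + y"] S(3)[of "2 - y"] y by linarith+
      then show "\<bar>- ?k * ln (1 - h\<^sup>2) - 2\<bar> \<le> e"
        using y(3) by (simp only: abs_le_iff mult_minus_left) linarith
    qed
    then show "\<exists>s t. (\<lambda>n. \<P>(\<omega> in N n. H n \<omega> < s n)) \<longlonglongrightarrow> 0 \<and> (\<lambda>n. \<P>(\<omega> in N n. t n < H n \<omega>)) \<longlonglongrightarrow> 0 \<and>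
      (\<forall>\<^sub>F n in sequentially. \<forall>h. s n \<le> h \<longrightarrow> h \<le> t n \<longrightarrow> \<bar>- ((dr n - 1) / ln (real n)) * ln (1 - h\<^sup>2) - 2\<bar> \<le> e)"
      using high_tail_3[OF y(1)] low_tail_3[OF y(1,2)] by blast
  qed
  show "conv_in_prob N H 1"
  proof (rule conv_in_prob_if_tails[OF ev_N, where g = "\<lambda>n h. h"])
    fix e :: real assume "0 < e"
    \<comment> \<open>From d <= c ln n it follows that ln n / (d - 1) is at least |ln e|, hence 1 -
      S <= 1 - S^2 <= e for S = \<open>S 1 n\<close>.\<close>
    define c where "c = 1 / (1 + \<bar>ln e\<bar>)"
    have c: "0 < c" by (simp add: c_def)
    from ev_small[OF this] ev_d
    have "\<forall>\<^sub>F n in sequentially. \<forall>h. S (2 - 1) n \<le> h \<longrightarrow> h \<le> S (2 + 1) n \<longrightarrow> \<bar>h - 1\<bar> \<le> e"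
    proof (eventually_elim, intro allI impI)
      fix n h assume n: "dr n \<le> c * ln (real n)" "2 \<le> d n \<and> 2 * d n \<le> n \<and> d n < n"
        and h: "S (2 - 1) n \<le> h" "h \<le> S (2 + 1) n"
      note S1 = S_props[of n 1] and S3 = S_props[of n 3]
      have "1 - S 1 n \<le> 1 - (S 1 n)\<^sup>2"
        using S1(1,2) n by (simp add: power2_eq_square mult_left_le)
      also have "\<dots> = exp (- (ln (real n) / (dr n - 1)))"
        using S1(3) n by simp
      also have "\<dots> \<le> exp (ln e)"
      proof -
        have "dr n * (1 + \<bar>ln e\<bar>) \<le> ln (real n)"
          using n(1) by (simp add: c_def field_simps)
        moreover have "(dr n - 1) * \<bar>ln e\<bar> \<le> dr n * (1 + \<bar>ln e\<bar>)"
          by (intro mult_mono) auto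
        ultimately have "\<bar>ln e\<bar> \<le> ln (real n) / (dr n - 1)"
          using n(2) by (simp add: pos_le_divide_eq mult.commute)
        then show ?thesis
          by (subst exp_le_cancel_iff) linarith
      qed
      finally have "1 - S 1 n \<le> e"
        using \<open>0 < e\<close> by simp
      then show "\<bar>h - 1\<bar> \<le> e"
        using h S3(2) n by (simp add: abs_le_iff)
    qed
    then show "\<exists>s t. (\<lambda>n. \<P>(\<omega> in N n. H n \<omega> < s n)) \<longlonglongrightarrow> 0 \<and> (\<lambda>n. \<P>(\<omega> in N n. t n < H n \<omega>)) \<longlonglongrightarrow> 0 \<and>
      (\<forall>\<^sub>F n in sequentially. \<forall>h. s n \<le> h \<longrightarrow> h \<le> t n \<longrightarrow> \<bar>h - 1\<bar> \<le> e)"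
      using high_tail_3[OF zero_less_one] low_tail_3[of 1] by (intro exI[of _ "S (2 - 1)"] exI[of _ "S (2 + 1)"]) auto
  qed
qed

end

end

theorem theorem4:
  fixes d :: "nat \<Rightarrow> nat"
    and M :: "nat \<Rightarrow> 'a measure" and X :: "nat \<Rightarrow> nat \<Rightarrow> 'a \<Rightarrow> nat \<Rightarrow> real"
    and N :: "nat \<Rightarrow> 'b measure" and H :: "nat \<Rightarrow> 'b \<Rightarrow> real"
  assumes d_range: "\<forall>\<^sub>F n in sequentially. d n \<in> {2..n - 1}"
    and d_regular: "(\<exists>c. \<forall>\<^sub>F n in sequentially. d n = c) \<or> filterlim d at_top sequentially"
    and sample: "\<And>n. d n \<in> {2..n - 1} \<Longrightarrow> iid_unif_sphere (M n) (X n) n (d n)"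
    and H_typ: "\<And>n. d n \<in> {2..n - 1} \<Longrightarrow> typical_height (M n) (X n) n (d n) (N n) (H n)"
    and d_less_n: "(\<lambda>n. real (d n) / real n) \<longlonglongrightarrow> 0"
  shows
    "((\<lambda>n. ln (real n) / real (d n)) \<longlonglongrightarrow> 0 \<longrightarrow>
        conv_in_prob N (\<lambda>n \<omega>. sqrt (real (d n) / ln (real n / real (d n))) * H n \<omega>) (sqrt 2) \<and>
        conv_in_prob N H 0) \<and>
     (\<forall>\<rho>>0. (\<lambda>n. ln (real n) / real (d n)) \<longlonglongrightarrow> \<rho> \<longrightarrow>
        conv_in_prob N H (sqrt (1 - exp (- 2 * \<rho>)))) \<and>
     ((\<lambda>n. real (d n) / ln (real n)) \<longlonglongrightarrow> 0 \<longrightarrow>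
        conv_in_prob N
          (\<lambda>n \<omega>. - ((real (d n) - 1) / ln (real n)) * ln (1 - (H n \<omega>)\<^sup>2)) 2 \<and>
        conv_in_prob N H 1)"
proof -
  interpret height_asymptotics d M X N H
    by (rule height_asymptotics.intro) fact+
  show ?thesis
    using conv_1 conv_2 conv_3 unfolding L_def by blast
qed

end
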